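(* Let $\Gamma$ be a finitely generated nilpotent group. Then: (1) For any subgroup $G\leq IA^{*}(\Gamma)$, the natural map $\hat{G}\to IA^{*}(\hat{\Gamma})$ is injective; in other words $C(G,\Gamma)=\{e\}$. (2) The image of $IA^{*}(\Gamma)$ is dense in $IA^{*}(\hat{\Gamma})$.
   Context: For a group $X$, $\hat{X}$ is its profinite completion. Let $\Gamma^{*}=(\Gamma/[\Gamma,\Gamma])/tor(\Gamma/[\Gamma,\Gamma])\cong\mathbb{Z}^{d}$. Define $IA^{*}(\Gamma)=\ker(Aut(\Gamma)\to Aut(\Gamma^{*}))$ and $IA^{*}(\hat{\Gamma})=\ker(Aut(\hat{\Gamma})\to Aut(\widehat{\Gamma^{*}})=GL_{d}(\hat{\mathbb{Z}}))$. For $G\leq Aut(\Gamma)$, $C(G,\Gamma)$ is the kernel of the natural map $\hat{G}\to Aut(\hat{\Gamma})$. *)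

theory Defs
  imports "HOL-Algebra.Algebra" "HOL-Analysis.Function_Topology"
begin

definition finitely_generated :: "('a, 'b) monoid_scheme \<Rightarrow> bool" where
  "finitely_generated G \<longleftrightarrow>
     (\<exists>S. finite S \<and> S \<subseteq> carrier G \<and> generate G S = carrier G)"

text \<open>Lower central series: gamma_1 = G, gamma_(i+1) = [gamma_i, G] (indexed from 0 here).\<close>
fun lower_central :: "('a, 'b) monoid_scheme \<Rightarrow> nat \<Rightarrow> 'a set" where
  "lower_central G 0 = carrier G"
| "lower_central G (Suc n) =
     generate G {h \<otimes>\<^bsub>G\<^esub> g \<otimes>\<^bsub>G\<^esub> inv\<^bsub>G\<^esub> h \<otimes>\<^bsub>G\<^esub> inv\<^bsub>G\<^esub> g
                 | h g. h \<in> lower_central G n \<and> g \<in> carrier G}"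

definition nilpotent :: "('a, 'b) monoid_scheme \<Rightarrow> bool" where
  "nilpotent G \<longleftrightarrow> group G \<and> (\<exists>n. lower_central G n = {\<one>\<^bsub>G\<^esub>})"

definition fin_normal :: "('a, 'b) monoid_scheme \<Rightarrow> 'a set set" where
  "fin_normal G = {N. N \<lhd> G \<and> finite (rcosets\<^bsub>G\<^esub> N)}"

definition profinite_completion :: "('a, 'b) monoid_scheme \<Rightarrow> ('a set \<Rightarrow> 'a set) monoid" where
  "profinite_completion G =
     \<lparr>carrier = {f \<in> (\<Pi>\<^sub>E N\<in>fin_normal G. rcosets\<^bsub>G\<^esub> N).
                  \<forall>N\<in>fin_normal G. \<forall>M\<in>fin_normal G. N \<subseteq> M \<longrightarrow> f N \<subseteq> f M},
      monoid.mult = (\<lambda>f g. \<lambda>N\<in>fin_normal G. f N <#>\<^bsub>G\<^esub> g N),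
      monoid.one = (\<lambda>N\<in>fin_normal G. N)\<rparr>"

definition profinite_topology :: "('a, 'b) monoid_scheme \<Rightarrow> ('a set \<Rightarrow> 'a set) topology" where
  "profinite_topology G =
     subtopology (product_topology (\<lambda>N. discrete_topology (rcosets\<^bsub>G\<^esub> N)) (fin_normal G))
                 (carrier (profinite_completion G))"

definition cont_aut :: "('a, 'b) monoid_scheme \<Rightarrow> (('a set \<Rightarrow> 'a set) \<Rightarrow> ('a set \<Rightarrow> 'a set)) set" where
  "cont_aut G = {\<alpha> \<in> auto (profinite_completion G).
                   continuous_map (profinite_topology G) (profinite_topology G) \<alpha>}"

text \<open>The natural map Aut(G) -> Aut(completion of G): the continuous extension,
  (phi x)_N = phi (x_(phi^-1 N)).\<close>
definition aut_ext :: "('a, 'b) monoid_scheme \<Rightarrow> ('a \<Rightarrow> 'a) \<Rightarrow> ('a set \<Rightarrow> 'a set) \<Rightarrow> ('a set \<Rightarrow> 'a set)" where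
  "aut_ext G \<phi> = (\<lambda>x\<in>carrier (profinite_completion G).
                    \<lambda>N\<in>fin_normal G. \<phi> ` (x (\<phi> -` N \<inter> carrier G)))"

text \<open>R = preimage in G of the torsion of G^ab, so that G^* = G / R.\<close>
definition tor_preimage :: "('a, 'b) monoid_scheme \<Rightarrow> 'a set" where
  "tor_preimage G = {g \<in> carrier G. \<exists>n::nat. n > 0 \<and> g [^]\<^bsub>G\<^esub> n \<in> derived G (carrier G)}"

definition Gstar :: "('a, 'b) monoid_scheme \<Rightarrow> 'a set monoid" where
  "Gstar G = G Mod (tor_preimage G)"

definition IA_star :: "('a, 'b) monoid_scheme \<Rightarrow> ('a \<Rightarrow> 'a) set" where
  "IA_star G = {\<phi> \<in> auto G. \<forall>g\<in>carrier G.
                  tor_preimage G #>\<^bsub>G\<^esub> \<phi> g = tor_preimage G #>\<^bsub>G\<^esub> g}"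

text \<open>The natural projection from the completion of G onto the completion of G^*:
  the component at a finite-index normal subgroup Q of G^* is the set of R-cosets
  contained in x_N, where N is the preimage (union) of Q.\<close>
definition star_proj :: "('a, 'b) monoid_scheme \<Rightarrow> ('a set \<Rightarrow> 'a set) \<Rightarrow> ('a set set \<Rightarrow> 'a set set)" where
  "star_proj G = (\<lambda>x\<in>carrier (profinite_completion G).
                    \<lambda>Q\<in>fin_normal (Gstar G). {c \<in> carrier (Gstar G). c \<subseteq> x (\<Union>Q)})"

text \<open>IA^*(completion): kernel of Aut(completion of G) -> Aut(completion of G^*),
  i.e. continuous automorphisms inducing the identity on the completion of G^*.\<close>
definition IA_star_hat :: "('a, 'b) monoid_scheme \<Rightarrow> (('a set \<Rightarrow> 'a set) \<Rightarrow> ('a set \<Rightarrow> 'a set)) set" where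
  "IA_star_hat G = {\<alpha> \<in> cont_aut G. \<forall>x\<in>carrier (profinite_completion G).
                      star_proj G (\<alpha> x) = star_proj G x}"

definition aut_subgroup :: "('a, 'b) monoid_scheme \<Rightarrow> ('a \<Rightarrow> 'a) set \<Rightarrow> ('a \<Rightarrow> 'a) monoid" where
  "aut_subgroup G H = (AutoGroup G)\<lparr>carrier := H\<rparr>"

text \<open>The natural map from the completion of H to Aut(completion of G): the unique continuous
  extension of phi |-> aut_ext G phi. The N-component of h.x is the common value of
  (phi x)_N for phi ranging in a sufficiently small coset h_M of a finite-index normal
  subgroup M of H.\<close>
definition completion_action ::
  "('a, 'b) monoid_scheme \<Rightarrow> ('a \<Rightarrow> 'a) set \<Rightarrow> (('a \<Rightarrow> 'a) set \<Rightarrow> ('a \<Rightarrow> 'a) set)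
     \<Rightarrow> ('a set \<Rightarrow> 'a set) \<Rightarrow> ('a set \<Rightarrow> 'a set)" where
  "completion_action G H h = (\<lambda>x\<in>carrier (profinite_completion G).
     \<lambda>N\<in>fin_normal G. THE c. \<exists>M\<in>fin_normal (aut_subgroup G H).
                               \<forall>\<phi>\<in>h M. aut_ext G \<phi> x N = c)"

definition congruence_kernel ::
  "('a, 'b) monoid_scheme \<Rightarrow> ('a \<Rightarrow> 'a) set \<Rightarrow> (('a \<Rightarrow> 'a) set \<Rightarrow> ('a \<Rightarrow> 'a) set) set" where
  "congruence_kernel G H =
     {h \<in> carrier (profinite_completion (aut_subgroup G H)).
        completion_action G H h = (\<lambda>x\<in>carrier (profinite_completion G). x)}"

end

theory Submission
  imports Defs
begin

text \<open>
  Polycyclic groups are subgroup separable, so the profinite topology of a finitely generated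
  nilpotent group, and of its finite direct powers, restricts well to subgroups; both parts climb
  the lower central series \<open>\<gamma>\<^sub>1 \<supseteq> \<gamma>\<^sub>2 \<supseteq> \<dots>\<close> with this tool.

  For (1), an automorphism in \<open>IA\<^sup>*\<close> that is congruent to the identity modulo a deep
  finite index subgroup is trivial modulo commutators, because the torsion of the abelianization is
  separated from the identity. If it is trivial modulo \<open>\<gamma>\<^sub>k\<close>, its displacements
  \<open>s\<inverse> \<phi>(s)\<close> on the generators \<open>s\<close> depend additively on \<open>\<phi>\<close> modulo
  \<open>\<gamma>\<^sub>k\<^sub>+\<^sub>1\<close>, and separability shows that if they are small they come from any
  prescribed finite index subgroup.

  For (2), an automorphism of the completion is approximated by tuples \<open>t\<close> of elements of the
  group, indexed by the generators. The obstruction against \<open>s \<mapsto> t s\<close> being a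
  homomorphism consists of the values at \<open>t\<close> of the relators of the generators. It is removed one
  degree at a time: in each degree, these obstructions form a coset of a subgroup of a finitely
  generated abelian group (substitution of words acts transitively by translations), and this
  coset contains arbitrarily small elements, hence \<open>0\<close>.
\<close>

section \<open>Polycyclic groups\<close>

text \<open>The subgroups \<open>powers G (carrier G) n\<close> measure closeness throughout. They
  are characteristic, so that one \<open>n\<close> serves all automorphisms, and in a polycyclic
  group those with \<open>n > 0\<close> have finite index and are cofinal among the finite index
  normal subgroups.

  The obstacle in (2) is that tuples carry no group structure compatible with relators. Only the
  changes of relator values form a group, and only because the change caused by a substitution does
  not depend, up to the next degree, on the tuple at which it is made. That independence uses the
  converse of the condition on tuples: a word that is deep at the tuple is already deep at the
  generators. The Hopf property supplies this converse. Relators are taken in a relatively free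
  group instead of a free group, since there they form finitely generated subgroups and a finite
  direct power of \<open>G\<close> can hold all their values.

  Torsion of the abelianization costs an extra argument in (2): the approximating tuples are
  controlled only modulo \<open>tor_preimage G\<close>, so that they generate \<open>G\<close> is
  not automatic; it is derived from the surjectivity of \<alpha>.\<close>

context group
begin

lemma inv_cancel [simp]:
  assumes "x \<in> carrier G" "y \<in> carrier G"
  shows "x \<otimes> (inv x \<otimes> y) = y" "inv x \<otimes> (x \<otimes> y) = y"
  using assms by (simp_all add: m_assoc [symmetric])

lemma subgroup_nat_pow_closed:
  assumes "subgroup H G" "h \<in> H" shows "h [^] (n::nat) \<in> H"
  using subgroup_int_pow_closed[OF assms, of "int n"] by (simp add: int_pow_int)

lemma subgroup_cancel_left:
  assumes "subgroup H G" "x \<in> H" "y \<in> carrier G" "x \<otimes> y \<in> H"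
  shows "y \<in> H"
proof -
  have "inv x \<otimes> (x \<otimes> y) \<in> H"
    by (rule subgroup.m_closed[OF assms(1) subgroup.m_inv_closed[OF assms(1,2)] assms(4)])
  then show ?thesis using assms subgroup.mem_carrier[OF assms(1,2)] by simp
qed

lemma subgroup_cancel_right:
  assumes "subgroup H G" "x \<in> H" "y \<in> carrier G" "y \<otimes> x \<in> H"
  shows "y \<in> H"
proof -
  have "(y \<otimes> x) \<otimes> inv x \<in> H"
    by (rule subgroup.m_closed[OF assms(1,4) subgroup.m_inv_closed[OF assms(1,2)]])
  then show ?thesis using assms subgroup.mem_carrier[OF assms(1,2)] by (simp add: m_assoc)
qed

end

text \<open>Both conjugations are required because \<open>H\<close> may be infinite, where
  invariance under one of them does not give the other. \<open>H\<close> may be any subset, so that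
  the normalizer of a generating set can be formed.\<close>

definition normalizing :: "('a, 'b) monoid_scheme \<Rightarrow> 'a set \<Rightarrow> 'a set" where
  "normalizing G H = {t \<in> carrier G. \<forall>h\<in>H. t \<otimes>\<^bsub>G\<^esub> h \<otimes>\<^bsub>G\<^esub> inv\<^bsub>G\<^esub> t \<in> H \<and> inv\<^bsub>G\<^esub> t \<otimes>\<^bsub>G\<^esub> h \<otimes>\<^bsub>G\<^esub> t \<in> H}"

definition cyc_coset :: "('a, 'b) monoid_scheme \<Rightarrow> 'a set \<Rightarrow> 'a \<Rightarrow> int \<Rightarrow> 'a set" where
  "cyc_coset G H t i = {h \<otimes>\<^bsub>G\<^esub> t [^]\<^bsub>G\<^esub> i | h. h \<in> H}"

definition cyc_ext :: "('a, 'b) monoid_scheme \<Rightarrow> 'a set \<Rightarrow> 'a \<Rightarrow> 'a set" where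
  "cyc_ext G H t = (\<Union>i. cyc_coset G H t i)"

text \<open>A predicate on subsets of one ambient group, so that a subgroup, its cyclic extensions
  and the whole group are compared inside the same structure.\<close>

inductive polycyclic :: "('a, 'b) monoid_scheme \<Rightarrow> 'a set \<Rightarrow> bool" for G where
  trivial: "polycyclic G {\<one>\<^bsub>G\<^esub>}"
| extend: "polycyclic G H \<Longrightarrow> t \<in> normalizing G H \<Longrightarrow> polycyclic G (cyc_ext G H t)"

text \<open>For a subgroup \<open>H\<close> this is the verbal subgroup of \<open>n\<close>-th
  powers, which is invariant under everything that normalizes \<open>H\<close>.\<close>

definition powers :: "('a, 'b) monoid_scheme \<Rightarrow> 'a set \<Rightarrow> nat \<Rightarrow> 'a set" where
  "powers G H n = generate G {x [^]\<^bsub>G\<^esub> n | x. x \<in> H}"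

context group
begin

lemma normalizing_subgroup:
  assumes "H \<subseteq> carrier G"
  shows "subgroup (normalizing G H) G"
proof (rule subgroupI)
  show "normalizing G H \<subseteq> carrier G" by (auto simp: normalizing_def)
  show "normalizing G H \<noteq> {}" using assms by (force simp: normalizing_def)
next
  fix a assume "a \<in> normalizing G H"
  then show "inv a \<in> normalizing G H" by (auto simp: normalizing_def)
next
  fix a b assume a: "a \<in> normalizing G H" and b: "b \<in> normalizing G H"
  then have ab: "a \<in> carrier G" "b \<in> carrier G" by (auto simp: normalizing_def)
  have "(a \<otimes> b) \<otimes> h \<otimes> inv (a \<otimes> b) \<in> H \<and> inv (a \<otimes> b) \<otimes> h \<otimes> (a \<otimes> b) \<in> H" if "h \<in> H" for h
  proof -
    have h: "h \<in> carrier G" using that assms by auto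
    have "a \<otimes> (b \<otimes> h \<otimes> inv b) \<otimes> inv a \<in> H" "inv b \<otimes> (inv a \<otimes> h \<otimes> a) \<otimes> b \<in> H"
      using a b that by (auto simp: normalizing_def)
    then show ?thesis using ab h by (simp add: m_assoc inv_mult_group)
  qed
  then show "a \<otimes> b \<in> normalizing G H" using ab by (auto simp: normalizing_def)
qed

lemma normalizing_self:
  assumes "subgroup H G" shows "H \<subseteq> normalizing G H"
  using assms unfolding normalizing_def
  by (auto simp: subgroup.mem_carrier subgroup.m_closed subgroup.m_inv_closed)

lemma normalizing_conj:
  assumes "t \<in> normalizing G H" "h \<in> H"
  shows "t \<otimes> h \<otimes> inv t \<in> H" "inv t \<otimes> h \<otimes> t \<in> H"
  using assms by (auto simp: normalizing_def)

lemma normalizing_int_pow: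
  assumes "H \<subseteq> carrier G" "t \<in> normalizing G H" shows "t [^] (i::int) \<in> normalizing G H"
  using assms subgroup_int_pow_closed normalizing_subgroup by blast

lemma normal_normalizing:
  assumes "N \<lhd> G" shows "normalizing G N = carrier G"
  using normal.inv_op_closed1[OF assms] normal.inv_op_closed2[OF assms] by (auto simp: normalizing_def)

lemma normalizing_normal:
  assumes "subgroup N G" "carrier G \<subseteq> normalizing G N" shows "N \<lhd> G"
  using assms unfolding normal_inv_iff normalizing_def by auto

lemma normalizing_generate:
  assumes A: "A \<subseteq> carrier G" and t: "t \<in> normalizing G A"
  shows "t \<in> normalizing G (generate G A)"
proof -
  have tc: "t \<in> carrier G" using t by (auto simp: normalizing_def)
  have *: "u \<otimes> h \<otimes> inv u \<in> generate G A"
    if u: "u \<in> carrier G" "\<And>a. a \<in> A \<Longrightarrow> u \<otimes> a \<otimes> inv u \<in> A" and h: "h \<in> generate G A" for u h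
    using h
  proof (induction h rule: generate.induct)
    case one
    then show ?case using u by (simp add: generate.one)
  next
    case (incl h)
    then show ?case using u by (auto intro: generate.incl)
  next
    case (inv h)
    have "inv (u \<otimes> h \<otimes> inv u) \<in> generate G A" using u inv by (auto intro: generate.inv)
    then show ?case using u A inv by (auto simp: inv_mult_group m_assoc)
  next
    case (eng h1 h2)
    have c: "h1 \<in> carrier G" "h2 \<in> carrier G" using eng A generate_in_carrier by auto
    have "(u \<otimes> h1 \<otimes> inv u) \<otimes> (u \<otimes> h2 \<otimes> inv u) \<in> generate G A" using eng by (blast intro: generate.eng)
    then show ?case using c u by (simp add: m_assoc)
  qed
  have "t \<otimes> h \<otimes> inv t \<in> generate G A" "inv t \<otimes> h \<otimes> t \<in> generate G A" if "h \<in> generate G A" for h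
    using *[of t h] *[of "inv t" h] t that tc by (auto simp: normalizing_def)
  then show ?thesis using tc by (auto simp: normalizing_def)
qed

lemma powers_mem:
  assumes "x \<in> H" shows "x [^] n \<in> powers G H n"
  unfolding powers_def using assms by (auto intro: generate.incl)

lemma powers_subgroup:
  assumes "H \<subseteq> carrier G" shows "subgroup (powers G H n) G"
  unfolding powers_def using assms by (intro generate_is_subgroup) auto

lemma powers_subset:
  assumes "subgroup K G" "\<And>x. x \<in> H \<Longrightarrow> x [^] n \<in> K" shows "powers G H n \<subseteq> K"
  unfolding powers_def using assms by (intro generate_subgroup_incl) auto

lemma powers_mono:
  assumes "H \<subseteq> K" shows "powers G H n \<subseteq> powers G K n"
  unfolding powers_def using assms by (intro mono_generate) auto

lemma powers_dvd:
  assumes "H \<subseteq> carrier G" "n dvd m" shows "powers G H m \<subseteq> powers G H n"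
proof (rule powers_subset)
  show "subgroup (powers G H n) G" using assms by (simp add: powers_subgroup)
  fix x assume x: "x \<in> H"
  obtain k where m: "m = n * k" using assms by auto
  have "(x [^] n) [^] k \<in> powers G H n"
    using x assms by (intro subgroup_nat_pow_closed powers_subgroup powers_mem)
  then show "x [^] m \<in> powers G H n" using x assms by (auto simp: m nat_pow_pow)
qed

lemma conj_nat_pow:
  assumes "t \<in> carrier G" "x \<in> carrier G"
  shows "t \<otimes> x [^] (n::nat) \<otimes> inv t = (t \<otimes> x \<otimes> inv t) [^] n"
proof (induction n)
  case (Suc n)
  have "t \<otimes> x [^] Suc n \<otimes> inv t = (t \<otimes> x [^] n \<otimes> inv t) \<otimes> (t \<otimes> x \<otimes> inv t)"
    using assms by (simp add: m_assoc)
  then show ?case using Suc by simp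
qed (use assms in auto)

lemma normalizing_powers:
  assumes H: "H \<subseteq> carrier G" and t: "t \<in> normalizing G H"
  shows "t \<in> normalizing G (powers G H n)"
  unfolding powers_def
proof (rule normalizing_generate)
  show "{x [^] n |x. x \<in> H} \<subseteq> carrier G" using H by auto
  have tc: "t \<in> carrier G" using t by (auto simp: normalizing_def)
  have "t \<otimes> x [^] n \<otimes> inv t \<in> {x [^] n |x. x \<in> H}" "inv t \<otimes> x [^] n \<otimes> t \<in> {x [^] n |x. x \<in> H}"
    if x: "x \<in> H" for x
    using conj_nat_pow[of t x n] conj_nat_pow[of "inv t" x n] normalizing_conj[OF t x] x tc H by auto
  then show "t \<in> normalizing G {x [^] n |x. x \<in> H}" using tc unfolding normalizing_def by blast
qed

lemma powers_normal: "powers G (carrier G) n \<lhd> G"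
proof (rule normalizing_normal)
  show "subgroup (powers G (carrier G) n) G" by (simp add: powers_subgroup)
  have "carrier G \<subseteq> normalizing G (carrier G)" by (auto simp: normalizing_def)
  then show "carrier G \<subseteq> normalizing G (powers G (carrier G) n)"
    using normalizing_powers[of "carrier G"] by blast
qed

lemma cyc_cosetI: "h \<in> H \<Longrightarrow> h \<otimes> t [^] i \<in> cyc_coset G H t i"
  by (auto simp: cyc_coset_def)

section \<open>Subgroups of a cyclic extension\<close>

context
  fixes H t
  assumes H: "subgroup H G" and t: "t \<in> normalizing G H"
begin

lemma cyc_t_closed: "t \<in> carrier G"
  using t by (simp add: normalizing_def)

lemma cyc_coset_closed: "cyc_coset G H t i \<subseteq> carrier G"
  using H cyc_t_closed by (auto simp: cyc_coset_def subgroup.mem_carrier)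

lemma cyc_coset_zero: "cyc_coset G H t 0 = H"
  using H by (force simp: cyc_coset_def subgroup.mem_carrier)

lemma cyc_coset_mult:
  assumes "a \<in> cyc_coset G H t i" "b \<in> cyc_coset G H t j"
  shows "a \<otimes> b \<in> cyc_coset G H t (i + j)"
proof -
  obtain h k where h: "h \<in> H" "a = h \<otimes> t [^] i" and k: "k \<in> H" "b = k \<otimes> t [^] j"
    using assms by (auto simp: cyc_coset_def)
  have c: "h \<in> carrier G" "k \<in> carrier G" using h k H by (auto simp: subgroup.mem_carrier)
  have "t [^] i \<otimes> k \<otimes> inv (t [^] i) \<in> H"
    using normalizing_conj[OF normalizing_int_pow[OF subgroup.subset[OF H] t]] k by blast
  then have "h \<otimes> (t [^] i \<otimes> k \<otimes> inv (t [^] i)) \<in> H" using h H by (simp add: subgroup.m_closed)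
  moreover have "a \<otimes> b = (h \<otimes> (t [^] i \<otimes> k \<otimes> inv (t [^] i))) \<otimes> t [^] (i + j)"
    using c cyc_t_closed h k by (simp add: int_pow_mult m_assoc)
  ultimately show ?thesis by (auto simp: cyc_coset_def)
qed

lemma cyc_coset_inv:
  assumes "a \<in> cyc_coset G H t i"
  shows "inv a \<in> cyc_coset G H t (- i)"
proof -
  obtain h where h: "h \<in> H" "a = h \<otimes> t [^] i"
    using assms by (auto simp: cyc_coset_def)
  have c: "h \<in> carrier G" using h H by (auto simp: subgroup.mem_carrier)
  have "inv (t [^] i) \<otimes> inv h \<otimes> t [^] i \<in> H"
    using normalizing_conj[OF normalizing_int_pow[OF subgroup.subset[OF H] t]] h H
    by (simp add: subgroup.m_inv_closed)
  moreover have "inv a = (inv (t [^] i) \<otimes> inv h \<otimes> t [^] i) \<otimes> t [^] (- i)"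
    using c cyc_t_closed h by (simp add: int_pow_neg m_assoc inv_mult_group)
  ultimately show ?thesis by (auto simp: cyc_coset_def)
qed

lemma cyc_coset_nat_pow:
  assumes "a \<in> cyc_coset G H t i"
  shows "a [^] (n::nat) \<in> cyc_coset G H t (i * int n)"
proof (induction n)
  case 0
  then show ?case using H by (simp add: cyc_coset_zero subgroup.one_closed)
next
  case (Suc n)
  show ?case using cyc_coset_mult[OF Suc assms] by (simp add: algebra_simps)
qed

lemma cyc_coset_int_pow:
  assumes "a \<in> cyc_coset G H t i"
  shows "a [^] (j::int) \<in> cyc_coset G H t (i * j)"
proof (cases "j \<ge> 0")
  case True
  then show ?thesis using cyc_coset_nat_pow[OF assms, of "nat j"] int_pow_int[of G a "nat j"] by simp
next
  case False
  have ac: "a \<in> carrier G" using assms cyc_coset_closed by blast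
  have "a [^] j = inv (a [^] nat (- j))"
    using int_pow_neg_int[OF ac, of "nat (- j)"] False by simp
  then show ?thesis using cyc_coset_inv[OF cyc_coset_nat_pow[OF assms, of "nat (- j)"]] False by simp
qed

lemma cyc_ext_subgroup: "subgroup (cyc_ext G H t) G"
proof (rule subgroupI)
  show "cyc_ext G H t \<subseteq> carrier G" using cyc_coset_closed by (auto simp: cyc_ext_def)
  show "cyc_ext G H t \<noteq> {}" using cyc_coset_zero subgroup.one_closed[OF H] unfolding cyc_ext_def by blast
  show "inv a \<in> cyc_ext G H t" if "a \<in> cyc_ext G H t" for a
    using that cyc_coset_inv unfolding cyc_ext_def by blast
  show "a \<otimes> b \<in> cyc_ext G H t" if "a \<in> cyc_ext G H t" "b \<in> cyc_ext G H t" for a b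
    using that cyc_coset_mult unfolding cyc_ext_def by blast
qed

lemma subset_cyc_ext: "H \<subseteq> cyc_ext G H t"
  using cyc_coset_zero unfolding cyc_ext_def by blast

lemma cyc_ext_mem: "t \<in> cyc_ext G H t"
  using cyc_cosetI[OF subgroup.one_closed[OF H], of t 1] cyc_t_closed unfolding cyc_ext_def by auto

lemma cyc_ext_int_pow_mem: "h \<in> H \<Longrightarrow> h \<otimes> t [^] (i::int) \<in> cyc_ext G H t"
  using cyc_cosetI[of h H t i] unfolding cyc_ext_def by auto

lemma cyc_ext_least:
  assumes "subgroup K G" "H \<subseteq> K" "t \<in> K" shows "cyc_ext G H t \<subseteq> K"
  using assms unfolding cyc_ext_def cyc_coset_def
  by (auto intro!: subgroup.m_closed subgroup_int_pow_closed)

lemma cyc_ext_normalizing: "cyc_ext G H t \<subseteq> normalizing G H"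
  using t by (intro cyc_ext_least normalizing_subgroup subgroup.subset H normalizing_self)

text \<open>As for subgroups of the integers: \<open>h\<close> is taken from the coset of the least
  positive power of \<open>t\<close> that meets \<open>K\<close>, and division with remainder
  reduces every element of \<open>K\<close> to \<open>K \<inter> H\<close> by a power of
  \<open>h\<close>.\<close>

lemma subgroup_cyc_ext_cases:
  assumes K: "subgroup K G" "K \<subseteq> cyc_ext G H t"
  obtains "K \<subseteq> H"
  | j h where "j > 0" "h \<in> K" "h \<in> cyc_coset G H t j" "h \<in> normalizing G (K \<inter> H)"
      "K = cyc_ext G (K \<inter> H) h"
proof (cases "K \<subseteq> H")
  case True
  then show ?thesis using that by blast
next
  case False
  define I where "I = {n::nat. n > 0 \<and> K \<inter> cyc_coset G H t (int n) \<noteq> {}}"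
  obtain k where k: "k \<in> K" "k \<notin> H" using False by auto
  then obtain i where i: "k \<in> cyc_coset G H t i" using K by (auto simp: cyc_ext_def)
  have "i \<noteq> 0" using i k cyc_coset_zero by auto
  have "nat \<bar>i\<bar> \<in> I"
  proof (cases "i > 0")
    case True
    then show ?thesis using i k by (auto simp: I_def)
  next
    case False
    have "inv k \<in> K \<inter> cyc_coset G H t (- i)" using cyc_coset_inv[OF i] k K by (simp add: subgroup.m_inv_closed)
    then show ?thesis using False \<open>i \<noteq> 0\<close> by (auto simp: I_def)
  qed
  define m where "m = (LEAST n. n \<in> I)"
  have m: "m \<in> I" and min: "\<And>n. n \<in> I \<Longrightarrow> m \<le> n"
    unfolding m_def using \<open>nat \<bar>i\<bar> \<in> I\<close> by (auto intro: LeastI Least_le)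
  then obtain h where h: "h \<in> K" "h \<in> cyc_coset G H t (int m)" and "m > 0" by (auto simp: I_def)
  have hc: "h \<in> carrier G" by (rule subgroup.mem_carrier[OF K(1) h(1)])
  have KH: "subgroup (K \<inter> H) G" using K H by (simp add: subgroups_Inter_pair)
  have hn: "h \<in> normalizing G (K \<inter> H)"
  proof -
    have "h \<in> normalizing G H" "h \<in> normalizing G K"
      using h(1) K(2) cyc_ext_normalizing normalizing_self[OF K(1)] by blast+
    then show ?thesis by (auto simp: normalizing_def)
  qed
  have "x \<in> cyc_ext G (K \<inter> H) h" if x: "x \<in> K" for x
  proof -
    have xc: "x \<in> carrier G" by (rule subgroup.mem_carrier[OF K(1) x])
    obtain i where i: "x \<in> cyc_coset G H t i" using x K by (auto simp: cyc_ext_def)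
    define q r where "q = i div int m" and "r = i mod int m"
    have r: "0 \<le> r" "r < int m" "i = int m * q + r" using \<open>m > 0\<close> by (auto simp: q_def r_def)
    have "x \<otimes> h [^] (- q) \<in> cyc_coset G H t (i + int m * (- q))"
      by (intro cyc_coset_mult cyc_coset_int_pow i h)
    then have 1: "x \<otimes> h [^] (- q) \<in> cyc_coset G H t r" using r by simp
    have 2: "x \<otimes> h [^] (- q) \<in> K"
      using x h K by (intro subgroup.m_closed subgroup_int_pow_closed)
    have "r = 0"
    proof (rule ccontr)
      assume "r \<noteq> 0"
      then have "nat r \<in> I" using 1 2 r by (auto simp: I_def)
      then show False using min r by fastforce
    qed
    then have 3: "x \<otimes> h [^] (- q) \<in> K \<inter> H" using 1 2 cyc_coset_zero by auto
    have "x = (x \<otimes> h [^] (- q)) \<otimes> h [^] q" using xc hc by (simp add: int_pow_neg m_assoc)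
    then show ?thesis using cyc_cosetI[OF 3, of h q] by (auto simp: cyc_ext_def)
  qed
  moreover have "cyc_ext G (K \<inter> H) h \<subseteq> K"
    using K h unfolding cyc_ext_def cyc_coset_def
    by (auto intro!: subgroup.m_closed subgroup_int_pow_closed)
  ultimately have "K = cyc_ext G (K \<inter> H) h" by blast
  then show ?thesis using that(2)[of "int m" h] h hn \<open>m > 0\<close> by simp
qed

end

section \<open>Finiteness properties and separability of polycyclic groups\<close>

lemma polycyclic_subgroup:
  assumes "polycyclic G E" shows "subgroup E G"
  using assms by (induction) (auto intro: triv_subgroup cyc_ext_subgroup)

text \<open>Along the cyclic extensions, generators of \<open>K \<inter> H\<close> and at most one
  further element generate \<open>K\<close>.\<close>

lemma polycyclic_subgroup_fin_gen:
  assumes "polycyclic G E" "subgroup K G" "K \<subseteq> E"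
  shows "\<exists>T. finite T \<and> T \<subseteq> K \<and> generate G T = K"
  using assms
proof (induction arbitrary: K)
  case trivial
  then have "K = {\<one>}" using subgroup.one_closed by blast
  then have "generate G {} = K" by (simp add: generate_empty)
  then show ?case by blast
next
  case (extend H t)
  have H: "subgroup H G" by (rule polycyclic_subgroup[OF extend(1)])
  from H extend(2) extend(4,5) show ?case
  proof (cases rule: subgroup_cyc_ext_cases)
    case 1
    then show ?thesis using extend by blast
  next
    case (2 j h)
    have KH: "subgroup (K \<inter> H) G" using extend H by (simp add: subgroups_Inter_pair)
    then obtain T where T: "finite T" "T \<subseteq> K \<inter> H" "generate G T = K \<inter> H"
      using extend.IH[of "K \<inter> H"] by blast
    have sub: "insert h T \<subseteq> K" using T 2 by auto
    then have sg: "subgroup (generate G (insert h T)) G"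
      using subgroup.subset[OF extend.prems(1)] by (intro generate_is_subgroup) auto
    have "K \<inter> H \<subseteq> generate G (insert h T)" using mono_generate[of T "insert h T"] T by auto
    then have "K \<subseteq> generate G (insert h T)"
      using cyc_ext_least[OF KH 2(4) sg] 2(5) by (metis generate.incl insertI1)
    moreover have "generate G (insert h T) \<subseteq> K"
      using sub extend.prems by (intro generate_subgroup_incl)
    ultimately show ?thesis using T sub by (intro exI[of _ "insert h T"]) auto
  qed
qed

text \<open>The union of the chain is a finitely generated subgroup, and finitely many generators
  already lie in one member. This drives the Hopf argument below.\<close>

lemma ascending_subgroups_stable:
  fixes U :: "nat \<Rightarrow> 'a set"
  assumes E: "polycyclic G E" and U: "\<And>n. subgroup (U n) G" "\<And>n. U n \<subseteq> E" "\<And>n. U n \<subseteq> U (Suc n)"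
  shows "\<exists>n. U (Suc n) = U n"
proof -
  have mono: "U m \<subseteq> U n" if "m \<le> n" for m n using U(3) that by (rule lift_Suc_mono_le)
  have sg: "subgroup (\<Union>n. U n) G"
  proof (rule subgroupI)
    show "(\<Union>n. U n) \<subseteq> carrier G" using subgroup.subset[OF U(1)] by blast
    show "(\<Union>n. U n) \<noteq> {}" using subgroup.one_closed[OF U(1)] by blast
    show "inv a \<in> (\<Union>n. U n)" if "a \<in> (\<Union>n. U n)" for a
      using that subgroup.m_inv_closed[OF U(1)] by blast
    show "a \<otimes> b \<in> (\<Union>n. U n)" if "a \<in> (\<Union>n. U n)" "b \<in> (\<Union>n. U n)" for a b
    proof -
      obtain m n where "a \<in> U m" "b \<in> U n" using \<open>a \<in> (\<Union>n. U n)\<close> \<open>b \<in> (\<Union>n. U n)\<close> by auto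
      then have "a \<in> U (max m n)" "b \<in> U (max m n)" using mono[of m "max m n"] mono[of n "max m n"] by auto
      then show ?thesis using subgroup.m_closed[OF U(1)] by blast
    qed
  qed
  moreover have "(\<Union>n. U n) \<subseteq> E" using U by auto
  ultimately obtain T where T: "finite T" "T \<subseteq> (\<Union>n. U n)" "generate G T = (\<Union>n. U n)"
    using polycyclic_subgroup_fin_gen[OF E] by meson
  then have "\<exists>f. \<forall>x\<in>T. x \<in> U (f x)" by (intro bchoice) auto
  then obtain f where f: "\<forall>x\<in>T. x \<in> U (f x)" by blast
  define n where "n = Max (f ` T)"
  have "T \<subseteq> U n"
  proof
    fix x assume "x \<in> T"
    then have "f x \<le> n" unfolding n_def using T by (intro Max_ge) auto
    then show "x \<in> U n" using f \<open>x \<in> T\<close> mono by blast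
  qed
  then have "(\<Union>n. U n) \<subseteq> U n" using generate_subgroup_incl U(1) T(3) by metis
  then show ?thesis using U(3)[of n] by blast
qed

text \<open>A polycyclic group of finite exponent is finite: dividing the exponent of
  \<open>t\<close> by \<open>n\<close> leaves finitely many powers of \<open>t\<close> and an
  element of the smaller group. Asking \<open>V\<close> to be normalized by \<open>E\<close>,
  instead of lying in it, allows the induction to keep the same \<open>V\<close>.\<close>

lemma polycyclic_finite_reps:
  assumes "polycyclic G E" "subgroup V G" "E \<subseteq> normalizing G V" "(n::nat) > 0" "\<And>x. x \<in> E \<Longrightarrow> x [^] n \<in> V"
  shows "\<exists>T. finite T \<and> T \<subseteq> E \<and> (\<forall>x\<in>E. \<exists>a\<in>T. inv a \<otimes> x \<in> V)"
  using assms
proof (induction)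
  case trivial
  then show ?case by (intro exI[of _ "{\<one>}"]) (auto simp: subgroup.one_closed)
next
  case (extend H t)
  have H: "subgroup H G" by (rule polycyclic_subgroup[OF extend(1)])
  note HE = subset_cyc_ext[OF H extend(2)]
  have tE: "t \<in> cyc_ext G H t" by (rule cyc_ext_mem[OF H extend(2)])
  have "\<exists>T. finite T \<and> T \<subseteq> H \<and> (\<forall>x\<in>H. \<exists>a\<in>T. inv a \<otimes> x \<in> V)"
    using extend.prems HE by (intro extend.IH) auto
  then obtain T where T: "finite T" "T \<subseteq> H" "\<And>x. x \<in> H \<Longrightarrow> \<exists>a\<in>T. inv a \<otimes> x \<in> V"
    by blast
  have tc: "t \<in> carrier G" using extend by (simp add: normalizing_def)
  define T' where "T' = (\<lambda>(a, r). a \<otimes> t [^] int r) ` (T \<times> {..<n})"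
  have "\<exists>b\<in>T'. inv b \<otimes> x \<in> V" if x: "x \<in> cyc_ext G H t" for x
  proof -
    obtain h i where h: "h \<in> H" "x = h \<otimes> t [^] (i::int)" using x by (auto simp: cyc_ext_def cyc_coset_def)
    obtain a where a: "a \<in> T" "inv a \<otimes> h \<in> V" using T h by blast
    have c: "a \<in> carrier G" "h \<in> carrier G" using a T h H by (auto dest: subgroup.mem_carrier)
    define q r where "q = i div int n" and "r = nat (i mod int n)"
    have r: "r < n" "i = int r + int n * q" using \<open>n > 0\<close> by (auto simp: q_def r_def nat_less_iff)
    have ti: "t [^] i = t [^] int r \<otimes> (t [^] n) [^] q"
      using tc by (simp add: r int_pow_mult int_pow_pow flip: int_pow_int)
    have "t [^] int r \<in> normalizing G V"
      using normalizing_int_pow[OF subgroup.subset[OF extend.prems(1)]] extend.prems(2) tE by blast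
    then have "inv (t [^] int r) \<otimes> (inv a \<otimes> h) \<otimes> t [^] int r \<in> V"
      using a(2) by (rule normalizing_conj)
    moreover have "(t [^] n) [^] q \<in> V"
      using subgroup_int_pow_closed[OF extend.prems(1)] extend.prems(4)[OF tE] by blast
    ultimately have "(inv (t [^] int r) \<otimes> (inv a \<otimes> h) \<otimes> t [^] int r) \<otimes> (t [^] n) [^] q \<in> V"
      using extend.prems(1) by (simp add: subgroup.m_closed)
    then have "inv (a \<otimes> t [^] int r) \<otimes> x \<in> V"
      using c tc by (simp add: h ti inv_mult_group m_assoc)
    then show ?thesis using a r by (auto simp: T'_def)
  qed
  moreover have "finite T'" using T by (auto simp: T'_def)
  moreover have "T' \<subseteq> cyc_ext G H t"
    using T cyc_ext_int_pow_mem[OF H extend(2)] by (auto simp: T'_def)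
  ultimately show ?case by blast
qed

text \<open>Two of the powers \<open>x [^] i\<close> with \<open>i \<le> card T\<close> lie in one
  coset, so some positive exponent up to \<open>card T\<close> brings \<open>x\<close> into
  \<open>N\<close>. The factorial is a common multiple of all these exponents and serves every
  \<open>x\<close>.\<close>

lemma finite_reps_exponent:
  assumes N: "subgroup N G" and E: "subgroup E G" and T: "finite T" "T \<subseteq> carrier G"
    and reps: "\<And>x. x \<in> E \<Longrightarrow> \<exists>a\<in>T. inv a \<otimes> x \<in> N" and x: "x \<in> E"
  shows "x [^] (fact (card T) :: nat) \<in> N"
proof -
  have xc: "x \<in> carrier G" by (rule subgroup.mem_carrier[OF E x])
  have "\<exists>f. \<forall>i::nat. f i \<in> T \<and> inv (f i) \<otimes> x [^] i \<in> N"
    using reps subgroup_nat_pow_closed[OF E x] by (intro choice) blast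
  then obtain f where f: "\<And>i::nat. f i \<in> T" "\<And>i::nat. inv (f i) \<otimes> x [^] i \<in> N" by blast
  have "\<not> inj_on f {..card T}"
    using T f(1) card_inj_on_le[of f "{..card T}" T] by auto
  then obtain i j where ij: "i \<le> card T" "j \<le> card T" "i < j" "f i = f j"
    unfolding inj_on_def by (metis atMost_iff linorder_neqE_nat)
  have fc: "f i \<in> carrier G" using f T by blast
  have "inv (inv (f i) \<otimes> x [^] i) \<otimes> (inv (f j) \<otimes> x [^] j) \<in> N"
    by (rule subgroup.m_closed[OF N subgroup.m_inv_closed[OF N f(2)] f(2)])
  moreover have "inv (inv (f i) \<otimes> x [^] i) \<otimes> (inv (f j) \<otimes> x [^] j) = inv (x [^] i) \<otimes> x [^] j"
    using fc xc ij(4)[symmetric] by (simp add: inv_mult_group m_assoc)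
  moreover have "x [^] j = x [^] i \<otimes> x [^] (j - i)" using xc ij by (simp add: nat_pow_mult)
  ultimately have "x [^] (j - i) \<in> N" using xc by simp
  moreover have "(j - i) dvd fact (card T)" using ij by (intro dvd_fact) auto
  then obtain k where "fact (card T) = (j - i) * k" by auto
  ultimately show ?thesis
    using subgroup_nat_pow_closed[OF N, of "x [^] (j - i)" k] xc by (simp add: nat_pow_pow)
qed

text \<open>Subgroup separability of polycyclic groups: the profinite topology of \<open>E\<close>
  induces on \<open>H\<close> a topology in which \<open>K\<close> is open.\<close>

lemma polycyclic_separation:
  assumes "polycyclic G E" "subgroup H G" "H \<subseteq> E" "subgroup K G" "m > 0"
    and "\<And>h. h \<in> H \<Longrightarrow> h [^] (m::nat) \<in> K"
  shows "\<exists>n>0. H \<inter> powers G E n \<subseteq> K"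
  using assms
proof (induction arbitrary: H K)
  case trivial
  then have "H \<subseteq> K" using subgroup.one_closed[of K G] by auto
  then show ?case by (intro exI[of _ 1]) auto
next
  case (extend \<Delta> t)
  let ?E = "cyc_ext G \<Delta> t"
  have D: "subgroup \<Delta> G" by (rule polycyclic_subgroup[OF extend(1)])
  have tn: "t \<in> normalizing G \<Delta>" by fact
  have tc: "t \<in> carrier G" using tn by (simp add: normalizing_def)
  have E: "subgroup ?E G" by (rule cyc_ext_subgroup[OF D tn])
  have "subgroup (H \<inter> \<Delta>) G" "subgroup (K \<inter> \<Delta>) G"
    using extend D by (simp_all add: subgroups_Inter_pair)
  then have "\<exists>n>0. H \<inter> \<Delta> \<inter> powers G \<Delta> n \<subseteq> K \<inter> \<Delta>"
    using extend.prems D by (intro extend.IH) (auto simp: subgroup_nat_pow_closed)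
  then obtain n where n: "n > 0" "H \<inter> \<Delta> \<inter> powers G \<Delta> n \<subseteq> K" by blast
  define N where "N = powers G \<Delta> n"
  have Nsg: "subgroup N G" unfolding N_def using D by (simp add: powers_subgroup subgroup.subset)
  have ND: "N \<subseteq> \<Delta>" unfolding N_def using D by (intro powers_subset) (auto simp: subgroup_nat_pow_closed)
  have EN: "?E \<subseteq> normalizing G N"
    unfolding N_def using cyc_ext_normalizing[OF D tn] normalizing_powers[OF subgroup.subset[OF D]] by blast
  have "\<exists>T. finite T \<and> T \<subseteq> \<Delta> \<and> (\<forall>x\<in>\<Delta>. \<exists>a\<in>T. inv a \<otimes> x \<in> N)"
    using EN subset_cyc_ext[OF D tn] n(1)
    by (intro polycyclic_finite_reps[OF extend(1) Nsg, of n]) (auto simp: N_def powers_mem)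
  then obtain T where T: "finite T" "T \<subseteq> \<Delta>" "\<And>x. x \<in> \<Delta> \<Longrightarrow> \<exists>a\<in>T. inv a \<otimes> x \<in> N"
    by blast
  \<comment> \<open>\<open>g\<close> generates, together with \<open>N\<close>, a subgroup of finite index of \<open>E\<close>.\<close>
  have "\<exists>g j. j > 0 \<and> g \<in> cyc_coset G \<Delta> t j \<and> cyc_ext G N g \<inter> H \<subseteq> K"
    using D tn extend.prems(1,2)
  proof (cases rule: subgroup_cyc_ext_cases)
    case 1
    show ?thesis
    proof (cases "\<exists>r>0. t [^] (r::int) \<in> \<Delta>")
      case True
      then obtain r where r: "r > 0" "t [^] (r::int) \<in> \<Delta>" by blast
      \<comment> \<open>If \<open>t\<close> has finite order modulo \<open>\<Delta>\<close>, a
        suitable power of \<open>t\<close> lies in \<open>N\<close> already, and adjoining it does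
        not enlarge \<open>N\<close>.\<close>
      define g where "g = (t [^] r) [^] n"
      have gN: "g \<in> N" unfolding g_def N_def using r by (intro powers_mem)
      have "g = \<one> \<otimes> t [^] (r * int n)" using tc by (simp add: g_def int_pow_pow flip: int_pow_int)
      then have "g \<in> cyc_coset G \<Delta> t (r * int n)" using cyc_cosetI[OF subgroup.one_closed[OF D]] by metis
      moreover have "cyc_ext G N g \<subseteq> N"
        using gN Nsg unfolding cyc_ext_def cyc_coset_def
        by (auto intro!: subgroup.m_closed subgroup_int_pow_closed)
      ultimately show ?thesis using r n 1 ND unfolding N_def
        by (intro exI[of _ g] exI[of _ "r * int n"]) auto
    next
      case False
      \<comment> \<open>If \<open>t\<close> has infinite order modulo \<open>\<Delta>\<close>,
        adjoining \<open>t\<close> itself to \<open>N\<close> adds nothing inside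
        \<open>\<Delta>\<close>, which contains \<open>H\<close>.\<close>
      have *: "i = 0" if "t [^] i \<in> \<Delta>" for i :: int
      proof (rule ccontr)
        assume "i \<noteq> 0"
        moreover have "t [^] (- i) \<in> \<Delta>" using that D tc by (simp add: int_pow_neg subgroup.m_inv_closed)
        ultimately show False using False that by (cases "i > 0") force+
      qed
      have "cyc_ext G N t \<inter> H \<subseteq> K"
      proof
        fix x assume x: "x \<in> cyc_ext G N t \<inter> H"
        then obtain y i where y: "y \<in> N" "x = y \<otimes> t [^] (i::int)" by (auto simp: cyc_ext_def cyc_coset_def)
        have "y \<otimes> t [^] i \<in> \<Delta>" using x y(2) 1 by blast
        then have "t [^] i \<in> \<Delta>" using y(1) ND tc by - (rule subgroup_cancel_left[OF D, of y]; blast)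
        then have "i = 0" by (rule *)
        then have "x \<in> N" using y subgroup.mem_carrier[OF Nsg y(1)] by simp
        then show "x \<in> K" using x 1 n ND by (auto simp: N_def)
      qed
      moreover have "t \<in> cyc_coset G \<Delta> t 1"
        using cyc_cosetI[OF subgroup.one_closed[OF D], of t 1] tc by simp
      ultimately show ?thesis by (intro exI[of _ t] exI[of _ 1]) auto
    qed
  next
    case (2 j h)
    \<comment> \<open>The power \<open>h [^] m\<close> belongs to both \<open>H\<close> and
      \<open>K\<close>. Hence an element of the extension that lies in \<open>H\<close> has its
      factor from \<open>N\<close> in \<open>H \<inter> N\<close>, which is inside \<open>K\<close>
      by the choice of \<open>n\<close>.\<close>
    have "cyc_ext G N (h [^] m) \<inter> H \<subseteq> K"
    proof
      fix x assume x: "x \<in> cyc_ext G N (h [^] m) \<inter> H"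
      then obtain y i where y: "y \<in> N" "x = y \<otimes> (h [^] m) [^] (i::int)" by (auto simp: cyc_ext_def cyc_coset_def)
      have hi: "(h [^] m) [^] i \<in> H" by (intro subgroup_int_pow_closed subgroup_nat_pow_closed extend.prems(1) 2(2))
      have "y \<otimes> (h [^] m) [^] i \<in> H" using x y(2) by blast
      then have "y \<in> H"
        by (rule subgroup_cancel_right[OF extend.prems(1) hi subgroup.mem_carrier[OF Nsg y(1)]])
      then have "y \<in> K" using y ND n by (auto simp: N_def)
      moreover have "(h [^] m) [^] i \<in> K" by (intro subgroup_int_pow_closed extend.prems(3,5) 2(2))
      ultimately show "x \<in> K" using y extend.prems(3) by (simp add: subgroup.m_closed)
    qed
    moreover have "h [^] m \<in> cyc_coset G \<Delta> t (j * int m)" by (rule cyc_coset_nat_pow[OF D tn 2(3)])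
    ultimately show ?thesis using 2(1) extend.prems(4)
      by (intro exI[of _ "h [^] m"] exI[of _ "j * int m"]) auto
  qed
  then obtain g j where j: "j > 0" and g: "g \<in> cyc_coset G \<Delta> t j" and gK: "cyc_ext G N g \<inter> H \<subseteq> K" by blast
  have gE: "g \<in> ?E" using g by (auto simp: cyc_ext_def)
  have gn: "g \<in> normalizing G N" using gE EN by blast
  have gc: "g \<in> carrier G" using gn by (simp add: normalizing_def)
  have M: "subgroup (cyc_ext G N g) G" by (rule cyc_ext_subgroup[OF Nsg gn])
  \<comment> \<open>Representatives of \<open>?E\<close> modulo \<open>cyc_ext G N g\<close>: the
    exponent of \<open>t\<close> counts only modulo \<open>j\<close>, and the remaining factor from
    \<open>\<Delta>\<close> only modulo \<open>N\<close>.\<close>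
  define T' where "T' = (\<lambda>(a, r). t [^] int r \<otimes> a) ` (T \<times> {..<nat j})"
  have "\<exists>b\<in>T'. inv b \<otimes> x \<in> cyc_ext G N g" if x: "x \<in> ?E" for x
  proof -
    obtain i where i: "x \<in> cyc_coset G \<Delta> t i" using x by (auto simp: cyc_ext_def)
    have xc: "x \<in> carrier G" by (rule subgroup.mem_carrier[OF E x])
    define q r where "q = i div j" and "r = nat (i mod j)"
    have r: "r < nat j" "i = int r + j * q" using j by (auto simp: q_def r_def nat_less_iff)
    have "x \<otimes> g [^] (- q) \<in> cyc_coset G \<Delta> t (i + j * (- q))"
      by (intro cyc_coset_mult[OF D tn] cyc_coset_int_pow[OF D tn] i g)
    then have "x \<otimes> g [^] (- q) \<in> cyc_coset G \<Delta> t (int r)" using r by simp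
    then obtain d where d: "d \<in> \<Delta>" "x \<otimes> g [^] (- q) = d \<otimes> t [^] int r" by (auto simp: cyc_coset_def)
    define d' where "d' = inv (t [^] int r) \<otimes> d \<otimes> t [^] int r"
    have dc: "d \<in> carrier G" by (rule subgroup.mem_carrier[OF D d(1)])
    have "d' \<in> \<Delta>" unfolding d'_def
      by (rule normalizing_conj[OF normalizing_int_pow[OF subgroup.subset[OF D] tn] d(1)])
    then obtain a where a: "a \<in> T" "inv a \<otimes> d' \<in> N" using T by blast
    have ac: "a \<in> carrier G" using subgroup.mem_carrier[OF D] a(1) T(2) by blast
    have "inv (t [^] int r \<otimes> a) \<otimes> x = (inv a \<otimes> d') \<otimes> g [^] q"
    proof -
      have "x = (x \<otimes> g [^] (- q)) \<otimes> g [^] q" using xc gc by (simp add: int_pow_neg m_assoc)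
      also have "\<dots> = d \<otimes> t [^] int r \<otimes> g [^] q" using d by simp
      finally show ?thesis using ac dc tc gc by (simp add: d'_def inv_mult_group m_assoc)
    qed
    then have "inv (t [^] int r \<otimes> a) \<otimes> x \<in> cyc_ext G N g"
      using cyc_ext_int_pow_mem[OF Nsg gn a(2), of q] by simp
    moreover have "t [^] int r \<otimes> a \<in> T'" using a(1) r(1) by (auto simp: T'_def)
    ultimately show ?thesis by blast
  qed
  moreover have "finite T'" using T by (auto simp: T'_def)
  moreover have "T' \<subseteq> carrier G" using T D tc by (auto simp: T'_def dest: subgroup.mem_carrier)
  ultimately have "x [^] (fact (card T')::nat) \<in> cyc_ext G N g" if "x \<in> ?E" for x
    using finite_reps_exponent[OF M E] that by blast
  then have "powers G ?E (fact (card T')) \<subseteq> cyc_ext G N g" using M by (intro powers_subset)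
  then show ?case using gK by (intro exI[of _ "fact (card T')"]) auto
qed

text \<open>The last assumption puts \<open>x\<close> into the profinite closure of
  \<open>K\<close>. Separability is applied inside the cyclic extension of \<open>K\<close> by
  \<open>x\<close>, where \<open>K\<close> is normal with cyclic quotient.\<close>

lemma polycyclic_closed:
  assumes E: "polycyclic G E" and K: "subgroup K G" "K \<subseteq> E" and x: "x \<in> E" "x \<in> normalizing G K"
    and appr: "\<And>n::nat. n > 0 \<Longrightarrow> \<exists>p\<in>powers G E n. x \<otimes> p \<in> K"
  shows "x \<in> K"
proof -
  have Esg: "subgroup E G" by (rule polycyclic_subgroup[OF E])
  have xc: "x \<in> carrier G" using x by (simp add: normalizing_def)
  let ?H = "cyc_ext G K x"
  have H: "subgroup ?H G" by (rule cyc_ext_subgroup[OF K(1) x(2)])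
  have HE: "?H \<subseteq> E" using cyc_ext_least[OF K(1) x(2)] Esg K x by blast
  have pH: "p \<in> ?H" if "x \<otimes> p \<in> K" "p \<in> powers G E n" for p n
  proof -
    have "p \<in> carrier G" using that subgroup.mem_carrier[OF powers_subgroup[OF subgroup.subset[OF Esg]]] by blast
    then show ?thesis using that(1) subset_cyc_ext[OF K(1) x(2)]
      by - (rule subgroup_cancel_left[OF H cyc_ext_mem[OF K(1) x(2)]]; blast)
  qed
  show ?thesis
  proof (cases "\<exists>k::nat. k > 0 \<and> x [^] k \<in> K")
    case True
    then obtain k :: nat where k: "k > 0" "x [^] k \<in> K" by blast
    have "h [^] k \<in> K" if h: "h \<in> ?H" for h
    proof -
      obtain i where "h \<in> cyc_coset G K x i" using h by (auto simp: cyc_ext_def)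
      then have "h [^] k \<in> cyc_coset G K x (i * int k)" by (rule cyc_coset_nat_pow[OF K(1) x(2)])
      then obtain y where "y \<in> K" "h [^] k = y \<otimes> x [^] (i * int k)" by (auto simp: cyc_coset_def)
      moreover have "x [^] (i * int k) = (x [^] k) [^] i"
        using xc by (simp add: int_pow_pow mult.commute flip: int_pow_int)
      ultimately show ?thesis using k K subgroup_int_pow_closed[OF K(1) k(2), of i]
        by (auto simp: subgroup.m_closed)
    qed
    then obtain n where n: "n > 0" "?H \<inter> powers G E n \<subseteq> K"
      using polycyclic_separation[OF E H HE K(1) k(1)] by blast
    then obtain p where p: "p \<in> powers G E n" "x \<otimes> p \<in> K" using appr by blast
    then have "p \<in> K" using n pH by blast
    then show ?thesis using p(2) xc by - (rule subgroup_cancel_right[OF K(1), of p x])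
  next
    case False
    \<comment> \<open>When \<open>x\<close> has infinite order modulo \<open>K\<close>, the
      extension of \<open>K\<close> by \<open>x [^] 2\<close> separates \<open>x\<close> from
      \<open>K\<close>: an approximation of \<open>x\<close> from \<open>K\<close> would put an odd,
      hence nonzero, power of \<open>x\<close> into \<open>K\<close>.\<close>
    have xn: "x [^] (2::int) \<in> normalizing G K"
      by (rule normalizing_int_pow[OF subgroup.subset[OF K(1)] x(2)])
    let ?K = "cyc_ext G K (x [^] (2::int))"
    have K': "subgroup ?K G" by (rule cyc_ext_subgroup[OF K(1) xn])
    have "h [^] (2::nat) \<in> ?K" if h: "h \<in> ?H" for h
    proof -
      obtain i where "h \<in> cyc_coset G K x i" using h by (auto simp: cyc_ext_def)
      then have "h [^] (2::nat) \<in> cyc_coset G K x (i * int 2)" by (rule cyc_coset_nat_pow[OF K(1) x(2)])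
      then obtain y where "y \<in> K" "h [^] (2::nat) = y \<otimes> x [^] (i * 2)" by (auto simp: cyc_coset_def)
      moreover have "x [^] (i * 2) = (x [^] (2::int)) [^] i"
        using xc by (simp add: int_pow_pow mult.commute)
      ultimately show ?thesis using cyc_ext_int_pow_mem[OF K(1) xn] by metis
    qed
    then obtain n where n: "n > 0" "?H \<inter> powers G E n \<subseteq> ?K"
      using polycyclic_separation[OF E H HE K', of 2] by auto
    then obtain p where p: "p \<in> powers G E n" "x \<otimes> p \<in> K" using appr by blast
    then have "p \<in> ?K" using n pH by blast
    then obtain y i where y: "y \<in> K" "p = y \<otimes> (x [^] (2::int)) [^] (i::int)"
      by (auto simp: cyc_ext_def cyc_coset_def)
    have "p = y \<otimes> x [^] (2 * i)" using y xc by (simp add: int_pow_pow)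
    then have "p \<in> cyc_coset G K x (2 * i)" using y by (auto simp: cyc_coset_def)
    moreover have "x \<in> cyc_coset G K x 1"
      using cyc_cosetI[OF subgroup.one_closed[OF K(1)], of x 1] xc by simp
    ultimately have "x \<otimes> p \<in> cyc_coset G K x (1 + 2 * i)" by (intro cyc_coset_mult[OF K(1) x(2)])
    then obtain z where z: "z \<in> K" "x \<otimes> p = z \<otimes> x [^] (1 + 2 * i)" by (auto simp: cyc_coset_def)
    then have xi: "x [^] (1 + 2 * i) \<in> K" using p(2) xc
      by - (rule subgroup_cancel_left[OF K(1), of z]; simp)
    then have xi': "x [^] (- (1 + 2 * i)) \<in> K" using K xc by (simp only: int_pow_neg subgroup.m_inv_closed)
    have "x [^] nat \<bar>1 + 2 * i\<bar> \<in> K"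
    proof (cases "1 + 2 * i > 0")
      case True
      then show ?thesis using xi int_pow_int[of G x "nat (1 + 2 * i)"] by simp
    next
      case False
      then show ?thesis using xi' int_pow_int[of G x "nat (- (1 + 2 * i))"] by simp
    qed
    moreover have "1 + 2 * i \<noteq> 0" by presburger
    then have "nat \<bar>1 + 2 * i\<bar> > 0" by simp
    ultimately show ?thesis using False by blast
  qed
qed

end

section \<open>Lower central series\<close>

definition commut :: "('a, 'b) monoid_scheme \<Rightarrow> 'a \<Rightarrow> 'a \<Rightarrow> 'a" where
  "commut G x y = x \<otimes>\<^bsub>G\<^esub> y \<otimes>\<^bsub>G\<^esub> inv\<^bsub>G\<^esub> x \<otimes>\<^bsub>G\<^esub> inv\<^bsub>G\<^esub> y"

text \<open>The carrier conditions are part of the relation, so that a congruence supplies them by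
  itself. The left quotient is the form in which displacements of automorphisms and differences of
  tuples appear later.\<close>

definition eqm :: "('a, 'b) monoid_scheme \<Rightarrow> 'a set \<Rightarrow> 'a \<Rightarrow> 'a \<Rightarrow> bool" where
  "eqm G N a b \<longleftrightarrow> a \<in> carrier G \<and> b \<in> carrier G \<and> inv\<^bsub>G\<^esub> a \<otimes>\<^bsub>G\<^esub> b \<in> N"

lemma lower_central_Suc:
  "lower_central G (Suc n) =
    generate G {commut G h g | h g. h \<in> lower_central G n \<and> g \<in> carrier G}"
  by (simp add: commut_def)

declare lower_central.simps(2) [simp del]

context group
begin

section \<open>Congruence modulo a subgroup\<close>

lemma eqm_refl: "a \<in> carrier G \<Longrightarrow> subgroup N G \<Longrightarrow> eqm G N a a"
  by (simp add: eqm_def subgroup.one_closed)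

lemma eqm_carrier: "eqm G N a b \<Longrightarrow> a \<in> carrier G" "eqm G N a b \<Longrightarrow> b \<in> carrier G"
  by (simp_all add: eqm_def)

lemma eqm_mono: "eqm G N a b \<Longrightarrow> N \<subseteq> M \<Longrightarrow> eqm G M a b"
  by (auto simp: eqm_def)

lemma eqm_sym:
  assumes "subgroup N G" "eqm G N a b" shows "eqm G N b a"
proof -
  have "inv (inv a \<otimes> b) \<in> N" using assms by (simp add: eqm_def subgroup.m_inv_closed)
  then show ?thesis using assms by (simp add: eqm_def inv_mult_group)
qed

lemma eqm_trans:
  assumes "subgroup N G" "eqm G N a b" "eqm G N b c" shows "eqm G N a c"
proof -
  have "(inv a \<otimes> b) \<otimes> (inv b \<otimes> c) \<in> N" using assms by (simp add: eqm_def subgroup.m_closed)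
  then show ?thesis using assms by (simp add: eqm_def m_assoc)
qed

lemma eqm_mult:
  assumes N: "N \<lhd> G" and ab: "eqm G N a b" "eqm G N c d" shows "eqm G N (a \<otimes> c) (b \<otimes> d)"
proof -
  have c: "a \<in> carrier G" "b \<in> carrier G" "c \<in> carrier G" "d \<in> carrier G" using ab by (auto simp: eqm_def)
  have "inv c \<otimes> (inv a \<otimes> b) \<otimes> c \<in> N"
    using normal.inv_op_closed1[OF N] ab c by (simp add: eqm_def)
  then have "(inv c \<otimes> (inv a \<otimes> b) \<otimes> c) \<otimes> (inv c \<otimes> d) \<in> N"
    using ab normal_imp_subgroup[OF N] by (simp add: eqm_def subgroup.m_closed)
  then show ?thesis using c by (simp add: eqm_def m_assoc inv_mult_group)
qed

lemma eqm_inv: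
  assumes N: "N \<lhd> G" and ab: "eqm G N a b" shows "eqm G N (inv a) (inv b)"
proof -
  have c: "a \<in> carrier G" "b \<in> carrier G" using ab by (auto simp: eqm_def)
  have "b \<otimes> inv (inv a \<otimes> b) \<otimes> inv b \<in> N"
    using normal.inv_op_closed2[OF N] subgroup.m_inv_closed[OF normal_imp_subgroup[OF N]] ab c
    by (simp add: eqm_def)
  then show ?thesis using c by (simp add: eqm_def m_assoc inv_mult_group)
qed

lemma eqm_mem:
  assumes "subgroup N G" "eqm G N a b" "a \<in> N" shows "b \<in> N"
proof -
  have "a \<otimes> (inv a \<otimes> b) \<in> N"
    using assms subgroup.m_closed[OF assms(1,3)] unfolding eqm_def by blast
  then show ?thesis using assms by (simp add: eqm_def)
qed

lemma eqm_memI: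
  assumes "subgroup N G" "a \<in> N" "b \<in> N" shows "eqm G N a b"
  using assms by (simp add: eqm_def subgroup.m_closed subgroup.m_inv_closed subgroup.mem_carrier[OF assms(1)])

lemma eqm_one_iff:
  assumes "subgroup N G" "a \<in> carrier G" shows "eqm G N \<one> a \<longleftrightarrow> a \<in> N"
  using assms by (simp add: eqm_def)

lemma eqm_rcos:
  assumes N: "N \<lhd> G" and c: "a \<in> carrier G" "b \<in> carrier G"
  shows "eqm G N a b \<longleftrightarrow> b \<in> N #> a" "eqm G N a b \<longleftrightarrow> N #> a = N #> b"
proof -
  have sg: "subgroup N G" by (rule normal_imp_subgroup[OF N])
  have "b \<in> N #> a \<longleftrightarrow> b \<otimes> inv a \<in> N" using subgroup.rcos_module[OF sg is_group c] .
  also have "\<dots> \<longleftrightarrow> inv a \<otimes> b \<in> N"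
  proof
    assume "b \<otimes> inv a \<in> N"
    then have "inv a \<otimes> (b \<otimes> inv a) \<otimes> a \<in> N" by (rule normal.inv_op_closed1[OF N c(1)])
    then show "inv a \<otimes> b \<in> N" using c by (simp add: m_assoc)
  next
    assume "inv a \<otimes> b \<in> N"
    then have "a \<otimes> (inv a \<otimes> b) \<otimes> inv a \<in> N" by (rule normal.inv_op_closed2[OF N c(1)])
    then show "b \<otimes> inv a \<in> N" using c by (simp add: m_assoc)
  qed
  finally show 1: "eqm G N a b \<longleftrightarrow> b \<in> N #> a" using c by (simp add: eqm_def)
  have "b \<in> N #> a \<longleftrightarrow> N #> a = N #> b"
    using repr_independence[OF _ c(1) sg] rcos_self[OF c(2) sg] by blast
  then show "eqm G N a b \<longleftrightarrow> N #> a = N #> b" using 1 by simp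
qed

section \<open>Commutators and the factors of the lower central series\<close>

lemma commut_closed [simp]: "x \<in> carrier G \<Longrightarrow> y \<in> carrier G \<Longrightarrow> commut G x y \<in> carrier G"
  by (simp add: commut_def)

lemma commut_mult_right:
  "a \<in> carrier G \<Longrightarrow> g \<in> carrier G \<Longrightarrow> g' \<in> carrier G \<Longrightarrow>
    commut G a (g \<otimes> g') = commut G a g \<otimes> (g \<otimes> commut G a g' \<otimes> inv g)"
  by (simp add: commut_def m_assoc inv_mult_group)

lemma commut_inv_right:
  "a \<in> carrier G \<Longrightarrow> g \<in> carrier G \<Longrightarrow> commut G a (inv g) = inv g \<otimes> inv (commut G a g) \<otimes> g"
  by (simp add: commut_def m_assoc inv_mult_group)

lemma commut_mult_left:
  "h \<in> carrier G \<Longrightarrow> h' \<in> carrier G \<Longrightarrow> g \<in> carrier G \<Longrightarrow>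
    commut G (h \<otimes> h') g = (h \<otimes> commut G h' g \<otimes> inv h) \<otimes> commut G h g"
  by (simp add: commut_def m_assoc inv_mult_group)

lemma commut_inv_left:
  "h \<in> carrier G \<Longrightarrow> g \<in> carrier G \<Longrightarrow> commut G (inv h) g = inv h \<otimes> inv (commut G h g) \<otimes> h"
  by (simp add: commut_def m_assoc inv_mult_group)

lemma commut_conj:
  "u \<in> carrier G \<Longrightarrow> h \<in> carrier G \<Longrightarrow> g \<in> carrier G \<Longrightarrow>
    u \<otimes> commut G h g \<otimes> inv u = commut G (u \<otimes> h \<otimes> inv u) (u \<otimes> g \<otimes> inv u)"
  by (simp add: commut_def m_assoc inv_mult_group)

lemma lower_central_normal: "lower_central G k \<lhd> G"
proof (induction k)
  case 0
  then show ?case by (simp add: normal_self)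
next
  case (Suc k)
  let ?A = "{commut G h g | h g. h \<in> lower_central G k \<and> g \<in> carrier G}"
  have sub: "lower_central G k \<subseteq> carrier G"
    using subgroup.subset[OF normal_imp_subgroup[OF Suc]] .
  have A: "?A \<subseteq> carrier G" using sub by auto
  have *: "u \<otimes> x \<otimes> inv u \<in> ?A" if u: "u \<in> carrier G" and x: "x \<in> ?A" for u x
  proof -
    obtain h g where hg: "h \<in> lower_central G k" "g \<in> carrier G" "x = commut G h g" using x by blast
    have "u \<otimes> h \<otimes> inv u \<in> lower_central G k" by (rule normal.inv_op_closed2[OF Suc u hg(1)])
    moreover have "u \<otimes> x \<otimes> inv u = commut G (u \<otimes> h \<otimes> inv u) (u \<otimes> g \<otimes> inv u)"
      using commut_conj u hg sub by auto
    ultimately show ?thesis using u hg by blast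
  qed
  have "u \<in> normalizing G ?A" if u: "u \<in> carrier G" for u
    using *[OF u] *[of "inv u"] u by (simp add: normalizing_def)
  then have "carrier G \<subseteq> normalizing G (generate G ?A)"
    using normalizing_generate[OF A] by blast
  then show ?case unfolding lower_central_Suc
    using generate_is_subgroup[OF A] by (intro normalizing_normal)
qed

lemma lower_central_subgroup: "subgroup (lower_central G k) G"
  by (rule normal_imp_subgroup[OF lower_central_normal])

lemma lower_central_closed: "x \<in> lower_central G k \<Longrightarrow> x \<in> carrier G"
  by (rule subgroup.mem_carrier[OF lower_central_subgroup])

lemma lower_central_commut:
  "h \<in> lower_central G k \<Longrightarrow> g \<in> carrier G \<Longrightarrow> commut G h g \<in> lower_central G (Suc k)"
  unfolding lower_central_Suc by (auto intro: generate.incl)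

lemma lower_central_Suc_subset: "lower_central G (Suc k) \<subseteq> lower_central G k"
  unfolding lower_central_Suc
proof (rule generate_subgroup_incl[OF _ lower_central_subgroup])
  have "commut G h g \<in> lower_central G k" if h: "h \<in> lower_central G k" and g: "g \<in> carrier G" for h g
  proof -
    have "g \<otimes> inv h \<otimes> inv g \<in> lower_central G k"
      using normal.inv_op_closed2[OF lower_central_normal g subgroup.m_inv_closed[OF lower_central_subgroup h]] .
    then have "h \<otimes> (g \<otimes> inv h \<otimes> inv g) \<in> lower_central G k"
      by (rule subgroup.m_closed[OF lower_central_subgroup h])
    then show ?thesis using lower_central_closed[OF h] g by (simp add: commut_def m_assoc)
  qed
  then show "{commut G h g |h g. h \<in> lower_central G k \<and> g \<in> carrier G} \<subseteq> lower_central G k" by blast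
qed

lemma lower_central_antimono: "m \<le> n \<Longrightarrow> lower_central G n \<subseteq> lower_central G m"
  by (rule lift_Suc_antimono_le[of "lower_central G"]) (rule lower_central_Suc_subset)

lemma derived_eq_lower_central: "derived G (carrier G) = lower_central G 1"
  unfolding One_nat_def lower_central_Suc derived_def commut_def
  by (rule arg_cong[where f = "generate G"]) auto

lemma eqm_central:
  assumes z: "z \<in> lower_central G k" and g: "g \<in> carrier G"
  shows "eqm G (lower_central G (Suc k)) (g \<otimes> z \<otimes> inv g) z"
proof -
  have zc: "z \<in> carrier G" by (rule lower_central_closed[OF z])
  have "commut G (inv z) g \<in> lower_central G (Suc k)"
    by (rule lower_central_commut[OF subgroup.m_inv_closed[OF lower_central_subgroup z] g])
  then have "inv (commut G (inv z) g) \<in> lower_central G (Suc k)"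
    by (rule subgroup.m_inv_closed[OF lower_central_subgroup])
  then show ?thesis using zc g by (simp add: eqm_def commut_def m_assoc inv_mult_group)
qed

lemma eqm_commute:
  assumes z: "z \<in> lower_central G k" and g: "g \<in> carrier G"
  shows "eqm G (lower_central G (Suc k)) (g \<otimes> z) (z \<otimes> g)"
proof -
  have zc: "z \<in> carrier G" by (rule lower_central_closed[OF z])
  have "eqm G (lower_central G (Suc k)) ((g \<otimes> z \<otimes> inv g) \<otimes> g) (z \<otimes> g)"
    using eqm_mult[OF lower_central_normal eqm_central[OF z g] eqm_refl[OF g lower_central_subgroup]] .
  then show ?thesis using zc g by (simp add: m_assoc)
qed

text \<open>Modulo \<open>\<gamma>\<^sub>k\<^sub>+\<^sub>2\<close>, the map \<open>g \<mapsto> [x, g]\<close> is a homomorphism to an abelian group, hence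
  kills commutators.\<close>

lemma lower_central_commut_derived:
  assumes x: "x \<in> lower_central G k" and y: "y \<in> lower_central G 1"
  shows "commut G x y \<in> lower_central G (Suc (Suc k))"
proof -
  let ?N = "lower_central G (Suc (Suc k))"
  note N = lower_central_normal[of "Suc (Suc k)"] and Nsg = lower_central_subgroup[of "Suc (Suc k)"]
  have xc: "x \<in> carrier G" by (rule lower_central_closed[OF x])
  let ?B = "{y \<in> carrier G. commut G x y \<in> ?N}"
  have B: "subgroup ?B G"
  proof (rule subgroupI)
    have "commut G x \<one> = \<one>" using xc by (simp add: commut_def)
    then show "?B \<noteq> {}" using subgroup.one_closed[OF Nsg] by force
    show "inv a \<in> ?B" if "a \<in> ?B" for a
      using that normal.inv_op_closed1[OF N _ subgroup.m_inv_closed[OF Nsg]] xc by (simp add: commut_inv_right)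
    show "a \<otimes> b \<in> ?B" if "a \<in> ?B" "b \<in> ?B" for a b
      using that normal.inv_op_closed2[OF N] xc by (simp add: commut_mult_right subgroup.m_closed[OF Nsg])
  qed auto
  have hom: "eqm G ?N (commut G x (a \<otimes> b)) (commut G x a \<otimes> commut G x b)"
    if ab: "a \<in> carrier G" "b \<in> carrier G" for a b
  proof -
    have "eqm G ?N (a \<otimes> commut G x b \<otimes> inv a) (commut G x b)"
      using ab x by (intro eqm_central lower_central_commut)
    then have "eqm G ?N (commut G x a \<otimes> (a \<otimes> commut G x b \<otimes> inv a)) (commut G x a \<otimes> commut G x b)"
      using ab xc by (intro eqm_mult N eqm_refl Nsg commut_closed)
    then show ?thesis using ab xc by (simp add: commut_mult_right)
  qed
  \<comment> \<open>The values \<open>?a\<close> and \<open>?b\<close> commute modulo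
    \<open>?N\<close>. Applying the homomorphism to
    \<open>?c \<otimes> (h \<otimes> g) = g \<otimes> h\<close> therefore cancels everything except
    \<open>commut G x ?c\<close>.\<close>
  have "commut G g h \<in> ?B" if gh: "g \<in> carrier G" "h \<in> carrier G" for g h
  proof -
    let ?c = "commut G g h" and ?a = "commut G x g" and ?b = "commut G x h"
    have c: "?c \<in> carrier G" "?a \<in> carrier G" "?b \<in> carrier G" "commut G x ?c \<in> carrier G" using gh xc by auto
    have "?c \<otimes> (h \<otimes> g) = g \<otimes> h" using gh by (simp add: commut_def m_assoc)
    then have "eqm G ?N (commut G x (g \<otimes> h)) (commut G x ?c \<otimes> commut G x (h \<otimes> g))"
      using hom[OF c(1), of "h \<otimes> g"] gh by simp
    moreover have "eqm G ?N (commut G x ?c \<otimes> commut G x (h \<otimes> g)) (commut G x ?c \<otimes> (?b \<otimes> ?a))"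
      using eqm_mult[OF N eqm_refl[OF c(4) Nsg] hom[OF gh(2,1)]] .
    moreover have "eqm G ?N (?a \<otimes> ?b) (commut G x (g \<otimes> h))"
      using eqm_sym[OF Nsg hom[OF gh]] .
    moreover have "eqm G ?N (?b \<otimes> ?a) (?a \<otimes> ?b)"
      using eqm_commute[OF lower_central_commut[OF x gh(1)] c(3)] .
    ultimately have "eqm G ?N (?b \<otimes> ?a) (commut G x ?c \<otimes> (?b \<otimes> ?a))"
      using eqm_trans[OF Nsg] by blast
    then have "eqm G ?N ((?b \<otimes> ?a) \<otimes> inv (?b \<otimes> ?a)) ((commut G x ?c \<otimes> (?b \<otimes> ?a)) \<otimes> inv (?b \<otimes> ?a))"
      using c by (intro eqm_mult[OF N _ eqm_refl[OF _ Nsg]]) auto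
    then have "eqm G ?N \<one> (commut G x ?c)" using c by (simp add: m_assoc)
    then show ?thesis using c eqm_one_iff[OF Nsg c(4)] by simp
  qed
  then have "lower_central G 1 \<subseteq> ?B"
    unfolding One_nat_def lower_central_Suc[of G 0]
    by (intro generate_subgroup_incl[OF _ B]) auto
  then show ?thesis using y by blast
qed

text \<open>The commutator is bimultiplicative modulo the term after next, so commutators of
  generators of one factor with elements of \<open>S\<close> generate the next factor. Elements of
  \<open>lower_central G 1\<close> contribute nothing there, hence generation modulo commutators
  suffices. That \<open>T\<close> lies in \<open>generate G S\<close> is recorded for
  \<open>nilpotent_generate\<close>.\<close>

lemma lower_central_fin_gen:
  assumes S: "finite S" "S \<subseteq> carrier G" and gen: "generate G (S \<union> lower_central G 1) = carrier G"
  shows "\<exists>T. finite T \<and> T \<subseteq> lower_central G k \<and> T \<subseteq> generate G S \<and>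
    generate G (T \<union> lower_central G (Suc k)) = lower_central G k"
proof (induction k)
  case 0
  have "S \<subseteq> generate G S" by (auto intro: generate.incl)
  then show ?case using S gen by auto
next
  case (Suc k)
  let ?L = "lower_central G"
  note Lsg = lower_central_subgroup
  obtain T where T: "finite T" "T \<subseteq> ?L k" "T \<subseteq> generate G S" "generate G (T \<union> ?L (Suc k)) = ?L k"
    using Suc by blast
  define T' where "T' = (\<lambda>(a, s). commut G a s) ` (T \<times> S)"
  let ?Q = "generate G (T' \<union> ?L (Suc (Suc k)))"
  have fin: "finite T'" using T S by (simp add: T'_def)
  have T'L: "T' \<subseteq> ?L (Suc k)" using T(2) S(2) by (force simp: T'_def intro: lower_central_commut)
  have gS: "subgroup (generate G S) G" using S by (simp add: generate_is_subgroup)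
  have T'S: "T' \<subseteq> generate G S"
  proof
    fix z assume "z \<in> T'"
    then obtain a s where as: "a \<in> generate G S" "s \<in> generate G S" "z = commut G a s"
      using T(3) generate.incl[of _ S G] by (force simp: T'_def)
    show "z \<in> generate G S" unfolding as commut_def
      using as(1,2) subgroup.m_closed[OF gS] subgroup.m_inv_closed[OF gS] by auto
  qed
  have sub: "T' \<union> ?L (Suc (Suc k)) \<subseteq> ?L (Suc k)" using T'L lower_central_Suc_subset by blast
  have QL: "?Q \<subseteq> ?L (Suc k)" by (rule generate_subgroup_incl[OF sub Lsg])
  have Q: "subgroup ?Q G"
    using sub subgroup.subset[OF Lsg] by (intro generate_is_subgroup) blast
  have LQ: "?L (Suc (Suc k)) \<subseteq> ?Q" by (auto intro: generate.incl)
  \<comment> \<open>\<open>?Q\<close> lies between two consecutive terms of the series, and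
    conjugation acts trivially on the factor; hence \<open>?Q\<close> is normal.\<close>
  have conj: "g \<otimes> z \<otimes> inv g \<in> ?Q" if g: "g \<in> carrier G" and z: "z \<in> ?Q" for g z
  proof -
    have "eqm G (?L (Suc (Suc k))) (g \<otimes> z \<otimes> inv g) z" using QL g z by (intro eqm_central) auto
    then have "eqm G ?Q z (g \<otimes> z \<otimes> inv g)" using eqm_mono[OF _ LQ] eqm_sym[OF Q] by blast
    then show ?thesis using eqm_mem[OF Q _ z] by blast
  qed
  have conj': "inv g \<otimes> inv z \<otimes> g \<in> ?Q" if g: "g \<in> carrier G" and z: "z \<in> ?Q" for g z
    using conj[of "inv g" "inv z"] g subgroup.m_inv_closed[OF Q z] by simp
  have 1: "commut G a g \<in> ?Q" if a: "a \<in> T" and g: "g \<in> carrier G" for a g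
  proof -
    have aL: "a \<in> ?L k" using a T by blast
    have ac: "a \<in> carrier G" by (rule lower_central_closed[OF aL])
    let ?B = "{g \<in> carrier G. commut G a g \<in> ?Q}"
    have "subgroup ?B G"
    proof (rule subgroupI)
      have "commut G a \<one> = \<one>" using ac by (simp add: commut_def)
      then show "?B \<noteq> {}" using subgroup.one_closed[OF Q] by force
      show "inv b \<in> ?B" if "b \<in> ?B" for b using that conj' ac by (simp add: commut_inv_right)
      show "b \<otimes> c \<in> ?B" if "b \<in> ?B" "c \<in> ?B" for b c
        using that conj ac by (simp add: commut_mult_right subgroup.m_closed[OF Q])
    qed auto
    moreover have "S \<subseteq> ?B"
    proof
      fix s assume s: "s \<in> S"
      then have "commut G a s \<in> T'" using a by (auto simp: T'_def)
      then show "s \<in> ?B" using s S by (auto intro: generate.incl)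
    qed
    moreover have "?L 1 \<subseteq> ?B"
      using lower_central_commut_derived[OF aL] LQ lower_central_closed by auto
    ultimately have "generate G (S \<union> ?L 1) \<subseteq> ?B" by (intro generate_subgroup_incl) auto
    then show ?thesis using gen g by auto
  qed
  let ?C = "{h \<in> ?L k. \<forall>g\<in>carrier G. commut G h g \<in> ?Q}"
  have "subgroup ?C G"
  proof (rule subgroupI)
    show "?C \<subseteq> carrier G" using lower_central_closed by blast
    have "commut G \<one> g = \<one>" if "g \<in> carrier G" for g using that by (simp add: commut_def)
    then have "\<one> \<in> ?C" using subgroup.one_closed[OF Q] subgroup.one_closed[OF Lsg] by simp
    then show "?C \<noteq> {}" by blast
    show "inv b \<in> ?C" if "b \<in> ?C" for b
      using that conj' lower_central_closed[of _ k] by (simp add: commut_inv_left subgroup.m_inv_closed[OF Lsg])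
    show "b \<otimes> c \<in> ?C" if "b \<in> ?C" "c \<in> ?C" for b c
      using that conj lower_central_closed[of _ k]
      by (simp add: commut_mult_left subgroup.m_closed[OF Lsg] subgroup.m_closed[OF Q])
  qed
  moreover have "T \<subseteq> ?C" using 1 T by blast
  moreover have "?L (Suc k) \<subseteq> ?C"
    using lower_central_commut[of _ "Suc k"] LQ lower_central_Suc_subset by blast
  ultimately have "?L k \<subseteq> ?C" using generate_subgroup_incl[of "T \<union> ?L (Suc k)" ?C] T by simp
  then have "{commut G h g |h g. h \<in> ?L k \<and> g \<in> carrier G} \<subseteq> ?Q" by blast
  then have "?L (Suc k) \<subseteq> ?Q" unfolding lower_central_Suc[of G k]
    using Q by (rule generate_subgroup_incl)
  then show ?case using QL fin T'L T'S by (intro exI[of _ T']) auto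
qed

text \<open>Climbing from the trivial term of the series upwards, each term lies in the subgroup
  generated by \<open>S\<close>, because it is generated modulo the next one by elements of that
  subgroup. This is applied to tuples that are known only modulo commutators.\<close>

lemma nilpotent_generate:
  assumes S: "finite S" "S \<subseteq> carrier G" and gen: "generate G (S \<union> lower_central G 1) = carrier G"
    and c: "lower_central G c = {\<one>}"
  shows "generate G S = carrier G"
proof -
  have gS: "subgroup (generate G S) G" using S by (simp add: generate_is_subgroup)
  have "lower_central G (c - j) \<subseteq> generate G S" for j
  proof (induction j)
    case 0
    then show ?case using c subgroup.one_closed[OF gS] by simp
  next
    case (Suc j)
    show ?case
    proof (cases "j < c")
      case True
      then have e: "c - j = Suc (c - Suc j)" by simp
      obtain T where "T \<subseteq> generate G S" "generate G (T \<union> lower_central G (c - j)) = lower_central G (c - Suc j)"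
        using lower_central_fin_gen[OF S gen, of "c - Suc j"] e by auto
      then show ?thesis using Suc generate_subgroup_incl[OF _ gS] by (metis Un_least)
    next
      case False
      then show ?thesis using Suc by simp
    qed
  qed
  from this[of c] show ?thesis using subgroup.subset[OF gS] by auto
qed

text \<open>The factors of the series are central, so every subgroup between consecutive terms is
  normal; generators of a factor can thus be adjoined one at a time.\<close>

lemma nilpotent_polycyclic:
  assumes S: "finite S" "S \<subseteq> carrier G" "generate G S = carrier G"
    and c: "lower_central G c = {\<one>}"
  shows "polycyclic G (carrier G)"
proof -
  let ?L = "lower_central G"
  have "S \<union> ?L 1 \<subseteq> carrier G" using S lower_central_closed by blast
  then have gen: "generate G (S \<union> ?L 1) = carrier G"
    using mono_generate[of S "S \<union> ?L 1"] S generate_incl[of "S \<union> ?L 1"] by blast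
  have step: "\<exists>E. polycyclic G E \<and> T \<union> ?L (Suc k) \<subseteq> E \<and> E \<subseteq> ?L k"
    if "polycyclic G (?L (Suc k))" "finite T" "T \<subseteq> ?L k" for T k
    using that(2,3)
  proof (induction T)
    case empty
    then show ?case using that(1) lower_central_Suc_subset by blast
  next
    case (insert a T)
    then obtain E where E: "polycyclic G E" "T \<union> ?L (Suc k) \<subseteq> E" "E \<subseteq> ?L k" by auto
    have Esg: "subgroup E G" by (rule polycyclic_subgroup[OF E(1)])
    have aL: "a \<in> ?L k" using insert by blast
    have conj: "u \<otimes> h \<otimes> inv u \<in> E" if u: "u \<in> carrier G" and h: "h \<in> E" for u h
    proof -
      have "eqm G (?L (Suc k)) (u \<otimes> h \<otimes> inv u) h" using E h u by (intro eqm_central) auto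
      then have "eqm G E h (u \<otimes> h \<otimes> inv u)" using eqm_mono[of "?L (Suc k)" _ _ E] eqm_sym[OF Esg] E by blast
      then show ?thesis using eqm_mem[OF Esg _ h] by blast
    qed
    have an: "a \<in> normalizing G E"
      using conj[of a] conj[of "inv a"] lower_central_closed[OF aL] by (simp add: normalizing_def)
    have "polycyclic G (cyc_ext G E a)" by (rule polycyclic.extend[OF E(1) an])
    moreover have "insert a T \<union> ?L (Suc k) \<subseteq> cyc_ext G E a"
      using subset_cyc_ext[OF Esg an] cyc_ext_mem[OF Esg an] E by blast
    moreover have "cyc_ext G E a \<subseteq> ?L k"
      by (rule cyc_ext_least[OF Esg an lower_central_subgroup E(3) aL])
    ultimately show ?case by blast
  qed
  have "polycyclic G (?L (c - j))" for j
  proof (induction j)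
    case 0
    then show ?case using c polycyclic.trivial[of G] by simp
  next
    case (Suc j)
    show ?case
    proof (cases "j < c")
      case True
      then have e: "c - j = Suc (c - Suc j)" by simp
      define k where "k = c - Suc j"
      obtain T where T: "finite T" "T \<subseteq> ?L k" "generate G (T \<union> ?L (Suc k)) = ?L k"
        using lower_central_fin_gen[OF S(1,2) gen, of k] by auto
      obtain E where E: "polycyclic G E" "T \<union> ?L (Suc k) \<subseteq> E" "E \<subseteq> ?L k"
        using step[of k T] Suc T e k_def by auto
      have "E = ?L k" using E T generate_subgroup_incl[OF E(2) polycyclic_subgroup[OF E(1)]] by auto
      then show ?thesis using E k_def by simp
    next
      case False
      then show ?thesis using Suc by simp
    qed
  qed
  from this[of c] show ?thesis by simp
qed

end

section \<open>Homomorphisms and the lower central series\<close>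

lemma (in group_hom) hom_commut:
  assumes "x \<in> carrier G" "y \<in> carrier G"
  shows "h (commut G x y) = commut H (h x) (h y)"
  using assms by (simp add: commut_def)

lemma (in group_hom) lower_central_img_subset:
  "x \<in> lower_central G k \<Longrightarrow> h x \<in> lower_central H k"
proof (induction k arbitrary: x)
  case 0
  then show ?case by simp
next
  case (Suc k)
  let ?A = "{commut G h g | h g. h \<in> lower_central G k \<and> g \<in> carrier G}"
  have "?A \<subseteq> carrier G" using G.lower_central_closed by auto
  then have "h ` lower_central G (Suc k) = generate H (h ` ?A)"
    unfolding lower_central_Suc using generate_img by blast
  also have "\<dots> \<subseteq> lower_central H (Suc k)"
  proof (rule H.generate_subgroup_incl[OF _ H.lower_central_subgroup])
    show "h ` ?A \<subseteq> lower_central H (Suc k)"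
      using Suc.IH G.lower_central_closed H.lower_central_commut by (auto simp: hom_commut)
  qed
  finally show ?case using Suc by blast
qed

lemma (in group_hom) lower_central_img:
  assumes surj: "h ` carrier G = carrier H"
  shows "h ` lower_central G k = lower_central H k"
proof (induction k)
  case 0
  then show ?case using surj by simp
next
  case (Suc k)
  let ?A = "{commut G h g | h g. h \<in> lower_central G k \<and> g \<in> carrier G}"
  have A: "?A \<subseteq> carrier G" using G.lower_central_closed by auto
  have "h ` ?A = {commut H u v | u v. u \<in> lower_central H k \<and> v \<in> carrier H}"
  proof safe
    fix x y assume xy: "x \<in> lower_central G k" "y \<in> carrier G"
    then have "h (commut G x y) = commut H (h x) (h y)" using hom_commut G.lower_central_closed by blast
    then show "\<exists>u v. h (commut G x y) = commut H u v \<and> u \<in> lower_central H k \<and> v \<in> carrier H"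
      using lower_central_img_subset[OF xy(1)] xy(2)
      by (intro exI[of _ "h x"] exI[of _ "h y"]) simp
  next
    fix u v assume uv: "u \<in> lower_central H k" "v \<in> carrier H"
    then obtain x y where xy: "x \<in> lower_central G k" "y \<in> carrier G" "u = h x" "v = h y"
      using Suc surj by (metis imageE)
    then have "commut H u v = h (commut G x y)" using hom_commut G.lower_central_closed by metis
    then show "commut H u v \<in> h ` ?A" using xy by blast
  qed
  then show ?case unfolding lower_central_Suc using generate_img[OF A] by simp
qed

text \<open>Changing the entries of an iterated commutator by commutators changes its value only in
  the next degree. In the inductive step the first entry changes by \<open>z\<close>, which is one
  degree deeper than the entry, and the second by \<open>y\<close> from
  \<open>lower_central G 1\<close>; both effects are trivial modulo \<open>?N\<close>.\<close>

lemma eqm_homs_lower_central: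
  assumes F: "group_hom F G h" "group_hom F G h'"
    and agree: "\<And>w. w \<in> carrier F \<Longrightarrow> eqm G (lower_central G 1) (h w) (h' w)"
    and w: "w \<in> lower_central F k"
  shows "eqm G (lower_central G (Suc k)) (h w) (h' w)"
  using w
proof (induction k arbitrary: w)
  case 0
  then show ?case using agree by simp
next
  case (Suc k)
  interpret h: group_hom F G h by fact
  interpret h': group_hom F G h' by fact
  let ?N = "lower_central G (Suc (Suc k))"
  note N = h.H.lower_central_normal[of "Suc (Suc k)"] and Nsg = h.H.lower_central_subgroup[of "Suc (Suc k)"]
  let ?B = "{w \<in> carrier F. eqm G ?N (h w) (h' w)}"
  have B: "subgroup ?B F"
  proof (rule h.G.subgroupI)
    have "\<one>\<^bsub>F\<^esub> \<in> ?B" using Nsg by (simp add: h.H.eqm_refl)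
    then show "?B \<noteq> {}" by blast
    show "inv\<^bsub>F\<^esub> a \<in> ?B" if "a \<in> ?B" for a
      using that h.H.eqm_inv[OF N] by simp
    show "a \<otimes>\<^bsub>F\<^esub> b \<in> ?B" if "a \<in> ?B" "b \<in> ?B" for a b
      using that h.H.eqm_mult[OF N] by simp
  qed auto
  have "commut F x g \<in> ?B" if x: "x \<in> lower_central F k" and g: "g \<in> carrier F" for x g
  proof -
    have xc: "x \<in> carrier F" by (rule h.G.lower_central_closed[OF x])
    define a z b y where "a = h x" and "z = inv\<^bsub>G\<^esub> (h x) \<otimes>\<^bsub>G\<^esub> h' x"
      and "b = h g" and "y = inv\<^bsub>G\<^esub> (h g) \<otimes>\<^bsub>G\<^esub> h' g"
    have aL: "a \<in> lower_central G k" unfolding a_def by (rule h.lower_central_img_subset[OF x])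
    have zL: "z \<in> lower_central G (Suc k)" using Suc.IH[OF x] by (simp add: z_def eqm_def)
    have yL: "y \<in> lower_central G 1" using agree[OF g] by (simp add: y_def eqm_def)
    have c: "a \<in> carrier G" "b \<in> carrier G" "z \<in> carrier G" "y \<in> carrier G"
      unfolding a_def b_def z_def y_def using xc g by auto
    have e: "h' x = a \<otimes>\<^bsub>G\<^esub> z" "h' g = b \<otimes>\<^bsub>G\<^esub> y"
      unfolding a_def b_def z_def y_def using xc g by simp_all
    have one: "eqm G ?N u \<one>\<^bsub>G\<^esub>" if "u \<in> ?N" for u
      using h.H.eqm_memI[OF Nsg that subgroup.one_closed[OF Nsg]] .
    have 1: "eqm G ?N (commut G (a \<otimes>\<^bsub>G\<^esub> z) (b \<otimes>\<^bsub>G\<^esub> y)) (commut G a (b \<otimes>\<^bsub>G\<^esub> y))"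
    proof -
      have "commut G z (b \<otimes>\<^bsub>G\<^esub> y) \<in> ?N" using c by (intro h.H.lower_central_commut zL) auto
      then have "a \<otimes>\<^bsub>G\<^esub> commut G z (b \<otimes>\<^bsub>G\<^esub> y) \<otimes>\<^bsub>G\<^esub> inv\<^bsub>G\<^esub> a \<in> ?N"
        by (rule normal.inv_op_closed2[OF N c(1)])
      then have "eqm G ?N ((a \<otimes>\<^bsub>G\<^esub> commut G z (b \<otimes>\<^bsub>G\<^esub> y) \<otimes>\<^bsub>G\<^esub> inv\<^bsub>G\<^esub> a) \<otimes>\<^bsub>G\<^esub> commut G a (b \<otimes>\<^bsub>G\<^esub> y))
          (\<one>\<^bsub>G\<^esub> \<otimes>\<^bsub>G\<^esub> commut G a (b \<otimes>\<^bsub>G\<^esub> y))"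
        using c by (intro h.H.eqm_mult[OF N] one h.H.eqm_refl Nsg) auto
      then show ?thesis using c by (simp add: h.H.commut_mult_left)
    qed
    have 2: "eqm G ?N (commut G a (b \<otimes>\<^bsub>G\<^esub> y)) (commut G a b)"
    proof -
      have "commut G a y \<in> ?N" by (rule h.H.lower_central_commut_derived[OF aL yL])
      then have "b \<otimes>\<^bsub>G\<^esub> commut G a y \<otimes>\<^bsub>G\<^esub> inv\<^bsub>G\<^esub> b \<in> ?N"
        by (rule normal.inv_op_closed2[OF N c(2)])
      then have "eqm G ?N (commut G a b \<otimes>\<^bsub>G\<^esub> (b \<otimes>\<^bsub>G\<^esub> commut G a y \<otimes>\<^bsub>G\<^esub> inv\<^bsub>G\<^esub> b)) (commut G a b \<otimes>\<^bsub>G\<^esub> \<one>\<^bsub>G\<^esub>)"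
        using c by (intro h.H.eqm_mult[OF N] one h.H.eqm_refl Nsg) auto
      then show ?thesis using c by (simp add: h.H.commut_mult_right)
    qed
    have "eqm G ?N (commut G a b) (commut G (a \<otimes>\<^bsub>G\<^esub> z) (b \<otimes>\<^bsub>G\<^esub> y))"
      using h.H.eqm_sym[OF Nsg h.H.eqm_trans[OF Nsg 1 2]] .
    then show ?thesis
      using xc g e by (simp add: h.hom_commut h'.hom_commut a_def b_def)
  qed
  then have "lower_central F (Suc k) \<subseteq> ?B"
    unfolding lower_central_Suc[of F] using B by (intro h.G.generate_subgroup_incl) auto
  then show ?case using Suc.prems by blast
qed

section \<open>Direct powers\<close>

abbreviation power_group :: "'i set \<Rightarrow> ('a, 'b) monoid_scheme \<Rightarrow> ('i \<Rightarrow> 'a) monoid" where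
  "power_group W G \<equiv> product_group W (\<lambda>_. G)"

definition single :: "('a, 'b) monoid_scheme \<Rightarrow> 'i set \<Rightarrow> 'i \<Rightarrow> 'a \<Rightarrow> 'i \<Rightarrow> 'a" where
  "single G W w x = (\<lambda>i\<in>W. if i = w then x else \<one>\<^bsub>G\<^esub>)"

context group
begin

lemma power_group_group: "group (power_group W G)"
  by (simp add: is_group)

lemma power_group_proj: "w \<in> W \<Longrightarrow> group_hom (power_group W G) G (\<lambda>f. f w)"
  by (auto simp: group_hom_def group_hom_axioms_def is_group hom_def PiE_iff)

lemma power_group_single: "group_hom G (power_group W G) (single G W w)"
  by (auto simp: group_hom_def group_hom_axioms_def is_group hom_def PiE_iff single_def intro!: ext)

lemma lower_central_power_group:
  "f \<in> lower_central (power_group W G) k \<Longrightarrow> w \<in> W \<Longrightarrow> f w \<in> lower_central G k"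
  using group_hom.lower_central_img_subset[OF power_group_proj] by fast

lemma power_group_mem_subgroup:
  assumes W: "finite W" and K: "subgroup K (power_group W G)" and f: "f \<in> carrier (power_group W G)"
    and s: "\<And>w. w \<in> W \<Longrightarrow> single G W w (f w) \<in> K"
  shows "f \<in> K"
proof -
  have "(\<lambda>i\<in>W. if i \<in> V then f i else \<one>) \<in> K" if "finite V" "V \<subseteq> W" for V
    using that
  proof (induction V)
    case empty
    have "\<one>\<^bsub>power_group W G\<^esub> \<in> K" by (rule subgroup.one_closed[OF K])
    then show ?case by (simp add: restrict_def)
  next
    case (insert w V)
    then have w: "w \<in> W" and V: "V \<subseteq> W" by auto
    have "single G W w (f w) \<otimes>\<^bsub>power_group W G\<^esub> (\<lambda>i\<in>W. if i \<in> V then f i else \<one>) \<in> K"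
      by (rule subgroup.m_closed[OF K s[OF w] insert.IH[OF V]])
    moreover have "single G W w (f w) \<otimes>\<^bsub>power_group W G\<^esub> (\<lambda>i\<in>W. if i \<in> V then f i else \<one>)
        = (\<lambda>i\<in>W. if i \<in> insert w V then f i else \<one>)"
      using insert f by (auto simp: single_def PiE_iff intro!: restrict_ext)
    ultimately show ?case by (simp only:)
  qed
  from this[OF W] have "(\<lambda>i\<in>W. if i \<in> W then f i else \<one>) \<in> K" by simp
  moreover have "(\<lambda>i\<in>W. if i \<in> W then f i else \<one>) = f"
    using f by (auto simp: PiE_iff extensional_def)
  ultimately show ?thesis by simp
qed

lemma power_group_powers:
  assumes W: "finite W" and f: "f \<in> carrier (power_group W G)"
    and p: "\<And>w. w \<in> W \<Longrightarrow> f w \<in> powers G (carrier G) n"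
  shows "f \<in> powers (power_group W G) (carrier (power_group W G)) n"
proof (rule power_group_mem_subgroup[OF W _ f])
  interpret P: group "power_group W G" by (rule power_group_group)
  show sg: "subgroup (powers (power_group W G) (carrier (power_group W G)) n) (power_group W G)"
    by (rule P.powers_subgroup) simp
  fix w assume w: "w \<in> W"
  interpret s: group_hom G "power_group W G" "single G W w" by (rule power_group_single)
  let ?A = "{x [^] n |x. x \<in> carrier G}"
  have "single G W w ` powers G (carrier G) n = generate (power_group W G) (single G W w ` ?A)"
    unfolding powers_def using s.generate_img[of ?A] by auto
  also have "\<dots> \<subseteq> powers (power_group W G) (carrier (power_group W G)) n"
  proof (rule P.generate_subgroup_incl[OF _ sg])
    show "single G W w ` ?A \<subseteq> powers (power_group W G) (carrier (power_group W G)) n"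
      using P.powers_mem[OF s.hom_closed] by (auto simp: s.hom_nat_pow)
  qed
  finally show "single G W w (f w) \<in> powers (power_group W G) (carrier (power_group W G)) n"
    using p[OF w] by blast
qed

text \<open>Separability will be applied to tuples of displacements and to tuples of relator values,
  so it must hold in finite direct powers.\<close>

lemma power_group_polycyclic:
  assumes W: "finite W" and S: "finite S" "S \<subseteq> carrier G" "generate G S = carrier G"
    and c: "lower_central G c = {\<one>}"
  shows "polycyclic (power_group W G) (carrier (power_group W G))"
proof -
  interpret P: group "power_group W G" by (rule power_group_group)
  define S' where "S' = (\<lambda>(w, s). single G W w s) ` (W \<times> S)"
  have S'c: "S' \<subseteq> carrier (power_group W G)"
    using S(2) unfolding S'_def
    by (auto intro!: group_hom.hom_closed[OF power_group_single] simp del: carrier_product_group)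
  have gS: "subgroup (generate (power_group W G) S') (power_group W G)"
    by (rule P.generate_is_subgroup[OF S'c])
  have "f \<in> generate (power_group W G) S'" if f: "f \<in> carrier (power_group W G)" for f
  proof (rule power_group_mem_subgroup[OF W gS f])
    fix w assume w: "w \<in> W"
    interpret s: group_hom G "power_group W G" "single G W w" by (rule power_group_single)
    have "f w \<in> generate G S" using f w S by (auto simp: PiE_iff)
    then have "single G W w (f w) \<in> generate (power_group W G) (single G W w ` S)"
      using s.generate_img[OF S(2)] by blast
    also have "\<dots> \<subseteq> generate (power_group W G) S'"
      using w by (intro P.mono_generate) (auto simp: S'_def)
    finally show "single G W w (f w) \<in> generate (power_group W G) S'" .
  qed
  then have gen: "generate (power_group W G) S' = carrier (power_group W G)"
    using P.generate_incl[OF S'c] by blast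
  have "lower_central (power_group W G) c = {\<one>\<^bsub>power_group W G\<^esub>}"
  proof
    show "lower_central (power_group W G) c \<subseteq> {\<one>\<^bsub>power_group W G\<^esub>}"
    proof
      fix f assume f: "f \<in> lower_central (power_group W G) c"
      then have "f w = \<one>" if "w \<in> W" for w using lower_central_power_group[OF f that] c by simp
      moreover have "f \<in> extensional W" using P.lower_central_closed[OF f] by (simp add: PiE_iff)
      ultimately show "f \<in> {\<one>\<^bsub>power_group W G\<^esub>}" by (auto simp: extensional_def)
    qed
    show "{\<one>\<^bsub>power_group W G\<^esub>} \<subseteq> lower_central (power_group W G) c"
      using subgroup.one_closed[OF P.lower_central_subgroup] by blast
  qed
  then show ?thesis using W S S'c gen by (intro P.nilpotent_polycyclic[of S']) (auto simp: S'_def)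
qed

end

section \<open>Congruence subgroups of automorphism groups\<close>

lemma (in group_hom) eqm_hom:
  assumes "eqm G N a b" "h ` N \<subseteq> N'" shows "eqm H N' (h a) (h b)"
proof -
  have "h (inv a \<otimes> b) \<in> N'" using assms by (auto simp: eqm_def)
  then show ?thesis using assms by (simp add: eqm_def)
qed

lemma (in group_hom) hom_powers: "h ` powers G (carrier G) n \<subseteq> powers H (carrier H) n"
proof -
  let ?A = "{x [^] n |x. x \<in> carrier G}"
  have "h ` powers G (carrier G) n = generate H (h ` ?A)"
    unfolding powers_def using generate_img[of ?A] by auto
  also have "\<dots> \<subseteq> powers H (carrier H) n"
    unfolding powers_def
  proof (rule H.mono_generate)
    show "h ` ?A \<subseteq> {x [^]\<^bsub>H\<^esub> n |x. x \<in> carrier H}" by (auto simp: hom_nat_pow)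
  qed
  finally show ?thesis .
qed

lemma eqm_homs_generate:
  assumes "group_hom G H h" "group_hom G H h'" and N: "N \<lhd> H" and S: "S \<subseteq> carrier G"
    and agree: "\<And>s. s \<in> S \<Longrightarrow> eqm H N (h s) (h' s)" and g: "g \<in> generate G S"
  shows "eqm H N (h g) (h' g)"
proof -
  interpret h: group_hom G H h by fact
  interpret h': group_hom G H h' by fact
  have Nsg: "subgroup N H" by (rule normal_imp_subgroup[OF N])
  let ?B = "{g \<in> carrier G. eqm H N (h g) (h' g)}"
  have B: "subgroup ?B G"
  proof (rule h.G.subgroupI)
    have "\<one>\<^bsub>G\<^esub> \<in> ?B" using Nsg by (simp add: h.H.eqm_refl)
    then show "?B \<noteq> {}" by blast
    show "inv\<^bsub>G\<^esub> a \<in> ?B" if "a \<in> ?B" for a using that h.H.eqm_inv[OF N] by simp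
    show "a \<otimes>\<^bsub>G\<^esub> b \<in> ?B" if "a \<in> ?B" "b \<in> ?B" for a b using that h.H.eqm_mult[OF N] by simp
  qed auto
  have "generate G S \<subseteq> ?B" using S agree by (intro h.G.generate_subgroup_incl[OF _ B]) auto
  then show ?thesis using g by blast
qed

text \<open>For characteristic \<open>N\<close> this is the principal congruence subgroup of level
  \<open>N\<close>, the kernel of the action on \<open>G / N\<close>.\<close>

definition cong_aut :: "('a, 'b) monoid_scheme \<Rightarrow> 'a set \<Rightarrow> ('a \<Rightarrow> 'a) set" where
  "cong_aut G N = {\<phi> \<in> auto G. \<forall>g\<in>carrier G. eqm G N g (\<phi> g)}"

context group
begin

section \<open>Finite index and power subgroups\<close>

lemma finite_reps_rcosets:
  assumes N: "N \<lhd> G" and T: "finite T" "T \<subseteq> carrier G"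
    and reps: "\<And>x. x \<in> carrier G \<Longrightarrow> \<exists>a\<in>T. inv a \<otimes> x \<in> N"
  shows "N \<in> fin_normal G"
proof -
  have "rcosets N \<subseteq> (\<lambda>a. N #> a) ` T"
  proof
    fix C assume "C \<in> rcosets N"
    then obtain x where x: "x \<in> carrier G" "C = N #> x" by (auto simp: RCOSETS_def)
    obtain a where a: "a \<in> T" "inv a \<otimes> x \<in> N" using reps[OF x(1)] by blast
    have "eqm G N a x" using a x T by (auto simp: eqm_def)
    then have "N #> a = N #> x" using eqm_rcos(2)[OF N, of a x] a x T by auto
    then show "C \<in> (\<lambda>a. N #> a) ` T" using a x by blast
  qed
  then show ?thesis using N T finite_subset unfolding fin_normal_def by blast
qed

lemma fin_normal_finite_reps:
  assumes "N \<in> fin_normal G"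
  shows "\<exists>T. finite T \<and> T \<subseteq> carrier G \<and> (\<forall>x\<in>carrier G. \<exists>a\<in>T. inv a \<otimes> x \<in> N)"
proof -
  have N: "N \<lhd> G" and fin: "finite (rcosets N)" using assms by (auto simp: fin_normal_def)
  have Nsg: "subgroup N G" by (rule normal_imp_subgroup[OF N])
  define T where "T = (\<lambda>C. SOME x. x \<in> C) ` (rcosets N)"
  have *: "(SOME y. y \<in> N #> x) \<in> N #> x" if x: "x \<in> carrier G" for x
    using rcos_self[OF x Nsg] by (rule someI)
  have "T \<subseteq> carrier G"
    using * r_coset_subset_G[OF subgroup.subset[OF Nsg]] by (fastforce simp: T_def RCOSETS_def)
  moreover have "\<exists>a\<in>T. inv a \<otimes> x \<in> N" if x: "x \<in> carrier G" for x
  proof -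
    let ?a = "SOME y. y \<in> N #> x"
    have a: "?a \<in> carrier G" using *[OF x] r_coset_subset_G[OF subgroup.subset[OF Nsg] x] by blast
    have "eqm G N x ?a" using *[OF x] eqm_rcos(1)[OF N x a] by blast
    then have "inv ?a \<otimes> x \<in> N" using eqm_sym[OF Nsg] unfolding eqm_def by blast
    moreover have "?a \<in> T" using x by (auto simp: T_def RCOSETS_def)
    ultimately show ?thesis by blast
  qed
  ultimately show ?thesis using fin by (intro exI[of _ T]) (auto simp: T_def)
qed

lemma fin_normal_powers:
  assumes "N \<in> fin_normal G" shows "\<exists>n>0. powers G (carrier G) n \<subseteq> N"
proof -
  have Nsg: "subgroup N G" using assms by (auto simp: fin_normal_def normal_imp_subgroup)
  obtain T where T: "finite T" "T \<subseteq> carrier G" "\<And>x. x \<in> carrier G \<Longrightarrow> \<exists>a\<in>T. inv a \<otimes> x \<in> N"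
    using fin_normal_finite_reps[OF assms] by blast
  have "x [^] (fact (card T) :: nat) \<in> N" if "x \<in> carrier G" for x
    using finite_reps_exponent[OF Nsg subgroup_self T that] .
  then have "powers G (carrier G) (fact (card T)) \<subseteq> N" by (rule powers_subset[OF Nsg])
  then show ?thesis by (intro exI[of _ "fact (card T)"]) simp
qed

lemma powers_fin_normal:
  assumes "polycyclic G (carrier G)" "n > 0" shows "powers G (carrier G) n \<in> fin_normal G"
proof -
  have "\<exists>T. finite T \<and> T \<subseteq> carrier G \<and> (\<forall>x\<in>carrier G. \<exists>a\<in>T. inv a \<otimes> x \<in> powers G (carrier G) n)"
    using assms normal_normalizing[OF powers_normal]
    by (intro polycyclic_finite_reps[of _ _ n]) (auto simp: powers_subgroup powers_mem)
  then show ?thesis using finite_reps_rcosets[OF powers_normal] by blast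
qed

subsection \<open>The torsion of the abelianization\<close>

lemma eqm_pow_mult:
  assumes "x \<in> carrier G" "y \<in> carrier G"
  shows "eqm G (lower_central G 1) ((x \<otimes> y) [^] (n::nat)) (x [^] n \<otimes> y [^] n)"
proof (induction n)
  case 0
  then show ?case by (simp add: eqm_refl lower_central_subgroup)
next
  case (Suc n)
  let ?L = "lower_central G 1"
  note L = lower_central_normal[of 1] and Lsg = lower_central_subgroup[of 1]
  have 1: "eqm G ?L ((x \<otimes> y) [^] n \<otimes> (x \<otimes> y)) ((x [^] n \<otimes> y [^] n) \<otimes> (x \<otimes> y))"
    using assms by (intro eqm_mult[OF L Suc eqm_refl[OF _ Lsg]]) auto
  have "eqm G ?L (y [^] n \<otimes> x) (x \<otimes> y [^] n)"
    using eqm_commute[of x 0 "y [^] n"] assms by simp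
  then have "eqm G ?L (x [^] n \<otimes> (y [^] n \<otimes> x) \<otimes> y) (x [^] n \<otimes> (x \<otimes> y [^] n) \<otimes> y)"
    using assms eqm_mult[OF L eqm_mult[OF L eqm_refl[OF _ Lsg]] eqm_refl[OF _ Lsg]] by simp
  then have "eqm G ?L ((x [^] n \<otimes> y [^] n) \<otimes> (x \<otimes> y)) (x [^] Suc n \<otimes> y [^] Suc n)"
    using assms by (simp add: m_assoc)
  then show ?case using eqm_trans[OF Lsg 1] by simp
qed

lemma tor_preimage_def': "tor_preimage G = {g \<in> carrier G. \<exists>n::nat. n > 0 \<and> g [^] n \<in> lower_central G 1}"
  unfolding tor_preimage_def derived_eq_lower_central ..

lemma pow_mult_in_derived:
  assumes "x \<in> carrier G" "x [^] (n::nat) \<in> lower_central G 1"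
  shows "x [^] (n * m) \<in> lower_central G 1"
  using subgroup_nat_pow_closed[OF lower_central_subgroup assms(2), of m] assms(1) by (simp add: nat_pow_pow)

lemma pow_mult_closed_in_derived:
  assumes "x \<in> carrier G" "y \<in> carrier G" "x [^] (n::nat) \<in> lower_central G 1" "y [^] n \<in> lower_central G 1"
  shows "(x \<otimes> y) [^] n \<in> lower_central G 1"
proof -
  have "x [^] n \<otimes> y [^] n \<in> lower_central G 1"
    by (rule subgroup.m_closed[OF lower_central_subgroup assms(3,4)])
  then show ?thesis
    using eqm_mem[OF lower_central_subgroup eqm_sym[OF lower_central_subgroup eqm_pow_mult[OF assms(1,2)]]] by blast
qed

lemma pow_inv_in_derived:
  assumes "x \<in> carrier G" "x [^] (n::nat) \<in> lower_central G 1"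
  shows "(inv x) [^] n \<in> lower_central G 1"
  using assms subgroup.m_inv_closed[OF lower_central_subgroup assms(2)] by (simp add: nat_pow_inv)

lemma derived_subset_tor_preimage: "lower_central G 1 \<subseteq> tor_preimage G"
proof
  fix x assume x: "x \<in> lower_central G 1"
  then have "x \<in> carrier G" "x [^] (1::nat) \<in> lower_central G 1" using lower_central_closed[OF x] by simp_all
  then show "x \<in> tor_preimage G" unfolding tor_preimage_def' by force
qed

lemma tor_preimage_subgroup: "subgroup (tor_preimage G) G"
proof (rule subgroupI)
  show "tor_preimage G \<subseteq> carrier G" by (auto simp: tor_preimage_def)
  show "tor_preimage G \<noteq> {}"
    using derived_subset_tor_preimage subgroup.one_closed[OF lower_central_subgroup] by blast
  show "inv a \<in> tor_preimage G" if "a \<in> tor_preimage G" for a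
    using that pow_inv_in_derived unfolding tor_preimage_def' by blast
  show "a \<otimes> b \<in> tor_preimage G" if ab: "a \<in> tor_preimage G" "b \<in> tor_preimage G" for a b
  proof -
    obtain n m :: nat where nm: "n > 0" "a [^] n \<in> lower_central G 1" "m > 0" "b [^] m \<in> lower_central G 1"
      and c: "a \<in> carrier G" "b \<in> carrier G"
      using ab unfolding tor_preimage_def' by blast
    have "(a \<otimes> b) [^] (n * m) \<in> lower_central G 1"
      using pow_mult_in_derived[OF c(1) nm(2), of m] pow_mult_in_derived[OF c(2) nm(4), of n]
      by (intro pow_mult_closed_in_derived c) (simp_all add: mult.commute)
    then show ?thesis using nm c unfolding tor_preimage_def' by (auto intro!: exI[of _ "n * m"])
  qed
qed

lemma tor_preimage_normal: "tor_preimage G \<lhd> G"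
proof -
  have "g \<otimes> z \<otimes> inv g \<in> tor_preimage G" if g: "g \<in> carrier G" and z: "z \<in> tor_preimage G" for g z
  proof -
    have zc: "z \<in> lower_central G 0" using z by (simp add: tor_preimage_def)
    have "eqm G (tor_preimage G) z (g \<otimes> z \<otimes> inv g)"
      using eqm_central[OF zc g] eqm_mono[OF _ derived_subset_tor_preimage] eqm_sym[OF tor_preimage_subgroup] by auto
    then show ?thesis using eqm_mem[OF tor_preimage_subgroup _ z] by blast
  qed
  then show ?thesis unfolding normal_inv_iff using tor_preimage_subgroup by blast
qed

text \<open>The torsion is finitely generated and taking powers is multiplicative modulo
  commutators, so the product of the exponents of finitely many generators serves all
  elements.\<close>

lemma tor_preimage_exponent:
  assumes E: "polycyclic G (carrier G)"
  shows "\<exists>r>0. \<forall>x\<in>tor_preimage G. x [^] (r::nat) \<in> lower_central G 1"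
proof -
  let ?R = "tor_preimage G"
  obtain T where T: "finite T" "T \<subseteq> ?R" "generate G T = ?R"
    using polycyclic_subgroup_fin_gen[OF E tor_preimage_subgroup subgroup.subset[OF tor_preimage_subgroup]] by blast
  have "\<forall>x\<in>T. \<exists>n::nat. n > 0 \<and> x [^] n \<in> lower_central G 1" using T(2) unfolding tor_preimage_def' by blast
  then obtain e :: "'a \<Rightarrow> nat" where e: "\<And>x. x \<in> T \<Longrightarrow> e x > 0" "\<And>x. x \<in> T \<Longrightarrow> x [^] e x \<in> lower_central G 1"
    by metis
  define r where "r = (\<Prod>x\<in>T. e x)"
  have r: "r > 0" unfolding r_def using e(1) by (intro prod_pos)
  let ?B = "{x \<in> carrier G. x [^] r \<in> lower_central G 1}"
  have B: "subgroup ?B G"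
  proof (rule subgroupI)
    have "\<one> \<in> ?B" using subgroup.one_closed[OF lower_central_subgroup] by simp
    then show "?B \<noteq> {}" by blast
    show "inv a \<in> ?B" if "a \<in> ?B" for a using that pow_inv_in_derived by simp
    show "a \<otimes> b \<in> ?B" if "a \<in> ?B" "b \<in> ?B" for a b using that pow_mult_closed_in_derived by simp
  qed auto
  have "T \<subseteq> ?B"
  proof
    fix x assume x: "x \<in> T"
    have xc: "x \<in> carrier G" using x T(2) by (auto simp: tor_preimage_def)
    have "e x dvd r" unfolding r_def using x T(1) by (rule dvd_prodI[rotated])
    then obtain m where "r = e x * m" by auto
    then show "x \<in> ?B" using pow_mult_in_derived[OF xc e(2)[OF x]] xc by simp
  qed
  then have "?R \<subseteq> ?B" using generate_subgroup_incl[OF _ B, of T] T(3) by simp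
  then show ?thesis using r by (intro exI[of _ r]) blast
qed

text \<open>Membership in \<open>IA_star\<close> controls classes modulo
  \<open>tor_preimage G\<close> only. At the level found here a congruence refines such a class to a
  class modulo commutators, where the lower central series takes over.\<close>

lemma tor_preimage_separation:
  assumes E: "polycyclic G (carrier G)"
  shows "\<exists>n>0. tor_preimage G \<inter> powers G (carrier G) n \<subseteq> lower_central G 1"
proof -
  obtain r :: nat where "r > 0" "\<forall>x\<in>tor_preimage G. x [^] r \<in> lower_central G 1"
    using tor_preimage_exponent[OF E] by blast
  then show ?thesis
    using polycyclic_separation[OF E tor_preimage_subgroup subgroup.subset[OF tor_preimage_subgroup]
        lower_central_subgroup] by blast
qed

subsection \<open>Automorphisms\<close>

lemma autoE:
  assumes "\<phi> \<in> auto G"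
  shows "group_hom G G \<phi>" "\<phi> \<in> extensional (carrier G)" "bij_betw \<phi> (carrier G) (carrier G)"
  using assms by (auto simp: auto_def Bij_def group_hom_def group_hom_axioms_def is_group)

lemma auto_closed: "\<phi> \<in> auto G \<Longrightarrow> g \<in> carrier G \<Longrightarrow> \<phi> g \<in> carrier G"
  using autoE(1) group_hom.hom_closed by fast

lemma auto_eqI:
  assumes "\<phi> \<in> auto G" "\<psi> \<in> auto G" "\<And>g. g \<in> carrier G \<Longrightarrow> \<phi> g = \<psi> g" shows "\<phi> = \<psi>"
  using autoE(2)[OF assms(1)] autoE(2)[OF assms(2)] assms(3) by (rule extensionalityI)

lemma carrier_AutoGroup: "carrier (AutoGroup G) = auto G"
  by (simp add: AutoGroup_def)

lemma AutoGroup_mult: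
  assumes "\<phi> \<in> auto G" "\<psi> \<in> auto G"
  shows "\<phi> \<otimes>\<^bsub>AutoGroup G\<^esub> \<psi> = compose (carrier G) \<phi> \<psi>"
  using assms by (simp add: AutoGroup_def BijGroup_def auto_def)

lemma AutoGroup_mult_apply:
  assumes "\<phi> \<in> auto G" "\<psi> \<in> auto G" "g \<in> carrier G"
  shows "(\<phi> \<otimes>\<^bsub>AutoGroup G\<^esub> \<psi>) g = \<phi> (\<psi> g)"
  using assms by (simp add: AutoGroup_mult compose_def)

lemma AutoGroup_one_apply: "g \<in> carrier G \<Longrightarrow> \<one>\<^bsub>AutoGroup G\<^esub> g = g"
  by (simp add: AutoGroup_def BijGroup_def)

lemma AutoGroup_inv_closed: "\<phi> \<in> auto G \<Longrightarrow> inv\<^bsub>AutoGroup G\<^esub> \<phi> \<in> auto G"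
  using group.inv_closed[OF AutoGroup] carrier_AutoGroup by blast

lemma AutoGroup_inv_apply:
  assumes "\<phi> \<in> auto G" "g \<in> carrier G"
  shows "\<phi> ((inv\<^bsub>AutoGroup G\<^esub> \<phi>) g) = g" "(inv\<^bsub>AutoGroup G\<^esub> \<phi>) (\<phi> g) = g"
  using AutoGroup_mult_apply[OF assms(1) AutoGroup_inv_closed[OF assms(1)] assms(2)]
    AutoGroup_mult_apply[OF AutoGroup_inv_closed[OF assms(1)] assms(1) assms(2)]
    group.r_inv[OF AutoGroup] group.l_inv[OF AutoGroup] AutoGroup_one_apply[OF assms(2)] assms(1)
  by (simp_all add: carrier_AutoGroup)

lemma cong_aut_subgroup:
  assumes N: "subgroup N G" shows "subgroup (cong_aut G N) (AutoGroup G)"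
proof (rule group.subgroupI[OF AutoGroup])
  show "cong_aut G N \<subseteq> carrier (AutoGroup G)" by (auto simp: cong_aut_def carrier_AutoGroup)
  have "\<one>\<^bsub>AutoGroup G\<^esub> \<in> cong_aut G N"
    using group.is_monoid[OF AutoGroup] monoid.one_closed carrier_AutoGroup
    by (auto simp: cong_aut_def AutoGroup_one_apply eqm_refl N)
  then show "cong_aut G N \<noteq> {}" by blast
next
  fix \<phi> assume \<phi>: "\<phi> \<in> cong_aut G N"
  then have a: "\<phi> \<in> auto G" by (simp add: cong_aut_def)
  let ?i = "inv\<^bsub>AutoGroup G\<^esub> \<phi>"
  have "eqm G N g (?i g)" if g: "g \<in> carrier G" for g
  proof -
    have "?i g \<in> carrier G" using auto_closed[OF AutoGroup_inv_closed[OF a] g] .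
    then have "eqm G N (?i g) (\<phi> (?i g))" using \<phi> by (simp add: cong_aut_def)
    then show ?thesis using AutoGroup_inv_apply[OF a g] eqm_sym[OF N] by simp
  qed
  then show "?i \<in> cong_aut G N" using AutoGroup_inv_closed[OF a] by (simp add: cong_aut_def)
next
  fix \<phi> \<psi> assume \<phi>: "\<phi> \<in> cong_aut G N" and \<psi>: "\<psi> \<in> cong_aut G N"
  then have a: "\<phi> \<in> auto G" "\<psi> \<in> auto G" by (simp_all add: cong_aut_def)
  have "\<phi> \<otimes>\<^bsub>AutoGroup G\<^esub> \<psi> \<in> auto G"
    using a group.is_monoid[OF AutoGroup] monoid.m_closed carrier_AutoGroup by metis
  moreover have "eqm G N g (\<phi> (\<psi> g))" if g: "g \<in> carrier G" for g
    using \<phi> \<psi> g auto_closed[OF a(2) g] eqm_trans[OF N, of g "\<psi> g" "\<phi> (\<psi> g)"] by (simp add: cong_aut_def)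
  ultimately show "\<phi> \<otimes>\<^bsub>AutoGroup G\<^esub> \<psi> \<in> cong_aut G N"
    using a by (simp add: cong_aut_def AutoGroup_mult_apply)
qed

lemma cong_aut_quotient:
  assumes N: "N \<lhd> G" and char: "\<And>\<phi>. \<phi> \<in> auto G \<Longrightarrow> \<phi> ` N \<subseteq> N"
    and a: "\<phi> \<in> auto G" "\<psi> \<in> auto G" and S: "S \<subseteq> carrier G" "generate G S = carrier G"
    and eq: "\<And>s. s \<in> S \<Longrightarrow> eqm G N (\<psi> s) (\<phi> s)"
  shows "inv\<^bsub>AutoGroup G\<^esub> \<psi> \<otimes>\<^bsub>AutoGroup G\<^esub> \<phi> \<in> cong_aut G N"
proof -
  let ?i = "inv\<^bsub>AutoGroup G\<^esub> \<psi>"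
  have i: "?i \<in> auto G" by (rule AutoGroup_inv_closed[OF a(2)])
  have "?i \<otimes>\<^bsub>AutoGroup G\<^esub> \<phi> \<in> auto G"
    using i a group.is_monoid[OF AutoGroup] monoid.m_closed carrier_AutoGroup by metis
  moreover have "eqm G N g (?i (\<phi> g))" if g: "g \<in> carrier G" for g
  proof -
    have "eqm G N (\<psi> g) (\<phi> g)"
      using g S by (intro eqm_homs_generate[OF autoE(1)[OF a(2)] autoE(1)[OF a(1)] N S(1) eq]) auto
    then have "eqm G N (?i (\<psi> g)) (?i (\<phi> g))"
      using group_hom.eqm_hom[OF autoE(1)[OF i]] char[OF i] by blast
    then show ?thesis using AutoGroup_inv_apply[OF a(2) g] by simp
  qed
  ultimately show ?thesis using a i by (simp add: cong_aut_def AutoGroup_mult_apply)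
qed

lemma auto_powers: "\<phi> \<in> auto G \<Longrightarrow> \<phi> ` powers G (carrier G) n \<subseteq> powers G (carrier G) n"
  by (rule group_hom.hom_powers[OF autoE(1)])

lemma auto_lower_central: "\<phi> \<in> auto G \<Longrightarrow> \<phi> ` lower_central G k \<subseteq> lower_central G k"
  using group_hom.lower_central_img_subset[OF autoE(1)] by blast

text \<open>Modulo the congruence subgroup an automorphism is determined by the classes of the
  images of the finitely many generators.\<close>

lemma cong_aut_finite_reps:
  assumes N: "N \<in> fin_normal G" and char: "\<And>\<phi>. \<phi> \<in> auto G \<Longrightarrow> \<phi> ` N \<subseteq> N"
    and S: "finite S" "S \<subseteq> carrier G" "generate G S = carrier G" and H: "H \<subseteq> auto G"
  shows "\<exists>T. finite T \<and> T \<subseteq> H \<and> (\<forall>\<phi>\<in>H. \<exists>\<psi>\<in>T. inv\<^bsub>AutoGroup G\<^esub> \<psi> \<otimes>\<^bsub>AutoGroup G\<^esub> \<phi> \<in> cong_aut G N)"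
proof -
  have Nn: "N \<lhd> G" and fin: "finite (rcosets N)" using N by (auto simp: fin_normal_def)
  define f where "f = (\<lambda>\<phi>. \<lambda>s\<in>S. N #> \<phi> s)"
  have "f ` H \<subseteq> (\<Pi>\<^sub>E s\<in>S. rcosets N)"
    using H S(2) auto_closed rcosetsI[OF subgroup.subset[OF normal_imp_subgroup[OF Nn]]]
    by (auto simp: f_def subset_iff)
  then have "finite (f ` H)" using S(1) fin finite_subset finite_PiE by metis
  then have "finite (inv_into H f ` f ` H)" by simp
  moreover have "inv_into H f ` f ` H \<subseteq> H" by (auto intro: inv_into_into)
  moreover have "\<exists>\<psi>\<in>inv_into H f ` f ` H. inv\<^bsub>AutoGroup G\<^esub> \<psi> \<otimes>\<^bsub>AutoGroup G\<^esub> \<phi> \<in> cong_aut G N"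
    if \<phi>: "\<phi> \<in> H" for \<phi>
  proof -
    define \<psi> where "\<psi> = inv_into H f (f \<phi>)"
    have \<psi>: "\<psi> \<in> H" "f \<psi> = f \<phi>" using \<phi> by (auto simp: \<psi>_def inv_into_into f_inv_into_f)
    have "eqm G N (\<psi> s) (\<phi> s)" if s: "s \<in> S" for s
    proof -
      have "N #> \<psi> s = N #> \<phi> s" using fun_cong[OF \<psi>(2), of s] s by (simp add: f_def)
      then show ?thesis using eqm_rcos(2)[OF Nn] auto_closed s S(2) H \<phi> \<psi>(1) by (meson subsetD)
    qed
    then have "inv\<^bsub>AutoGroup G\<^esub> \<psi> \<otimes>\<^bsub>AutoGroup G\<^esub> \<phi> \<in> cong_aut G N"
      using H \<phi> \<psi>(1) by (intro cong_aut_quotient[OF Nn char _ _ S(2,3)]) auto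
    then show ?thesis using \<phi> by (auto simp: \<psi>_def)
  qed
  ultimately show ?thesis by blast
qed

lemma cong_aut_exponent:
  assumes N: "N \<in> fin_normal G" and char: "\<And>\<phi>. \<phi> \<in> auto G \<Longrightarrow> \<phi> ` N \<subseteq> N"
    and S: "finite S" "S \<subseteq> carrier G" "generate G S = carrier G"
  shows "\<exists>m>0. \<forall>\<phi>\<in>auto G. \<phi> [^]\<^bsub>AutoGroup G\<^esub> (m::nat) \<in> cong_aut G N"
proof -
  interpret A: group "AutoGroup G" by (rule AutoGroup)
  have Nsg: "subgroup N G" using N by (auto simp: fin_normal_def normal_imp_subgroup)
  obtain T where T: "finite T" "T \<subseteq> auto G"
    "\<And>\<phi>. \<phi> \<in> auto G \<Longrightarrow> \<exists>\<psi>\<in>T. inv\<^bsub>AutoGroup G\<^esub> \<psi> \<otimes>\<^bsub>AutoGroup G\<^esub> \<phi> \<in> cong_aut G N"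
    using cong_aut_finite_reps[OF N char S order_refl] by auto
  have "\<phi> [^]\<^bsub>AutoGroup G\<^esub> (fact (card T)::nat) \<in> cong_aut G N" if "\<phi> \<in> auto G" for \<phi>
    using A.finite_reps_exponent[OF cong_aut_subgroup[OF Nsg] A.subgroup_self T(1)] T(2,3) that
    by (simp add: carrier_AutoGroup)
  then show ?thesis by (intro exI[of _ "fact (card T)"]) auto
qed

end

section \<open>Displacements of the generators and the congruence subgroup property\<close>

context group
begin

lemma cong_aut_central:
  assumes z: "z \<in> cong_aut G (lower_central G 1)" and a: "a \<in> lower_central G k"
  shows "eqm G (lower_central G (Suc k)) a (z a)"
proof (rule eqm_homs_lower_central[where h = "\<lambda>x. x" and h' = z])
  show "group_hom G G (\<lambda>x. x)" by (simp add: group_hom_def group_hom_axioms_def is_group hom_def)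
  show "group_hom G G z" using z autoE(1) by (simp add: cong_aut_def)
  show "eqm G (lower_central G 1) w (z w)" if "w \<in> carrier G" for w using z that by (simp add: cong_aut_def)
  show "a \<in> lower_central G k" by fact
qed

text \<open>One has \<open>z (w g) = z g \<otimes> z (inv g \<otimes> w g)\<close>. As
  \<open>k \<ge> 1\<close>, the automorphism \<open>z\<close> is trivial modulo commutators and so
  fixes the element \<open>inv g \<otimes> w g\<close> of \<open>lower_central G k\<close> up to the
  next term.\<close>

lemma displacement_mult:
  assumes k: "k \<ge> 1" and zw: "z \<in> cong_aut G (lower_central G k)" "w \<in> cong_aut G (lower_central G k)"
    and g: "g \<in> carrier G"
  shows "eqm G (lower_central G (Suc k)) (inv g \<otimes> (z \<otimes>\<^bsub>AutoGroup G\<^esub> w) g) ((inv g \<otimes> z g) \<otimes> (inv g \<otimes> w g))"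
proof -
  note L = lower_central_normal[of "Suc k"] and Lsg = lower_central_subgroup[of "Suc k"]
  have a: "z \<in> auto G" "w \<in> auto G" using zw by (auto simp: cong_aut_def)
  interpret z: group_hom G G z by (rule autoE(1)[OF a(1)])
  have c: "z g \<in> carrier G" "w g \<in> carrier G" using a g auto_closed by auto
  have wg: "inv g \<otimes> w g \<in> lower_central G k" using zw g by (simp add: cong_aut_def eqm_def)
  have "z \<in> cong_aut G (lower_central G 1)"
    using zw(1) eqm_mono[OF _ lower_central_antimono[OF k]] by (auto simp: cong_aut_def)
  then have "eqm G (lower_central G (Suc k)) (z (inv g \<otimes> w g)) (inv g \<otimes> w g)"
    using eqm_sym[OF Lsg cong_aut_central[OF _ wg]] by blast
  then have "eqm G (lower_central G (Suc k)) ((inv g \<otimes> z g) \<otimes> z (inv g \<otimes> w g)) ((inv g \<otimes> z g) \<otimes> (inv g \<otimes> w g))"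
    using g c by (intro eqm_mult[OF L eqm_refl[OF _ Lsg]]) auto
  moreover have "(inv g \<otimes> z g) \<otimes> z (inv g \<otimes> w g) = inv g \<otimes> (z \<otimes>\<^bsub>AutoGroup G\<^esub> w) g"
    using g c a by (simp add: AutoGroup_mult_apply m_assoc)
  ultimately show ?thesis by simp
qed

text \<open>The full preimage in the direct power of the displacement tuples modulo
  \<open>lower_central G (Suc k)\<close>. Displacements are multiplicative only modulo that term;
  taking the preimage yields a subgroup of the direct power, to which separability applies
  directly.\<close>

definition displacements :: "'a set \<Rightarrow> nat \<Rightarrow> ('a \<Rightarrow> 'a) set \<Rightarrow> ('a \<Rightarrow> 'a) set" where
  "displacements S k Y = {x \<in> carrier (power_group S G).
     \<exists>z\<in>Y. \<forall>s\<in>S. eqm G (lower_central G (Suc k)) (inv s \<otimes> z s) (x s)}"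

context
  fixes S :: "'a set" and k :: nat
  assumes S: "S \<subseteq> carrier G" and k: "k \<ge> 1"
begin

lemma displacement_rel_mult:
  assumes zw: "z \<in> cong_aut G (lower_central G k)" "w \<in> cong_aut G (lower_central G k)"
    and x: "\<And>s. s \<in> S \<Longrightarrow> eqm G (lower_central G (Suc k)) (inv s \<otimes> z s) (x s)"
    and y: "\<And>s. s \<in> S \<Longrightarrow> eqm G (lower_central G (Suc k)) (inv s \<otimes> w s) (y s)"
    and s: "s \<in> S"
  shows "eqm G (lower_central G (Suc k)) (inv s \<otimes> (z \<otimes>\<^bsub>AutoGroup G\<^esub> w) s) ((x \<otimes>\<^bsub>power_group S G\<^esub> y) s)"
proof -
  have sc: "s \<in> carrier G" using s S by blast
  have "eqm G (lower_central G (Suc k)) ((inv s \<otimes> z s) \<otimes> (inv s \<otimes> w s)) (x s \<otimes> y s)"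
    by (rule eqm_mult[OF lower_central_normal x[OF s] y[OF s]])
  then show ?thesis
    using eqm_trans[OF lower_central_subgroup displacement_mult[OF k zw sc]] s by simp
qed

lemma displacements_subgroup:
  assumes Y: "subgroup Y (AutoGroup G)" "Y \<subseteq> cong_aut G (lower_central G k)"
  shows "subgroup (displacements S k Y) (power_group S G)"
proof -
  interpret P: group "power_group S G" by (rule power_group_group)
  interpret A: group "AutoGroup G" by (rule AutoGroup)
  note L = lower_central_normal[of "Suc k"] and Lsg = lower_central_subgroup[of "Suc k"]
  show ?thesis
  proof (rule P.subgroupI)
    show "displacements S k Y \<subseteq> carrier (power_group S G)" by (auto simp: displacements_def)
    have "eqm G (lower_central G (Suc k)) (inv s \<otimes> \<one>\<^bsub>AutoGroup G\<^esub> s) (\<one>\<^bsub>power_group S G\<^esub> s)" if "s \<in> S" for s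
      using that S eqm_refl[OF one_closed Lsg] by (simp add: AutoGroup_one_apply subset_iff)
    then have "\<one>\<^bsub>power_group S G\<^esub> \<in> displacements S k Y"
      unfolding displacements_def using subgroup.one_closed[OF Y(1)] P.one_closed by blast
    then show "displacements S k Y \<noteq> {}" by blast
  next
    fix x assume "x \<in> displacements S k Y"
    then obtain z where xc: "x \<in> carrier (power_group S G)" and z: "z \<in> Y"
      and r: "\<And>s. s \<in> S \<Longrightarrow> eqm G (lower_central G (Suc k)) (inv s \<otimes> z s) (x s)"
      by (auto simp: displacements_def)
    let ?i = "inv\<^bsub>AutoGroup G\<^esub> z"
    have za: "z \<in> auto G" using z Y(2) by (auto simp: cong_aut_def)
    have i: "?i \<in> Y" by (rule subgroup.m_inv_closed[OF Y(1) z])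
    have ia: "?i \<in> auto G" by (rule AutoGroup_inv_closed[OF za])
    have "eqm G (lower_central G (Suc k)) (inv s \<otimes> ?i s) ((inv\<^bsub>power_group S G\<^esub> x) s)" if s: "s \<in> S" for s
    proof -
      have sc: "s \<in> carrier G" using s S by blast
      have xs: "x s \<in> carrier G" using xc s by (auto simp: PiE_iff)
      have c: "z s \<in> carrier G" "?i s \<in> carrier G" using za ia sc auto_closed by auto
      have "eqm G (lower_central G (Suc k)) (inv s \<otimes> (z \<otimes>\<^bsub>AutoGroup G\<^esub> ?i) s) ((inv s \<otimes> z s) \<otimes> (inv s \<otimes> ?i s))"
        using Y z i by (intro displacement_mult[OF k _ _ sc]) auto
      then have "eqm G (lower_central G (Suc k)) \<one> ((inv s \<otimes> z s) \<otimes> (inv s \<otimes> ?i s))"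
        using za sc by (simp add: carrier_AutoGroup AutoGroup_one_apply)
      then have "eqm G (lower_central G (Suc k)) (inv (inv s \<otimes> z s) \<otimes> \<one>)
          (inv (inv s \<otimes> z s) \<otimes> ((inv s \<otimes> z s) \<otimes> (inv s \<otimes> ?i s)))"
        using sc c by (intro eqm_mult[OF L eqm_refl[OF _ Lsg]]) auto
      then have "eqm G (lower_central G (Suc k)) (inv (inv s \<otimes> z s)) (inv s \<otimes> ?i s)"
        using sc c by simp
      moreover have "eqm G (lower_central G (Suc k)) (inv (inv s \<otimes> z s)) (inv (x s))"
        by (rule eqm_inv[OF L r[OF s]])
      ultimately have "eqm G (lower_central G (Suc k)) (inv s \<otimes> ?i s) (inv (x s))"
        using eqm_trans[OF Lsg] eqm_sym[OF Lsg] by blast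
      then show ?thesis using xc s by (simp add: is_group)
    qed
    then show "inv\<^bsub>power_group S G\<^esub> x \<in> displacements S k Y"
      unfolding displacements_def using i P.inv_closed[OF xc] by blast
  next
    fix x y assume x: "x \<in> displacements S k Y" and y: "y \<in> displacements S k Y"
    then obtain z w where c: "x \<in> carrier (power_group S G)" "y \<in> carrier (power_group S G)"
      and z: "z \<in> Y" "\<And>s. s \<in> S \<Longrightarrow> eqm G (lower_central G (Suc k)) (inv s \<otimes> z s) (x s)"
      and w: "w \<in> Y" "\<And>s. s \<in> S \<Longrightarrow> eqm G (lower_central G (Suc k)) (inv s \<otimes> w s) (y s)"
      by (auto simp: displacements_def)
    have "z \<otimes>\<^bsub>AutoGroup G\<^esub> w \<in> Y" by (rule subgroup.m_closed[OF Y(1) z(1) w(1)])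
    moreover have "\<forall>s\<in>S. eqm G (lower_central G (Suc k)) (inv s \<otimes> (z \<otimes>\<^bsub>AutoGroup G\<^esub> w) s) ((x \<otimes>\<^bsub>power_group S G\<^esub> y) s)"
      using displacement_rel_mult[OF _ _ z(2) w(2)] z(1) w(1) Y(2) by blast
    ultimately show "x \<otimes>\<^bsub>power_group S G\<^esub> y \<in> displacements S k Y"
      unfolding displacements_def using P.m_closed[OF c] by blast
  qed
qed

lemma displacements_pow:
  assumes z: "z \<in> cong_aut G (lower_central G k)" and x: "x \<in> carrier (power_group S G)"
    and r: "\<And>s. s \<in> S \<Longrightarrow> eqm G (lower_central G (Suc k)) (inv s \<otimes> z s) (x s)"
    and s: "s \<in> S"
  shows "eqm G (lower_central G (Suc k)) (inv s \<otimes> (z [^]\<^bsub>AutoGroup G\<^esub> (n::nat)) s) ((x [^]\<^bsub>power_group S G\<^esub> n) s)"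
  using s
proof (induction n arbitrary: s)
  case 0
  then have "s \<in> carrier G" using S by blast
  then show ?case using 0 eqm_refl[OF one_closed lower_central_subgroup] by (simp add: AutoGroup_one_apply)
next
  case (Suc n)
  interpret A: group "AutoGroup G" by (rule AutoGroup)
  have "z [^]\<^bsub>AutoGroup G\<^esub> n \<in> cong_aut G (lower_central G k)"
    using A.subgroup_nat_pow_closed[OF cong_aut_subgroup[OF lower_central_subgroup] z] .
  then show ?case using displacement_rel_mult[OF _ z Suc.IH r Suc.prems] by (simp del: mult_product_group)
qed

end

text \<open>If \<open>\<phi>\<close> is close to the identity then \<open>\<phi> = \<mu> z\<close> with \<open>\<mu> \<in> M\<close> and \<open>z\<close> trivial modulo
  \<open>\<gamma>\<^sub>k\<close>; since \<open>z \<mapsto> (s\<inverse> z(s))\<^sub>s\<close> is additive modulo \<open>\<gamma>\<^sub>k\<^sub>+\<^sub>1\<close>, separability of a direct power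
  of \<open>G\<close> allows to pass from \<open>k\<close> to \<open>k + 1\<close>.\<close>

lemma congruence_subgroup_property:
  assumes S: "finite S" "S \<subseteq> carrier G" "generate G S = carrier G" and c: "lower_central G c = {\<one>}"
    and H: "subgroup H (AutoGroup G)" "H \<subseteq> IA_star G"
    and M: "subgroup M (AutoGroup G)" "m > 0" "\<And>\<phi>. \<phi> \<in> H \<Longrightarrow> \<phi> [^]\<^bsub>AutoGroup G\<^esub> (m::nat) \<in> M"
  shows "\<exists>n>0. H \<inter> cong_aut G (powers G (carrier G) n) \<subseteq> M"
proof -
  interpret A: group "AutoGroup G" by (rule AutoGroup)
  interpret P: group "power_group S G" by (rule power_group_group)
  let ?L = "lower_central G" and ?C = "\<lambda>n. cong_aut G (powers G (carrier G) n)"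
  have E: "polycyclic G (carrier G)" by (rule nilpotent_polycyclic[OF S c])
  have PE: "polycyclic (power_group S G) (carrier (power_group S G))"
    by (rule power_group_polycyclic[OF S(1) S c])
  have Ha: "H \<subseteq> auto G" using subgroup.subset[OF H(1)] by (simp add: carrier_AutoGroup)
  have Csg: "subgroup (?C n) (AutoGroup G)" for n by (intro cong_aut_subgroup powers_subgroup order_refl)
  have Cmono: "?C n \<subseteq> ?C n'" if "n' dvd n" for n n'
    using eqm_mono[OF _ powers_dvd[OF order_refl that]] by (auto simp: cong_aut_def)
  have Zsg: "subgroup (H \<inter> cong_aut G (?L k)) (AutoGroup G)" for k
    by (intro A.subgroups_Inter_pair H cong_aut_subgroup lower_central_subgroup)
  \<comment> \<open>\<open>M\<close> and \<open>m\<close> are quantified inside because the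
    inductive step applies the hypothesis to a smaller subgroup than \<open>M\<close>.\<close>
  have claim: "\<exists>n>0. \<forall>\<phi>\<in>H \<inter> ?C n. \<exists>\<mu>\<in>M. \<exists>z\<in>H \<inter> cong_aut G (?L (Suc k)). \<phi> = \<mu> \<otimes>\<^bsub>AutoGroup G\<^esub> z"
    if "subgroup M (AutoGroup G)" "m > 0" "\<And>\<phi>. \<phi> \<in> H \<Longrightarrow> \<phi> [^]\<^bsub>AutoGroup G\<^esub> (m::nat) \<in> M" for k M m
    using that
  proof (induction k arbitrary: M m)
    case 0
    \<comment> \<open>At this level an element of \<open>H\<close> is trivial modulo commutators by
      itself, so the factor from \<open>M\<close> is the identity.\<close>
    obtain n where n: "n > 0" "tor_preimage G \<inter> powers G (carrier G) n \<subseteq> ?L 1"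
      using tor_preimage_separation[OF E] by blast
    have "\<phi> \<in> cong_aut G (?L 1)" if \<phi>: "\<phi> \<in> H \<inter> ?C n" for \<phi>
    proof -
      have "\<phi> \<in> IA_star G" and a: "\<phi> \<in> auto G" using \<phi> H(2) Ha by auto
      have "eqm G (?L 1) g (\<phi> g)" if g: "g \<in> carrier G" for g
      proof -
        have pg: "\<phi> g \<in> carrier G" by (rule auto_closed[OF a g])
        have "tor_preimage G #> g = tor_preimage G #> \<phi> g" using \<open>\<phi> \<in> IA_star G\<close> g by (simp add: IA_star_def)
        then have "eqm G (tor_preimage G) g (\<phi> g)" using eqm_rcos(2)[OF tor_preimage_normal g pg] by simp
        moreover have "eqm G (powers G (carrier G) n) g (\<phi> g)" using \<phi> g by (simp add: cong_aut_def)
        ultimately show ?thesis using n(2) by (auto simp: eqm_def)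
      qed
      then show ?thesis using a by (simp add: cong_aut_def)
    qed
    then show ?case using n(1) subgroup.one_closed[OF 0(1)] Ha
      by (intro exI[of _ n] conjI ballI bexI[of _ "\<one>\<^bsub>AutoGroup G\<^esub>"] bexI)
        (auto simp: carrier_AutoGroup subset_iff)
  next
    case (Suc k)
    let ?k = "Suc k"
    have k1: "?k \<ge> 1" by simp
    let ?Z = "H \<inter> cong_aut G (?L ?k)"
    let ?J = "displacements S ?k"
    have J: "subgroup (?J ?Z) (power_group S G)"
      by (rule displacements_subgroup[OF S(2) k1 Zsg]) blast
    have MZ: "subgroup (M \<inter> ?Z) (AutoGroup G)" by (intro A.subgroups_Inter_pair Suc.prems(1) Zsg)
    have JM: "subgroup (?J (M \<inter> ?Z)) (power_group S G)"
      by (rule displacements_subgroup[OF S(2) k1 MZ]) blast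
    have "x [^]\<^bsub>power_group S G\<^esub> m \<in> ?J (M \<inter> ?Z)" if x: "x \<in> ?J ?Z" for x
    proof -
      obtain z where xc: "x \<in> carrier (power_group S G)" and z: "z \<in> ?Z"
        and r: "\<And>s. s \<in> S \<Longrightarrow> eqm G (?L (Suc ?k)) (inv s \<otimes> z s) (x s)"
        using x by (auto simp: displacements_def)
      have "z [^]\<^bsub>AutoGroup G\<^esub> m \<in> M \<inter> ?Z" using z Suc.prems(3) A.subgroup_nat_pow_closed[OF Zsg z] by blast
      moreover have "\<forall>s\<in>S. eqm G (?L (Suc ?k)) (inv s \<otimes> (z [^]\<^bsub>AutoGroup G\<^esub> m) s) ((x [^]\<^bsub>power_group S G\<^esub> m) s)"
        using displacements_pow[OF S(2) k1 _ xc r] z by blast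
      ultimately show ?thesis unfolding displacements_def using P.nat_pow_closed[OF xc] by blast
    qed
    then have "\<exists>n>0. ?J ?Z \<inter> powers (power_group S G) (carrier (power_group S G)) n \<subseteq> ?J (M \<inter> ?Z)"
      using Suc.prems(2) by (intro P.polycyclic_separation[OF PE J subgroup.subset[OF J] JM])
    then obtain n2 where n2: "n2 > 0"
      "?J ?Z \<inter> powers (power_group S G) (carrier (power_group S G)) n2 \<subseteq> ?J (M \<inter> ?Z)" by blast
    \<comment> \<open>The factor \<open>z\<close> is close to the identity only if
      \<open>\<mu>\<close> is. Hence the induction hypothesis is used for
      \<open>M \<inter> ?C n2\<close>, and \<open>m * m2\<close> is an exponent that brings
      \<open>H\<close> into it.\<close>
    obtain m2 :: nat where m2: "m2 > 0" "\<forall>\<phi>\<in>auto G. \<phi> [^]\<^bsub>AutoGroup G\<^esub> m2 \<in> ?C n2"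
      using cong_aut_exponent[OF powers_fin_normal[OF E n2(1)] auto_powers S] by blast
    have "\<phi> [^]\<^bsub>AutoGroup G\<^esub> (m * m2) \<in> M \<inter> ?C n2" if \<phi>: "\<phi> \<in> H" for \<phi>
    proof -
      have \<phi>c: "\<phi> \<in> carrier (AutoGroup G)" using \<phi> Ha by (auto simp: carrier_AutoGroup)
      have "(\<phi> [^]\<^bsub>AutoGroup G\<^esub> m) [^]\<^bsub>AutoGroup G\<^esub> m2 \<in> M"
        by (rule A.subgroup_nat_pow_closed[OF Suc.prems(1) Suc.prems(3)[OF \<phi>]])
      moreover have "\<phi> [^]\<^bsub>AutoGroup G\<^esub> m2 \<in> ?C n2" using m2(2) \<phi> Ha by blast
      then have "(\<phi> [^]\<^bsub>AutoGroup G\<^esub> m2) [^]\<^bsub>AutoGroup G\<^esub> m \<in> ?C n2"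
        by (rule A.subgroup_nat_pow_closed[OF Csg])
      ultimately show ?thesis using \<phi>c by (simp add: A.nat_pow_pow mult.commute)
    qed
    then have "\<exists>n>0. \<forall>\<phi>\<in>H \<inter> ?C n. \<exists>\<mu>\<in>M \<inter> ?C n2. \<exists>z\<in>?Z. \<phi> = \<mu> \<otimes>\<^bsub>AutoGroup G\<^esub> z"
      using Suc.prems(2) m2(1)
      by (intro Suc.IH[of _ "m * m2"] A.subgroups_Inter_pair Suc.prems(1) Csg) auto
    then obtain n1 where n1: "n1 > 0"
      "\<And>\<phi>. \<phi> \<in> H \<inter> ?C n1 \<Longrightarrow> \<exists>\<mu>\<in>M \<inter> ?C n2. \<exists>z\<in>?Z. \<phi> = \<mu> \<otimes>\<^bsub>AutoGroup G\<^esub> z" by blast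
    have "\<exists>\<mu>\<in>M. \<exists>z\<in>H \<inter> cong_aut G (?L (Suc ?k)). \<phi> = \<mu> \<otimes>\<^bsub>AutoGroup G\<^esub> z" if \<phi>: "\<phi> \<in> H \<inter> ?C (n1 * n2)" for \<phi>
    proof -
      have \<phi>12: "\<phi> \<in> H \<inter> ?C n1" "\<phi> \<in> ?C n2" using \<phi> Cmono[of n1 "n1 * n2"] Cmono[of n2 "n1 * n2"] by auto
      obtain \<mu> z where \<mu>: "\<mu> \<in> M" "\<mu> \<in> ?C n2" and z: "z \<in> ?Z" and e: "\<phi> = \<mu> \<otimes>\<^bsub>AutoGroup G\<^esub> z"
        using n1(2)[OF \<phi>12(1)] by blast
      have za: "z \<in> auto G" using z Ha by blast
      have zC: "z \<in> ?C n2"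
        using A.subgroup_cancel_left[OF Csg \<mu>(2)] za \<phi>12(2) e by (simp add: carrier_AutoGroup)
      define x where "x = (\<lambda>s\<in>S. inv s \<otimes> z s)"
      have xs: "x s = inv s \<otimes> z s" "x s \<in> carrier G" if "s \<in> S" for s
        using that S(2) auto_closed[OF za] by (auto simp: x_def subset_iff)
      have xc: "x \<in> carrier (power_group S G)" using xs(2) by (auto simp: x_def)
      have "\<forall>s\<in>S. eqm G (?L (Suc ?k)) (inv s \<otimes> z s) (x s)"
        using xs(1) eqm_refl[OF xs(2) lower_central_subgroup] by simp
      then have "x \<in> ?J ?Z" unfolding displacements_def using xc z by blast
      moreover have "x s \<in> powers G (carrier G) n2" if s: "s \<in> S" for s
        using zC s S(2) xs by (auto simp: cong_aut_def eqm_def subset_iff)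
      then have "x \<in> powers (power_group S G) (carrier (power_group S G)) n2"
        by (rule power_group_powers[OF S(1) xc])
      ultimately have "x \<in> ?J (M \<inter> ?Z)" using n2(2) by blast
      then obtain v where v: "v \<in> M" "v \<in> ?Z" and r: "\<And>s. s \<in> S \<Longrightarrow> eqm G (?L (Suc ?k)) (inv s \<otimes> v s) (x s)"
        by (auto simp: displacements_def)
      have va: "v \<in> auto G" using v Ha by blast
      \<comment> \<open>\<open>v\<close> comes from \<open>M\<close> and has the displacements of
        \<open>z\<close> up to the next term. Moving \<open>v\<close> into the factor from
        \<open>M\<close> leaves a rest that is trivial one degree further.\<close>
      have vz: "eqm G (?L (Suc ?k)) (v s) (z s)" if s: "s \<in> S" for s
      proof -
        have sc: "s \<in> carrier G" using s S by blast
        have "eqm G (?L (Suc ?k)) (s \<otimes> (inv s \<otimes> v s)) (s \<otimes> x s)"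
          by (rule eqm_mult[OF lower_central_normal eqm_refl[OF sc lower_central_subgroup] r[OF s]])
        then show ?thesis using sc auto_closed[OF va sc] auto_closed[OF za sc] xs(1)[OF s] by simp
      qed
      have w: "inv\<^bsub>AutoGroup G\<^esub> v \<otimes>\<^bsub>AutoGroup G\<^esub> z \<in> cong_aut G (?L (Suc ?k))"
        by (rule cong_aut_quotient[OF lower_central_normal _ za va S(2,3) vz]) (rule auto_lower_central)
      let ?w = "inv\<^bsub>AutoGroup G\<^esub> v \<otimes>\<^bsub>AutoGroup G\<^esub> z"
      have "?w \<in> H"
        using v(2) z subgroup.m_closed[OF H(1)] subgroup.m_inv_closed[OF H(1)] by blast
      moreover have "\<mu> \<otimes>\<^bsub>AutoGroup G\<^esub> v \<in> M" by (rule subgroup.m_closed[OF Suc.prems(1) \<mu>(1) v(1)])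
      moreover have "\<phi> = (\<mu> \<otimes>\<^bsub>AutoGroup G\<^esub> v) \<otimes>\<^bsub>AutoGroup G\<^esub> ?w"
      proof -
        have "v \<in> carrier (AutoGroup G)" "z \<in> carrier (AutoGroup G)" "\<mu> \<in> carrier (AutoGroup G)"
          using va za \<mu>(2) by (simp_all add: carrier_AutoGroup cong_aut_def)
        then show ?thesis using e by (simp add: A.m_assoc)
      qed
      ultimately show ?thesis using w by blast
    qed
    then show ?case using n1(1) n2(1) by (intro exI[of _ "n1 * n2"]) auto
  qed
  have "\<exists>n>0. \<forall>\<phi>\<in>H \<inter> ?C n. \<exists>\<mu>\<in>M. \<exists>z\<in>H \<inter> cong_aut G (?L (Suc c)). \<phi> = \<mu> \<otimes>\<^bsub>AutoGroup G\<^esub> z"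
    using M by (intro claim)
  then obtain n where n: "n > 0"
    "\<And>\<phi>. \<phi> \<in> H \<inter> ?C n \<Longrightarrow> \<exists>\<mu>\<in>M. \<exists>z\<in>H \<inter> cong_aut G (?L (Suc c)). \<phi> = \<mu> \<otimes>\<^bsub>AutoGroup G\<^esub> z"
    by blast
  have "\<phi> \<in> M" if \<phi>: "\<phi> \<in> H \<inter> ?C n" for \<phi>
  proof -
    obtain \<mu> z where \<mu>: "\<mu> \<in> M" and z: "z \<in> cong_aut G (?L (Suc c))" and e: "\<phi> = \<mu> \<otimes>\<^bsub>AutoGroup G\<^esub> z"
      using n(2)[OF \<phi>] by blast
    have za: "z \<in> auto G" using z by (simp add: cong_aut_def)
    have "?L (Suc c) \<subseteq> {\<one>}" using lower_central_Suc_subset c by blast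
    then have "z g = g" if g: "g \<in> carrier G" for g
    proof -
      have "inv g \<otimes> z g = \<one>" using z g \<open>?L (Suc c) \<subseteq> {\<one>}\<close> by (auto simp: cong_aut_def eqm_def)
      then show ?thesis using g auto_closed[OF za g] by (metis inv_cancel(1) r_one)
    qed
    then have "z = \<one>\<^bsub>AutoGroup G\<^esub>"
      using A.one_closed by (intro auto_eqI[OF za]) (auto simp: carrier_AutoGroup AutoGroup_one_apply)
    then show ?thesis using e \<mu> subgroup.mem_carrier[OF M(1) \<mu>] by simp
  qed
  then show ?thesis using n(1) by blast
qed

end

section \<open>Word maps\<close>

abbreviation tuples :: "('a, 'b) monoid_scheme \<Rightarrow> 'a set \<Rightarrow> ('a \<Rightarrow> 'a) set" where
  "tuples G S \<equiv> carrier (power_group S G)"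

definition coord :: "('a, 'b) monoid_scheme \<Rightarrow> 'a set \<Rightarrow> 'a \<Rightarrow> ('a \<Rightarrow> 'a) \<Rightarrow> 'a" where
  "coord G S s = (\<lambda>t\<in>tuples G S. t s)"

text \<open>The relatively free group on \<open>S\<close> in the variety of \<open>G\<close>, realised by the functions on
  \<open>S\<close>-tuples that are given by a word.\<close>

definition words :: "('a, 'b) monoid_scheme \<Rightarrow> 'a set \<Rightarrow> (('a \<Rightarrow> 'a) \<Rightarrow> 'a) monoid" where
  "words G S = (power_group (tuples G S) G)
     \<lparr>carrier := generate (power_group (tuples G S) G) (coord G S ` S)\<rparr>"

text \<open>A surjective endomorphism of a polycyclic group is injective; here in a form for
  the correspondence \<open>{(h w, h' w) | w \<in> A}\<close> modulo \<open>J\<close>.\<close>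

lemma hopfian_correspondence:
  assumes h: "group_hom F G h" and h': "group_hom F G h'" and E: "polycyclic G (carrier G)"
    and A: "subgroup A F" and J: "subgroup J G" and img: "h ` A = I" "h' ` A = I" "J \<subseteq> I"
    and stage: "\<And>w. w \<in> A \<Longrightarrow> h w \<in> J \<Longrightarrow> h' w \<in> J"
    and w: "w \<in> A" "h' w \<in> J"
  shows "h w \<in> J"
proof -
  interpret h: group_hom F G h by fact
  interpret h': group_hom F G h' by fact
  \<comment> \<open>Read modulo \<open>J\<close>, the correspondence from \<open>h w\<close> to
    \<open>h' w\<close> is a surjective endomorphism of \<open>I\<close>, and \<open>U n\<close> is
    the kernel of its \<open>n\<close>-th iterate.\<close>
  define U where "U = rec_nat J (\<lambda>_ V. h ` {w \<in> A. h' w \<in> V})"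
  have U0: "U 0 = J" and US: "U (Suc n) = h ` {w \<in> A. h' w \<in> U n}" for n by (simp_all add: U_def)
  have Usg: "subgroup (U n) G" for n
  proof (induction n)
    case 0
    then show ?case using J U0 by simp
  next
    case (Suc n)
    have "subgroup {w \<in> A. h' w \<in> U n} F"
    proof (rule h.G.subgroupI)
      show "{w \<in> A. h' w \<in> U n} \<subseteq> carrier F" using subgroup.subset[OF A] by blast
      have "\<one>\<^bsub>F\<^esub> \<in> {w \<in> A. h' w \<in> U n}" using subgroup.one_closed[OF A] subgroup.one_closed[OF Suc] by simp
      then show "{w \<in> A. h' w \<in> U n} \<noteq> {}" by blast
      show "inv\<^bsub>F\<^esub> a \<in> {w \<in> A. h' w \<in> U n}" if "a \<in> {w \<in> A. h' w \<in> U n}" for a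
        using that subgroup.m_inv_closed[OF A] subgroup.m_inv_closed[OF Suc] subgroup.mem_carrier[OF A] by simp
      show "a \<otimes>\<^bsub>F\<^esub> b \<in> {w \<in> A. h' w \<in> U n}" if "a \<in> {w \<in> A. h' w \<in> U n}" "b \<in> {w \<in> A. h' w \<in> U n}" for a b
        using that subgroup.m_closed[OF A] subgroup.m_closed[OF Suc] subgroup.mem_carrier[OF A] by simp
    qed
    then show ?case unfolding US by (rule h.subgroup_img_is_subgroup)
  qed
  have JU: "J \<subseteq> U 1"
  proof
    fix x assume x: "x \<in> J"
    then obtain w where "w \<in> A" "x = h w" using img by blast
    then show "x \<in> U 1" using stage x U0 US[of 0] by auto
  qed
  have mono: "U n \<subseteq> U (Suc n)" for n
  proof (induction n)
    case 0
    then show ?case using JU U0 by simp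
  next
    case (Suc n)
    then show ?case unfolding US by blast
  qed
  have JUn: "J \<subseteq> U n" for n using lift_Suc_mono_le[of U 0 n, OF mono] U0 by simp
  obtain n where n: "U (Suc n) = U n"
    using h.H.ascending_subgroups_stable[of "carrier G" U] E Usg subgroup.subset[OF Usg] mono by blast
  \<comment> \<open>Surjectivity of the endomorphism: an element of \<open>U (Suc n)\<close> is the
    image of some \<open>h w\<close>, which lies in \<open>U (Suc (Suc n))\<close> and so in
    \<open>U (Suc n)\<close>. Equality thus descends to the start of the chain.\<close>
  have down: "U (Suc n) = U n" if eq: "U (Suc (Suc n)) = U (Suc n)" for n
  proof
    show "U (Suc n) \<subseteq> U n"
    proof
      fix x assume x: "x \<in> U (Suc n)"
      then have "x \<in> I" using US[of n] img(1) by auto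
      then obtain w where w: "w \<in> A" "h' w = x" using img(2) by blast
      then have "h w \<in> U (Suc n)" using x US[of "Suc n"] eq by auto
      then obtain v where v: "v \<in> A" "h w = h v" "h' v \<in> U n" unfolding US[of n] by auto
      have c: "w \<in> carrier F" "v \<in> carrier F" using w v subgroup.mem_carrier[OF A] by auto
      have "inv\<^bsub>F\<^esub> v \<otimes>\<^bsub>F\<^esub> w \<in> A" using w v by (simp add: subgroup.m_closed[OF A] subgroup.m_inv_closed[OF A])
      moreover have "h (inv\<^bsub>F\<^esub> v \<otimes>\<^bsub>F\<^esub> w) \<in> J" using c v subgroup.one_closed[OF J] by simp
      ultimately have "h' (inv\<^bsub>F\<^esub> v \<otimes>\<^bsub>F\<^esub> w) \<in> U n" using stage JUn by blast
      then have "inv\<^bsub>G\<^esub> h' v \<otimes>\<^bsub>G\<^esub> h' w \<in> U n" using c by simp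
      then have "h' v \<otimes>\<^bsub>G\<^esub> (inv\<^bsub>G\<^esub> h' v \<otimes>\<^bsub>G\<^esub> h' w) \<in> U n"
        by (rule subgroup.m_closed[OF Usg v(3)])
      then have "h' w \<in> U n" using c by simp
      then show "x \<in> U n" using w by simp
    qed
  qed (rule mono)
  have "U 1 = U 0" using n by (induction n) (auto dest: down)
  moreover have "h w \<in> U 1" using w U0 US[of 0] by auto
  ultimately show ?thesis using U0 by simp
qed

section \<open>Evaluation of words at tuples\<close>

locale fg_nilpotent = group G for G (structure) +
  fixes S :: "'a set" and c :: nat
  assumes S: "finite S" "S \<subseteq> carrier G" "generate G S = carrier G"
    and c: "lower_central G c = {\<one>}"
begin

lemma polycyclic_G: "polycyclic G (carrier G)"
  by (rule nilpotent_polycyclic[OF S c])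

abbreviation L where "L \<equiv> lower_central G"
abbreviation TS where "TS \<equiv> tuples G S"
abbreviation FX where "FX \<equiv> power_group TS G"
abbreviation F where "F \<equiv> words G S"
abbreviation LF where "LF \<equiv> lower_central F"

text \<open>\<open>S\<close> is its own index set. Evaluation at \<open>base\<close> presents
  \<open>G\<close> as a quotient of \<open>words G S\<close>, and the kernel consists of the
  relators.\<close>

definition base :: "'a \<Rightarrow> 'a" where "base = (\<lambda>s\<in>S. s)"

lemma base_tuple: "base \<in> TS"
  using S by (auto simp: base_def)

lemma tuple_closed: "t \<in> TS \<Longrightarrow> s \<in> S \<Longrightarrow> t s \<in> carrier G"
  by (auto simp: PiE_iff)

lemma tupleI: "(\<And>s. s \<in> S \<Longrightarrow> f s \<in> carrier G) \<Longrightarrow> (\<lambda>s\<in>S. f s) \<in> TS"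
  by auto

lemma tuple_eqI: "t \<in> TS \<Longrightarrow> t' \<in> TS \<Longrightarrow> (\<And>s. s \<in> S \<Longrightarrow> t s = t' s) \<Longrightarrow> t = t'"
  by (auto simp: PiE_iff intro: extensionalityI)

lemma FX_group: "group FX"
  by (rule power_group_group)

lemma coord_closed: "s \<in> S \<Longrightarrow> coord G S s \<in> carrier FX"
  using tuple_closed by (auto simp: coord_def)

lemma coord_apply: "t \<in> TS \<Longrightarrow> coord G S s t = t s"
  by (simp add: coord_def)

lemma coords_closed: "coord G S ` S \<subseteq> carrier FX"
  using coord_closed by blast

lemma words_subgroup: "subgroup (carrier F) FX"
  unfolding words_def using group.generate_is_subgroup[OF FX_group coords_closed] by simp

lemma words_group: "group F"
  using group.subgroup_imp_group[OF FX_group words_subgroup] by (simp add: words_def)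

lemma word_in_FX: "w \<in> carrier F \<Longrightarrow> w \<in> carrier FX"
  using subgroup.mem_carrier[OF words_subgroup] .

lemma word_closed: "w \<in> carrier F \<Longrightarrow> t \<in> TS \<Longrightarrow> w t \<in> carrier G"
  using word_in_FX by (fastforce simp: PiE_iff)

lemma word_eqI:
  assumes "v \<in> carrier F" "w \<in> carrier F" "\<And>t. t \<in> TS \<Longrightarrow> v t = w t" shows "v = w"
  using word_in_FX[OF assms(1)] word_in_FX[OF assms(2)] assms(3)
  by (auto simp: PiE_iff intro: extensionalityI)

lemma word_mult: "t \<in> TS \<Longrightarrow> (v \<otimes>\<^bsub>F\<^esub> w) t = v t \<otimes> w t"
  by (simp add: words_def)

lemma word_one: "t \<in> TS \<Longrightarrow> \<one>\<^bsub>F\<^esub> t = \<one>"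
  by (simp add: words_def)

lemma eval_hom: "t \<in> TS \<Longrightarrow> group_hom F G (\<lambda>w. w t)"
  unfolding group_hom_def group_hom_axioms_def hom_def
  using words_group is_group word_closed word_mult by simp

lemma coord_word: "s \<in> S \<Longrightarrow> coord G S s \<in> carrier F"
  unfolding words_def by (auto intro: generate.incl)

lemma words_generate: "generate F (coord G S ` S) = carrier F"
proof -
  have "coord G S ` S \<subseteq> carrier F" using coord_word by blast
  then have "generate (FX\<lparr>carrier := carrier F\<rparr>) (coord G S ` S) = generate FX (coord G S ` S)"
    by (rule group.generate_consistent[OF FX_group _ words_subgroup])
  then show ?thesis by (simp add: words_def)
qed

lemma word_inv: "t \<in> TS \<Longrightarrow> w \<in> carrier F \<Longrightarrow> (inv\<^bsub>F\<^esub> w) t = inv (w t)"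
  using group_hom.hom_inv[OF eval_hom] by fast

lemma eval_coords: "t \<in> TS \<Longrightarrow> (\<lambda>w. w t) ` coord G S ` S = t ` S"
  by (auto simp: coord_apply image_image)

lemma eval_surj:
  assumes t: "t \<in> TS" and gen: "generate G (t ` S) = carrier G"
  shows "(\<lambda>w. w t) ` carrier F = carrier G"
proof -
  interpret e: group_hom F G "\<lambda>w. w t" by (rule eval_hom[OF t])
  have "generate G ((\<lambda>w. w t) ` coord G S ` S) = (\<lambda>w. w t) ` generate F (coord G S ` S)"
    using coord_word by (intro e.generate_img) blast
  then show ?thesis using gen by (simp add: eval_coords[OF t] words_generate)
qed

lemma base_generate: "generate G (base ` S) = carrier G"
  using S(3) by (simp add: base_def)

lemma eval_lower_central:
  assumes t: "t \<in> TS" and gen: "generate G (t ` S) = carrier G"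
  shows "(\<lambda>w. w t) ` LF k = L k"
  by (rule group_hom.lower_central_img[OF eval_hom[OF t] eval_surj[OF t gen]])

lemma word_lower_central: "t \<in> TS \<Longrightarrow> w \<in> LF k \<Longrightarrow> w t \<in> L k"
  using group_hom.lower_central_img_subset[OF eval_hom] by fast

lemma LF_closed: "w \<in> LF k \<Longrightarrow> w \<in> carrier F"
  by (rule group.lower_central_closed[OF words_group])

lemma LF_subgroup: "subgroup (LF k) F"
  by (rule group.lower_central_subgroup[OF words_group])

lemma LF_c: "LF c = {\<one>\<^bsub>F\<^esub>}"
proof
  show "LF c \<subseteq> {\<one>\<^bsub>F\<^esub>}"
  proof
    fix w assume w: "w \<in> LF c"
    have "w = \<one>\<^bsub>F\<^esub>"
      using word_lower_central[OF _ w] c word_one LF_closed[OF w] group.is_monoid[OF words_group]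
      by (intro word_eqI) (auto simp: monoid.one_closed simp del: carrier_product_group)
    then show "w \<in> {\<one>\<^bsub>F\<^esub>}" by simp
  qed
  show "{\<one>\<^bsub>F\<^esub>} \<subseteq> LF c" using subgroup.one_closed[OF LF_subgroup] by blast
qed

text \<open>The reason for using a relatively free group: subgroups of relators become finitely
  generated, so that finitely many values decide whether a tuple respects all of them.\<close>

lemma polycyclic_F: "polycyclic F (carrier F)"
  using S(1) coord_word words_generate LF_c
  by (intro group.nilpotent_polycyclic[OF words_group, of "coord G S ` S"]) auto

lemma eqm_eval:
  assumes t: "t \<in> TS" "t' \<in> TS" and eq: "\<And>s. s \<in> S \<Longrightarrow> eqm G N (t s) (t' s)"
    and N: "N \<lhd> G" and w: "w \<in> carrier F"
  shows "eqm G N (w t) (w t')"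
proof -
  have sub: "coord G S ` S \<subseteq> carrier F" using coord_word by blast
  have "eqm G N (v t) (v t')" if "v \<in> coord G S ` S" for v
    using that eq coord_apply t by auto
  then show ?thesis
    using eqm_homs_generate[OF eval_hom[OF t(1)] eval_hom[OF t(2)] N sub, of w] w words_generate by simp
qed

lemma eqm_eval_lower_central:
  assumes t: "t \<in> TS" "t' \<in> TS" and eq: "\<And>s. s \<in> S \<Longrightarrow> eqm G (L 1) (t s) (t' s)" and w: "w \<in> LF k"
  shows "eqm G (L (Suc k)) (w t) (w t')"
  using eqm_homs_lower_central[OF eval_hom[OF t(1)] eval_hom[OF t(2)] _ w]
    eqm_eval[OF t eq lower_central_normal] by blast

subsection \<open>Substitutions\<close>

text \<open>The correction \<open>q s\<close> is a word evaluated at the tuple that is being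
  corrected, so a single \<open>q\<close> moves all tuples simultaneously.\<close>

definition subst :: "('a \<Rightarrow> ('a \<Rightarrow> 'a) \<Rightarrow> 'a) \<Rightarrow> ('a \<Rightarrow> 'a) \<Rightarrow> 'a \<Rightarrow> 'a" where
  "subst q t = (\<lambda>s\<in>S. t s \<otimes> q s t)"

definition pullback :: "('a \<Rightarrow> ('a \<Rightarrow> 'a) \<Rightarrow> 'a) \<Rightarrow> (('a \<Rightarrow> 'a) \<Rightarrow> 'a) \<Rightarrow> ('a \<Rightarrow> 'a) \<Rightarrow> 'a" where
  "pullback q w = (\<lambda>t\<in>TS. w (subst q t))"

context
  fixes q assumes q: "\<And>s. s \<in> S \<Longrightarrow> q s \<in> LF 1"
begin

lemma q_word: "s \<in> S \<Longrightarrow> q s \<in> carrier F"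
  using q LF_closed by blast

lemma subst_tuple: "t \<in> TS \<Longrightarrow> subst q t \<in> TS"
  unfolding subst_def using tuple_closed word_closed q_word by (intro tupleI) blast

lemma pullback_hom_FX: "group_hom FX FX (pullback q)"
proof -
  have "pullback q w \<in> carrier FX" if "w \<in> carrier FX" for w
    using that subst_tuple by (auto simp: pullback_def PiE_iff simp del: carrier_product_group
        simp add: carrier_product_group[of TS])
  moreover have "pullback q (v \<otimes>\<^bsub>FX\<^esub> w) = pullback q v \<otimes>\<^bsub>FX\<^esub> pullback q w" for v w
    using subst_tuple by (auto simp: pullback_def simp del: carrier_product_group intro!: restrict_ext)
  ultimately show ?thesis
    by (simp add: group_hom_def group_hom_axioms_def hom_def FX_group del: carrier_product_group mult_product_group)
qed

lemma pullback_coord: "s \<in> S \<Longrightarrow> pullback q (coord G S s) = coord G S s \<otimes>\<^bsub>F\<^esub> q s"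
  using subst_tuple by (auto simp: pullback_def words_def coord_apply subst_def
      simp del: carrier_product_group intro!: restrict_ext)

lemma pullback_word: "w \<in> carrier F \<Longrightarrow> pullback q w \<in> carrier F"
proof -
  assume w: "w \<in> carrier F"
  interpret p: group_hom FX FX "pullback q" by (rule pullback_hom_FX)
  have "generate FX (pullback q ` coord G S ` S) \<subseteq> carrier F"
  proof (rule p.G.generate_subgroup_incl[OF _ words_subgroup])
    show "pullback q ` coord G S ` S \<subseteq> carrier F"
      using coord_word q_word monoid.m_closed[OF group.is_monoid[OF words_group]] by (auto simp: pullback_coord)
  qed
  moreover have "carrier F = generate FX (coord G S ` S)" by (simp add: words_def)
  ultimately show ?thesis using p.generate_img[OF coords_closed] w by blast
qed

lemma pullback_apply: "t \<in> TS \<Longrightarrow> pullback q w t = w (subst q t)"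
  by (simp add: pullback_def)

lemma pullback_hom: "group_hom F F (pullback q)"
proof -
  have "pullback q (v \<otimes>\<^bsub>F\<^esub> w) = pullback q v \<otimes>\<^bsub>F\<^esub> pullback q w" if "v \<in> carrier F" "w \<in> carrier F" for v w
    using that pullback_word subst_tuple monoid.m_closed[OF group.is_monoid[OF words_group]]
    by (intro word_eqI) (auto simp: pullback_apply word_mult simp del: carrier_product_group)
  then show ?thesis using words_group pullback_word
    by (simp add: group_hom_def group_hom_axioms_def hom_def)
qed

text \<open>The corrections are commutator words, so the substitution is the identity modulo
  commutators on the generating words, and therefore on every factor of the lower central
  series.\<close>

lemma pullback_lower_central:
  assumes w: "w \<in> LF k" shows "inv\<^bsub>F\<^esub> w \<otimes>\<^bsub>F\<^esub> pullback q w \<in> LF (Suc k)"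
proof -
  interpret F: group F by (rule words_group)
  have id: "group_hom F F (\<lambda>w. w)" by (simp add: group_hom_def group_hom_axioms_def words_group hom_def)
  have sub: "coord G S ` S \<subseteq> carrier F" using coord_word by blast
  have "eqm F (LF 1) v (pullback q v)" if v: "v \<in> coord G S ` S" for v
    using v coord_word q_word q by (auto simp: eqm_def pullback_coord)
  then have "eqm F (LF 1) w (pullback q w)" if "w \<in> carrier F" for w
    using eqm_homs_generate[OF id pullback_hom F.lower_central_normal sub, of 1 w] words_generate that by simp
  then have "eqm F (LF (Suc k)) w (pullback q w)"
    using eqm_homs_lower_central[OF id pullback_hom _ w] by blast
  then show ?thesis by (simp add: eqm_def)
qed

end

end

section \<open>Approximating automorphisms of the completion\<close>

lemma (in group) powers_one:
  assumes "subgroup H G" shows "powers G H 1 = H"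
proof
  show "powers G H 1 \<subseteq> H"
    using assms by (intro powers_subset) (auto simp: subgroup.mem_carrier)
  show "H \<subseteq> powers G H 1"
  proof
    fix x assume x: "x \<in> H"
    then have "x [^] (1::nat) \<in> powers G H 1" by (rule powers_mem)
    then show "x \<in> powers G H 1" using subgroup.mem_carrier[OF assms x] by simp
  qed
qed

section \<open>Tuples in a fixed class modulo commutators, and their stages\<close>

locale tuple_stages = fg_nilpotent +
  fixes t0 :: "'a \<Rightarrow> 'a"
  assumes t0: "t0 \<in> TS" and t0_generate: "generate G (t0 ` S) = carrier G"
begin

definition start :: "('a \<Rightarrow> 'a) set" where
  "start = {t \<in> TS. \<forall>s\<in>S. eqm G (L 1) (t0 s) (t s)}"

text \<open>Powers of the commutator subgroup, not of \<open>G\<close>: a move of this kind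
  preserves the class modulo commutators, and its entries are values of words in the corresponding
  power subgroup of \<open>LF 1\<close>, which have small values at every tuple of
  \<open>start\<close>.\<close>

definition nearby :: "nat \<Rightarrow> ('a \<Rightarrow> 'a) \<Rightarrow> ('a \<Rightarrow> 'a) \<Rightarrow> bool" where
  "nearby n t t' \<longleftrightarrow> (\<forall>s\<in>S. eqm G (powers G (L 1) n) (t s) (t' s))"

text \<open>The condition says that \<open>base s \<mapsto> t s\<close> induces maps \<open>\<gamma>\<^sub>k / \<gamma>\<^sub>k\<^sub>+\<^sub>d \<rightarrow> \<gamma>\<^sub>k / \<gamma>\<^sub>k\<^sub>+\<^sub>d\<close>.
  It is void for \<open>d = 0\<close>, and for \<open>d = c\<close> it yields an endomorphism of \<open>G\<close>.\<close>

definition stage :: "nat \<Rightarrow> ('a \<Rightarrow> 'a) set" where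
  "stage d = {t \<in> start. \<forall>k. \<forall>w\<in>LF k. w base \<in> L (k + d) \<longrightarrow> w t \<in> L (k + d)}"

lemma V_subgroup: "subgroup (powers G (L 1) n) G"
  by (rule powers_subgroup[OF subgroup.subset[OF lower_central_subgroup]])

lemma V_subset: "powers G (L 1) n \<subseteq> L 1"
  by (rule powers_subset[OF lower_central_subgroup subgroup_nat_pow_closed[OF lower_central_subgroup]])

lemma V_powers: "powers G (L 1) n \<subseteq> powers G (carrier G) n"
  by (rule powers_mono[OF subgroup.subset[OF lower_central_subgroup]])

lemma nearby_sym: "nearby n t t' \<Longrightarrow> nearby n t' t"
  using eqm_sym[OF V_subgroup] by (simp add: nearby_def)

lemma nearby_trans: "nearby n t t' \<Longrightarrow> nearby n t' t'' \<Longrightarrow> nearby n t t''"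
  using eqm_trans[OF V_subgroup] unfolding nearby_def by blast

lemma nearby_refl: "t \<in> TS \<Longrightarrow> nearby n t t"
  using eqm_refl[OF tuple_closed V_subgroup] by (simp add: nearby_def)

lemma startD: "t \<in> start \<Longrightarrow> t \<in> TS"
  by (simp add: start_def)

lemma stageD: "t \<in> stage d \<Longrightarrow> t \<in> start" "t \<in> stage d \<Longrightarrow> t \<in> TS"
  using startD by (auto simp: stage_def simp del: carrier_product_group)

lemma stage_mem: "t \<in> stage d \<Longrightarrow> w \<in> LF k \<Longrightarrow> w base \<in> L (k + d) \<Longrightarrow> w t \<in> L (k + d)"
  by (simp add: stage_def)

lemma start_eqm: "t \<in> start \<Longrightarrow> t' \<in> start \<Longrightarrow> s \<in> S \<Longrightarrow> eqm G (L 1) (t s) (t' s)"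
  unfolding start_def using eqm_sym[OF lower_central_subgroup] eqm_trans[OF lower_central_subgroup] by blast

lemma start_nearby: "t \<in> start \<Longrightarrow> t' \<in> start \<Longrightarrow> nearby 1 t t'"
  unfolding nearby_def powers_one[OF lower_central_subgroup] using start_eqm by blast

lemma nearby_start:
  assumes t: "t \<in> start" "t' \<in> TS" and near: "\<And>s. s \<in> S \<Longrightarrow> eqm G (L 1) (t s) (t' s)"
  shows "t' \<in> start"
  using t near eqm_trans[OF lower_central_subgroup] unfolding start_def by blast

text \<open>By \<open>nilpotent_generate\<close> generation is decided modulo commutators, where
  \<open>t\<close> and \<open>t0\<close> agree. Consequently evaluation at \<open>t\<close> is onto
  in each term of the series.\<close>

lemma start_generate:
  assumes t: "t \<in> start" shows "generate G (t ` S) = carrier G"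
proof (rule nilpotent_generate[OF _ _ _ c])
  show "finite (t ` S)" using S by simp
  show sub: "t ` S \<subseteq> carrier G" using tuple_closed[OF startD[OF t]] by blast
  let ?B = "generate G (t ` S \<union> L 1)"
  have B: "subgroup ?B G" using sub lower_central_closed by (intro generate_is_subgroup) blast
  have "t0 s \<in> ?B" if s: "s \<in> S" for s
  proof -
    have "eqm G (L 1) (t s) (t0 s)"
      using t s eqm_sym[OF lower_central_subgroup] by (simp add: start_def)
    then have "inv (t s) \<otimes> t0 s \<in> ?B" by (auto simp: eqm_def intro: generate.incl)
    moreover have ts: "t s \<in> ?B" using s by (auto intro: generate.incl)
    ultimately have "t s \<otimes> (inv (t s) \<otimes> t0 s) \<in> ?B" using subgroup.m_closed[OF B] by blast
    then show ?thesis using tuple_closed[OF t0 s] tuple_closed[OF startD[OF t] s] by simp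
  qed
  then have "generate G (t0 ` S) \<subseteq> ?B" by (intro generate_subgroup_incl[OF _ B]) blast
  then show "?B = carrier G" using t0_generate subgroup.subset[OF B] by blast
qed

lemma eval_powers:
  assumes t: "t \<in> start" shows "(\<lambda>w. w t) ` powers F (LF 1) n = powers G (L 1) n"
proof -
  interpret e: group_hom F G "\<lambda>w. w t" by (rule eval_hom[OF startD[OF t]])
  have sub: "{x [^]\<^bsub>F\<^esub> n |x. x \<in> LF 1} \<subseteq> carrier F" using LF_closed by auto
  have "(\<lambda>w. w t) ` {x [^]\<^bsub>F\<^esub> n |x. x \<in> LF 1} = {y [^] n |y. y \<in> L 1}"
  proof safe
    fix x assume x: "x \<in> LF 1"
    have "(x [^]\<^bsub>F\<^esub> n) t = x t [^] n" using e.hom_nat_pow[OF LF_closed[OF x]] .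
    then show "\<exists>y. (x [^]\<^bsub>F\<^esub> n) t = y [^] n \<and> y \<in> L 1"
      using word_lower_central[OF startD[OF t] x] by blast
  next
    fix y assume "y \<in> L 1"
    then obtain x where x: "x \<in> LF 1" "y = x t"
      using eval_lower_central[OF startD[OF t] start_generate[OF t], of 1] by blast
    have "(x [^]\<^bsub>F\<^esub> n) t = y [^] n" using e.hom_nat_pow[OF LF_closed[OF x(1)]] x(2) by simp
    then have "y [^] n = (x [^]\<^bsub>F\<^esub> n) t" by simp
    then show "y [^] n \<in> (\<lambda>w. w t) ` {x [^]\<^bsub>F\<^esub> n |x. x \<in> LF 1}" using x(1) by blast
  qed
  then show ?thesis unfolding powers_def using e.generate_img[OF sub] by simp
qed

text \<open>By \<open>eval_powers\<close> every small difference is the value at \<open>t\<close> of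
  a word from \<open>powers F (LF 1) n\<close>; the values of that word at the other tuples of
  \<open>start\<close> are small for the same reason.\<close>

lemma subst_exists:
  assumes t: "t \<in> start" "t' \<in> TS" and near: "nearby n t t'"
  obtains q where "\<And>s. s \<in> S \<Longrightarrow> q s \<in> LF 1" "subst q t = t'"
    "\<And>t''. t'' \<in> start \<Longrightarrow> nearby n t'' (subst q t'')"
proof -
  have "\<exists>w\<in>powers F (LF 1) n. w t = inv (t s) \<otimes> t' s" if s: "s \<in> S" for s
  proof -
    have "inv (t s) \<otimes> t' s \<in> powers G (L 1) n" using near s by (simp add: nearby_def eqm_def)
    then show ?thesis unfolding eval_powers[OF t(1), symmetric] by auto
  qed
  then obtain q where q: "\<And>s. s \<in> S \<Longrightarrow> q s \<in> powers F (LF 1) n" "\<And>s. s \<in> S \<Longrightarrow> q s t = inv (t s) \<otimes> t' s"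
    by metis
  have sub: "powers F (LF 1) n \<subseteq> LF 1"
    using group.subgroup_nat_pow_closed[OF words_group LF_subgroup]
    by (intro group.powers_subset[OF words_group LF_subgroup])
  then have qL: "\<And>s. s \<in> S \<Longrightarrow> q s \<in> LF 1" using q(1) by blast
  have 1: "subst q t = t'"
  proof (rule tuple_eqI[OF subst_tuple[OF qL startD[OF t(1)]] t(2)])
    fix s assume s: "s \<in> S"
    show "subst q t s = t' s"
      using q(2)[OF s] s tuple_closed[OF t(2) s] tuple_closed[OF startD[OF t(1)] s] by (simp add: subst_def)
  qed
  have "nearby n t'' (subst q t'')" if t'': "t'' \<in> start" for t''
    unfolding nearby_def
  proof
    fix s assume s: "s \<in> S"
    have "q s t'' \<in> powers G (L 1) n" using q(1)[OF s] eval_powers[OF t'', of n] by blast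
    moreover have "t'' s \<in> carrier G" by (rule tuple_closed[OF startD[OF t''] s])
    moreover have "q s t'' \<in> carrier G" by (rule subgroup.mem_carrier[OF V_subgroup calculation(1)])
    ultimately show "eqm G (powers G (L 1) n) (t'' s) (subst q t'' s)"
      using s by (simp add: eqm_def subst_def)
  qed
  then show thesis using that qL 1 by blast
qed

text \<open>The stage condition yields an endomorphism of \<open>L k\<close> modulo
  \<open>L (k + d)\<close>. It is surjective because \<open>t\<close> generates \<open>G\<close>,
  hence injective by the Hopf property.\<close>

lemma stage_converse:
  assumes t: "t \<in> stage d" and w: "w \<in> LF k" "w t \<in> L (k + d)"
  shows "w base \<in> L (k + d)"
proof (rule hopfian_correspondence[where h = "\<lambda>w. w base" and h' = "\<lambda>w. w t" and F = F
        and A = "LF k" and I = "L k"])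
  show "group_hom F G (\<lambda>w. w base)" "group_hom F G (\<lambda>w. w t)"
    by (rule eval_hom[OF base_tuple], rule eval_hom[OF stageD(2)[OF t]])
  show "polycyclic G (carrier G)" "subgroup (LF k) F" "subgroup (L (k + d)) G"
    by (rule polycyclic_G, rule LF_subgroup, rule lower_central_subgroup)
  show "w \<in> LF k" "w t \<in> L (k + d)" by fact+
  show "(\<lambda>w. w base) ` LF k = L k" by (rule eval_lower_central[OF base_tuple base_generate])
  show "(\<lambda>w. w t) ` LF k = L k"
    by (rule eval_lower_central[OF stageD(2)[OF t] start_generate[OF stageD(1)[OF t]]])
  show "L (k + d) \<subseteq> L k" by (rule lower_central_antimono) simp
  show "w t \<in> L (k + d)" if "w \<in> LF k" "w base \<in> L (k + d)" for w by (rule stage_mem[OF t that])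
qed

text \<open>The change of \<open>w\<close> is the value of a word \<open>y\<close> that lies one
  degree deeper than \<open>w\<close>. Split \<open>y\<close> into a word \<open>z\<close> of degree
  \<open>k + d\<close> and a rest \<open>r\<close> that vanishes at \<open>t\<close>. The value of
  \<open>z\<close> is independent of the tuple modulo \<open>L (Suc (k + d))\<close> since the
  tuples agree modulo commutators; the value of \<open>r\<close> stays in that term by the stage
  condition and its converse.\<close>

lemma transport_subst:
  assumes t: "t \<in> stage d" "subst q t \<in> stage d" "t' \<in> stage d" and q: "\<And>s. s \<in> S \<Longrightarrow> q s \<in> LF 1"
    and w: "w \<in> LF k" "w base \<in> L (k + d)"
  shows "eqm G (L (Suc (k + d))) (inv (w t) \<otimes> w (subst q t)) (inv (w t') \<otimes> w (subst q t'))"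
    and "w (subst q t') \<in> L (k + d)"
proof -
  interpret F: group F by (rule words_group)
  note tt = stageD(2)[OF t(1)] stageD(2)[OF t(3)]
  have wF: "w \<in> carrier F" by (rule LF_closed[OF w(1)])
  define y where "y = inv\<^bsub>F\<^esub> w \<otimes>\<^bsub>F\<^esub> pullback q w"
  have y: "y \<in> LF (Suc k)" unfolding y_def by (rule pullback_lower_central[OF q w(1)])
  have yt: "y u = inv (w u) \<otimes> w (subst q u)" if u: "u \<in> TS" for u
    using u wF by (simp only: y_def word_mult word_inv pullback_apply[OF q])
  have "w t \<in> L (k + d)" "w (subst q t) \<in> L (k + d)" and wt': "w t' \<in> L (k + d)"
    using stage_mem[OF _ w] t by auto
  then have ytL: "y t \<in> L (k + d)"
    unfolding yt[OF tt(1)]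
    by (intro subgroup.m_closed[OF lower_central_subgroup] subgroup.m_inv_closed[OF lower_central_subgroup])
  \<comment> \<open>For \<open>d = 0\<close> the degree of \<open>y\<close> alone suffices. The
    splitting needs \<open>d > 0\<close>, since otherwise \<open>z\<close> would have degree
    \<open>k\<close> only and the rest could not be taken in \<open>LF (Suc k)\<close>.\<close>
  have eq: "eqm G (L (Suc (k + d))) (y t) (y t')"
  proof (cases "d = 0")
    case True
    then show ?thesis using word_lower_central[OF _ y] tt by (intro eqm_memI lower_central_subgroup) auto
  next
    case False
    obtain z where z: "z \<in> LF (k + d)" "y t = z t"
      using ytL eval_lower_central[OF tt(1) start_generate[OF stageD(1)[OF t(1)]], of "k + d"] by blast
    have zF: "z \<in> carrier F" and yF: "y \<in> carrier F" using z y LF_closed by auto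
    define r where "r = y \<otimes>\<^bsub>F\<^esub> inv\<^bsub>F\<^esub> z"
    have "z \<in> LF (Suc k)" using z(1) F.lower_central_antimono[of "Suc k" "k + d"] False by auto
    then have r: "r \<in> LF (Suc k)"
      unfolding r_def using y by (intro subgroup.m_closed[OF LF_subgroup] subgroup.m_inv_closed[OF LF_subgroup])
    have "r t = \<one>" using z(2) word_closed[OF zF tt(1)] zF tt(1) by (simp add: r_def word_mult word_inv del: carrier_product_group)
    \<comment> \<open>The degree of \<open>r\<close> is \<open>Suc k\<close>, so the stage condition
      reaches depth \<open>Suc k + d\<close>, one more than it gives for \<open>w\<close>.\<close>
    then have "r t \<in> L (Suc k + d)" using subgroup.one_closed[OF lower_central_subgroup] by simp
    then have "r base \<in> L (Suc k + d)" by (rule stage_converse[OF t(1) r])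
    then have rt': "r t' \<in> L (Suc (k + d))" using stage_mem[OF t(3) r] by simp
    have c': "y t' \<in> carrier G" "z t' \<in> carrier G" using word_closed yF zF tt(2) by auto
    have "y t' = r t' \<otimes> z t'"
      using c' zF tt(2) by (simp add: r_def word_mult word_inv m_assoc del: carrier_product_group)
    moreover have "eqm G (L (Suc (k + d))) (\<one> \<otimes> z t') (r t' \<otimes> z t')"
      using rt' c' lower_central_closed[OF rt']
      by (intro eqm_mult[OF lower_central_normal] eqm_refl lower_central_subgroup)
        (simp_all add: eqm_one_iff[OF lower_central_subgroup])
    moreover have "eqm G (L (Suc (k + d))) (z t) (z t')"
      using start_eqm[OF stageD(1)[OF t(1)] stageD(1)[OF t(3)]]
      by (intro eqm_eval_lower_central[OF tt _ z(1)])
    ultimately show ?thesis using z(2) c' eqm_trans[OF lower_central_subgroup] by simp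
  qed
  then show "eqm G (L (Suc (k + d))) (inv (w t) \<otimes> w (subst q t)) (inv (w t') \<otimes> w (subst q t'))"
    using yt tt by simp
  have "eqm G (L (k + d)) (y t) (y t')" by (rule eqm_mono[OF eq lower_central_Suc_subset])
  then have "y t' \<in> L (k + d)" by (rule eqm_mem[OF lower_central_subgroup _ ytL])
  then have "w t' \<otimes> y t' \<in> L (k + d)" by (rule subgroup.m_closed[OF lower_central_subgroup wt'])
  moreover have "w t' \<in> carrier G" "w (subst q t') \<in> carrier G"
    using word_closed[OF wF] tt(2) subst_tuple[OF q tt(2)] by auto
  ultimately show "w (subst q t') \<in> L (k + d)" using yt[OF tt(2)] by simp
qed

lemma transport:
  assumes t: "t \<in> stage d" "t' \<in> stage d" "u \<in> stage d" and near: "nearby n t t'"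
  obtains u' where "u' \<in> stage d" "nearby n u u'"
    "\<And>k w. w \<in> LF k \<Longrightarrow> w base \<in> L (k + d) \<Longrightarrow>
      eqm G (L (Suc (k + d))) (inv (w t) \<otimes> w t') (inv (w u) \<otimes> w u')"
proof -
  obtain q where q: "\<And>s. s \<in> S \<Longrightarrow> q s \<in> LF 1" "subst q t = t'"
    "\<And>t''. t'' \<in> start \<Longrightarrow> nearby n t'' (subst q t'')"
    using subst_exists[OF stageD(1)[OF t(1)] stageD(2)[OF t(2)] near] by blast
  have t2: "subst q t \<in> stage d" using q(2) t(2) by simp
  note tr = transport_subst[OF t(1) t2 t(3) q(1)]
  have near': "nearby n u (subst q u)" by (rule q(3)[OF stageD(1)[OF t(3)]])
  have "subst q u \<in> start"
  proof (rule nearby_start[OF stageD(1)[OF t(3)] subst_tuple[OF q(1) stageD(2)[OF t(3)]]])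
    show "eqm G (L 1) (u s) (subst q u s)" if "s \<in> S" for s
      using near' that eqm_mono[OF _ V_subset] unfolding nearby_def by blast
  qed
  then have "subst q u \<in> stage d" unfolding stage_def using tr(2) by blast
  then show thesis using that near' tr(1) q(2) by blast
qed

end

section \<open>The group of differences of relator values\<close>

context tuple_stages
begin

text \<open>An index is a pair of a degree and a word of that degree, because the depth at which
  values are compared depends on the degree and cannot be recovered from the word.\<close>

definition wvals :: "(nat \<times> (('a \<Rightarrow> 'a) \<Rightarrow> 'a)) set \<Rightarrow> ('a \<Rightarrow> 'a) \<Rightarrow> nat \<times> (('a \<Rightarrow> 'a) \<Rightarrow> 'a) \<Rightarrow> 'a" where
  "wvals W t = (\<lambda>i\<in>W. snd i t)"

definition diff_rel :: "nat \<Rightarrow> (nat \<times> (('a \<Rightarrow> 'a) \<Rightarrow> 'a)) set \<Rightarrow>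
    (nat \<times> (('a \<Rightarrow> 'a) \<Rightarrow> 'a) \<Rightarrow> 'a) \<Rightarrow> ('a \<Rightarrow> 'a) \<Rightarrow> ('a \<Rightarrow> 'a) \<Rightarrow> bool" where
  "diff_rel d W x t t' \<longleftrightarrow> (\<forall>i\<in>W. eqm G (L (Suc (fst i + d))) (inv (snd i t) \<otimes> snd i t') (x i))"

text \<open>Again a full preimage in the direct power: values matter only up to the next degree. The
  parameter \<open>n\<close> bounds the move of the tuple, not the size of the difference.\<close>

definition diffs :: "nat \<Rightarrow> (nat \<times> (('a \<Rightarrow> 'a) \<Rightarrow> 'a)) set \<Rightarrow> nat \<Rightarrow>
    (nat \<times> (('a \<Rightarrow> 'a) \<Rightarrow> 'a) \<Rightarrow> 'a) set" where
  "diffs d W n = {x \<in> carrier (power_group W G).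
     \<exists>t\<in>stage d. \<exists>t'\<in>stage d. nearby n t t' \<and> diff_rel d W x t t'}"

context
  fixes d :: nat and W :: "(nat \<times> (('a \<Rightarrow> 'a) \<Rightarrow> 'a)) set"
  assumes W: "finite W" "\<And>i. i \<in> W \<Longrightarrow> snd i \<in> LF (fst i)"
      "\<And>i. i \<in> W \<Longrightarrow> snd i base \<in> L (Suc (fst i + d))"
    and nonempty: "stage d \<noteq> {}"
begin

abbreviation PW where "PW \<equiv> power_group W G"

lemma PW_group: "group PW"
  by (rule power_group_group)

lemma PW_polycyclic: "polycyclic PW (carrier PW)"
  by (rule power_group_polycyclic[OF W(1) S c])

lemma PW_closed: "x \<in> carrier PW \<Longrightarrow> i \<in> W \<Longrightarrow> x i \<in> carrier G"
  by (auto simp: PiE_iff)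

lemma PW_mult: "i \<in> W \<Longrightarrow> (x \<otimes>\<^bsub>PW\<^esub> y) i = x i \<otimes> y i"
  by simp

lemma PW_inv: "x \<in> carrier PW \<Longrightarrow> i \<in> W \<Longrightarrow> (inv\<^bsub>PW\<^esub> x) i = inv (x i)"
  by (simp add: is_group)

lemma W_base: "i \<in> W \<Longrightarrow> snd i base \<in> L (fst i + d)"
  using W(3) lower_central_Suc_subset by blast

lemma W_closed: "i \<in> W \<Longrightarrow> t \<in> TS \<Longrightarrow> snd i t \<in> carrier G"
  using word_closed[OF LF_closed[OF W(2)]] by blast

lemma W_stage: "i \<in> W \<Longrightarrow> t \<in> stage d \<Longrightarrow> snd i t \<in> L (fst i + d)"
  by (rule stage_mem[OF _ W(2) W_base])

lemma wvals_closed: "t \<in> TS \<Longrightarrow> wvals W t \<in> carrier PW"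
  using W_closed by (auto simp: wvals_def simp del: carrier_product_group
      simp add: carrier_product_group[of W])

lemma wvals_apply: "i \<in> W \<Longrightarrow> wvals W t i = snd i t"
  by (simp add: wvals_def)

lemma diff_rel_mult:
  assumes t: "t \<in> TS" "t' \<in> TS" "t'' \<in> TS" and r: "diff_rel d W x t t'" "diff_rel d W y t' t''"
  shows "diff_rel d W (x \<otimes>\<^bsub>PW\<^esub> y) t t''"
  unfolding diff_rel_def
proof
  fix i assume i: "i \<in> W"
  have "eqm G (L (Suc (fst i + d))) ((inv (snd i t) \<otimes> snd i t') \<otimes> (inv (snd i t') \<otimes> snd i t'')) (x i \<otimes> y i)"
    using r i by (intro eqm_mult[OF lower_central_normal]) (auto simp: diff_rel_def)
  then show "eqm G (L (Suc (fst i + d))) (inv (snd i t) \<otimes> snd i t'') ((x \<otimes>\<^bsub>PW\<^esub> y) i)"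
    using W_closed[OF i] t i by (simp add: m_assoc del: carrier_product_group)
qed

lemma diff_rel_inv:
  assumes t: "t \<in> TS" "t' \<in> TS" and x: "x \<in> carrier PW" and r: "diff_rel d W x t t'"
  shows "diff_rel d W (inv\<^bsub>PW\<^esub> x) t' t"
  unfolding diff_rel_def
proof
  fix i assume i: "i \<in> W"
  have "eqm G (L (Suc (fst i + d))) (inv (inv (snd i t) \<otimes> snd i t')) (inv (x i))"
    using r i by (intro eqm_inv[OF lower_central_normal]) (auto simp: diff_rel_def)
  then show "eqm G (L (Suc (fst i + d))) (inv (snd i t') \<otimes> snd i t) ((inv\<^bsub>PW\<^esub> x) i)"
    using W_closed[OF i] t by (simp add: PW_inv[OF x i] inv_mult_group del: carrier_product_group)
qed

lemma diff_rel_one: "t \<in> TS \<Longrightarrow> diff_rel d W \<one>\<^bsub>PW\<^esub> t t"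
  unfolding diff_rel_def using W_closed eqm_refl[OF one_closed lower_central_subgroup]
  by (simp del: carrier_product_group)

lemma diff_rel_cong:
  assumes r: "diff_rel d W x t t'" and y: "\<And>i. i \<in> W \<Longrightarrow> eqm G (L (Suc (fst i + d))) (x i) (y i)"
  shows "diff_rel d W y t t'"
  using r y eqm_trans[OF lower_central_subgroup] unfolding diff_rel_def by blast

lemma diff_rel_transport:
  assumes t: "t \<in> stage d" "t' \<in> stage d" "u \<in> stage d" and near: "nearby n t t'"
    and r: "diff_rel d W x t t'"
  obtains u' where "u' \<in> stage d" "nearby n u u'" "diff_rel d W x u u'"
proof -
  obtain u' where u': "u' \<in> stage d" "nearby n u u'"
    "\<And>k w. w \<in> LF k \<Longrightarrow> w base \<in> L (k + d) \<Longrightarrow>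
      eqm G (L (Suc (k + d))) (inv (w t) \<otimes> w t') (inv (w u) \<otimes> w u')"
    using transport[OF t near] by blast
  have "diff_rel d W x u u'"
    unfolding diff_rel_def
  proof
    fix i assume i: "i \<in> W"
    have "eqm G (L (Suc (fst i + d))) (inv (snd i u) \<otimes> snd i u') (inv (snd i t) \<otimes> snd i t')"
      using eqm_sym[OF lower_central_subgroup u'(3)[OF W(2)[OF i] W_base[OF i]]] .
    moreover have "eqm G (L (Suc (fst i + d))) (inv (snd i t) \<otimes> snd i t') (x i)"
      using r i by (simp add: diff_rel_def)
    ultimately show "eqm G (L (Suc (fst i + d))) (inv (snd i u) \<otimes> snd i u') (x i)"
      by (rule eqm_trans[OF lower_central_subgroup])
  qed
  then show thesis using that u' by blast
qed

lemma diffsI: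
  "x \<in> carrier PW \<Longrightarrow> t \<in> stage d \<Longrightarrow> t' \<in> stage d \<Longrightarrow> nearby n t t' \<Longrightarrow> diff_rel d W x t t' \<Longrightarrow>
    x \<in> diffs d W n"
  unfolding diffs_def by blast

lemma diffs_closed: "x \<in> diffs d W n \<Longrightarrow> x \<in> carrier PW"
  unfolding diffs_def by blast

text \<open>For products, the second pair of tuples is transported so that it starts where the first
  one ends. The inverse reverses a pair.\<close>

lemma diffs_subgroup: "subgroup (diffs d W n) PW"
proof (rule group.subgroupI[OF PW_group])
  interpret P: group PW by (rule PW_group)
  show "diffs d W n \<subseteq> carrier PW" using diffs_closed by blast
  obtain t where t: "t \<in> stage d" using nonempty by blast
  have "\<one>\<^bsub>PW\<^esub> \<in> diffs d W n"
    by (rule diffsI[OF P.one_closed t t nearby_refl[OF stageD(2)[OF t]] diff_rel_one[OF stageD(2)[OF t]]])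
  then show "diffs d W n \<noteq> {}" by blast
  show "inv\<^bsub>PW\<^esub> x \<in> diffs d W n" if x: "x \<in> diffs d W n" for x
  proof -
    obtain t t' where t: "t \<in> stage d" "t' \<in> stage d" "nearby n t t'" "diff_rel d W x t t'"
      using x unfolding diffs_def by blast
    note xc = diffs_closed[OF x]
    show ?thesis
      by (rule diffsI[OF P.inv_closed[OF xc] t(2,1) nearby_sym[OF t(3)]
          diff_rel_inv[OF stageD(2)[OF t(1)] stageD(2)[OF t(2)] xc t(4)]])
  qed
  show "x \<otimes>\<^bsub>PW\<^esub> y \<in> diffs d W n" if x: "x \<in> diffs d W n" and y: "y \<in> diffs d W n" for x y
  proof -
    obtain t t' where t: "t \<in> stage d" "t' \<in> stage d" "nearby n t t'" "diff_rel d W x t t'"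
      using x unfolding diffs_def by blast
    obtain u u' where u: "u \<in> stage d" "u' \<in> stage d" "nearby n u u'" "diff_rel d W y u u'"
      using y unfolding diffs_def by blast
    obtain v where v: "v \<in> stage d" "nearby n t' v" "diff_rel d W y t' v"
      using diff_rel_transport[OF u(1,2) t(2) u(3,4)] by blast
    show ?thesis
      by (rule diffsI[OF P.m_closed[OF diffs_closed[OF x] diffs_closed[OF y]] t(1) v(1)
          nearby_trans[OF t(3) v(2)]
          diff_rel_mult[OF stageD(2)[OF t(1)] stageD(2)[OF t(2)] stageD(2)[OF v(1)] t(4) v(3)]])
  qed
qed

lemma diffs_cong:
  assumes x: "x \<in> diffs d W n" and y: "y \<in> carrier PW" "\<And>i. i \<in> W \<Longrightarrow> eqm G (L (Suc (fst i + d))) (x i) (y i)"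
  shows "y \<in> diffs d W n"
  using x diff_rel_cong[OF _ y(2)] y(1) unfolding diffs_def by blast

lemma diffs_lower_central:
  assumes x: "x \<in> diffs d W n" and i: "i \<in> W" shows "x i \<in> L (fst i + d)"
proof -
  obtain t t' where t: "t \<in> stage d" "t' \<in> stage d" "diff_rel d W x t t'"
    using x unfolding diffs_def by blast
  have "inv (snd i t) \<otimes> snd i t' \<in> L (fst i + d)"
    using W_stage[OF i] t
    by (intro subgroup.m_closed[OF lower_central_subgroup] subgroup.m_inv_closed[OF lower_central_subgroup])
  moreover have "eqm G (L (fst i + d)) (inv (snd i t) \<otimes> snd i t') (x i)"
    using t(3) i eqm_mono[OF _ lower_central_Suc_subset] by (auto simp: diff_rel_def)
  ultimately show ?thesis using eqm_mem[OF lower_central_subgroup] by blast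
qed

text \<open>The entries lie in \<open>L (fst i + d)\<close>, on which conjugation is trivial modulo
  the next term.\<close>

lemma diffs_normalizing: "carrier PW \<subseteq> normalizing PW (diffs d W n)"
proof
  interpret P: group PW by (rule PW_group)
  have *: "u \<otimes>\<^bsub>PW\<^esub> x \<otimes>\<^bsub>PW\<^esub> inv\<^bsub>PW\<^esub> u \<in> diffs d W n" if u: "u \<in> carrier PW" and x: "x \<in> diffs d W n" for u x
  proof (rule diffs_cong[OF x])
    show "u \<otimes>\<^bsub>PW\<^esub> x \<otimes>\<^bsub>PW\<^esub> inv\<^bsub>PW\<^esub> u \<in> carrier PW"
      using u diffs_closed[OF x] by (intro P.m_closed P.inv_closed)
    fix i assume i: "i \<in> W"
    have "eqm G (L (Suc (fst i + d))) (x i) (u i \<otimes> x i \<otimes> inv (u i))"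
      using eqm_sym[OF lower_central_subgroup eqm_central[OF diffs_lower_central[OF x i] PW_closed[OF u i]]] .
    then show "eqm G (L (Suc (fst i + d))) (x i) ((u \<otimes>\<^bsub>PW\<^esub> x \<otimes>\<^bsub>PW\<^esub> inv\<^bsub>PW\<^esub> u) i)"
      using PW_inv[OF u i] i by simp
  qed
  fix u assume u: "u \<in> carrier PW"
  then show "u \<in> normalizing PW (diffs d W n)"
    using *[OF u] *[OF P.inv_closed[OF u]] unfolding normalizing_def by (simp del: carrier_product_group mult_product_group)
qed

lemma diffs_mono: "diffs d W n \<subseteq> diffs d W 1"
  using start_nearby stageD(1) unfolding diffs_def by blast

text \<open>\<open>C\<close> counts the tuples modulo a power subgroup of \<open>G\<close> that
  meets \<open>L 1\<close> inside \<open>powers G (L 1) n\<close>; such a subgroup exists by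
  separability. It matters that \<open>C\<close> is the same for all sequences.\<close>

lemma finite_tuple_classes:
  assumes n: "n > 0"
  shows "\<exists>C. \<forall>f. (\<forall>i. f i \<in> start) \<longrightarrow> (\<exists>i j. i < j \<and> j \<le> C \<and> nearby n (f i) (f (j::nat)))"
proof -
  have "\<exists>n'>0. L 1 \<inter> powers G (carrier G) n' \<subseteq> powers G (L 1) n"
    using n powers_mem[of _ "L 1" n]
    by (intro polycyclic_separation[OF polycyclic_G lower_central_subgroup
          subgroup.subset[OF lower_central_subgroup] V_subgroup])
  then obtain n' where n': "n' > 0" "L 1 \<inter> powers G (carrier G) n' \<subseteq> powers G (L 1) n" by blast
  let ?N = "powers G (carrier G) n'"
  have N: "?N \<lhd> G" by (rule powers_normal)
  have "finite (rcosets ?N)" using powers_fin_normal[OF polycyclic_G n'(1)] by (simp add: fin_normal_def)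
  then have fin: "finite (\<Pi>\<^sub>E s\<in>S. rcosets ?N)" using S(1) by (simp add: finite_PiE)
  define C where "C = card (\<Pi>\<^sub>E s\<in>S. rcosets ?N)"
  have "\<exists>i j. i < j \<and> j \<le> C \<and> nearby n (f i) (f j)" if f: "\<forall>i. f i \<in> start" for f :: "nat \<Rightarrow> 'a \<Rightarrow> 'a"
  proof -
    define g where "g i = (\<lambda>s\<in>S. ?N #> f i s)" for i
    have ft: "f i s \<in> carrier G" if "s \<in> S" for i s using tuple_closed[OF startD that] f by blast
    have "g i \<in> (\<Pi>\<^sub>E s\<in>S. rcosets ?N)" for i
      using ft rcosetsI[OF subgroup.subset[OF normal_imp_subgroup[OF N]]] by (auto simp: g_def)
    then have "\<not> inj_on g {..C}"
      using card_inj_on_le[of g "{..C}" "\<Pi>\<^sub>E s\<in>S. rcosets ?N"] fin by (auto simp: C_def)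
    then obtain i j where ij: "j \<le> C" "i < j" "g i = g j"
      unfolding inj_on_def by (metis atMost_iff linorder_neqE_nat)
    have "eqm G (powers G (L 1) n) (f i s) (f j s)" if s: "s \<in> S" for s
    proof -
      have "?N #> f i s = ?N #> f j s" using fun_cong[OF ij(3), of s] s by (simp add: g_def)
      then have "eqm G ?N (f i s) (f j s)" using eqm_rcos(2)[OF N ft[OF s] ft[OF s]] by blast
      moreover have "eqm G (L 1) (f i s) (f j s)" using start_eqm f s by blast
      ultimately show ?thesis using n'(2) by (auto simp: eqm_def)
    qed
    then show ?thesis using ij unfolding nearby_def by blast
  qed
  then show ?thesis by blast
qed

text \<open>Repeated transport of the pair for \<open>x\<close> gives a sequence of tuples with
  successive difference \<open>x\<close>. Two of its first members are nearby, so a power of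
  \<open>x\<close> is a difference of nearby tuples; the factorial makes the exponent uniform. This
  is the power condition required by separability.\<close>

lemma diffs_exponent:
  assumes n: "n > 0"
  shows "\<exists>m>0. \<forall>x\<in>diffs d W 1. x [^]\<^bsub>PW\<^esub> (m::nat) \<in> diffs d W n"
proof -
  interpret P: group PW by (rule PW_group)
  obtain C where C: "\<And>f. \<forall>i. f i \<in> start \<Longrightarrow> \<exists>i j. i < j \<and> j \<le> C \<and> nearby n (f i) (f (j::nat))"
    using finite_tuple_classes[OF n] by blast
  have "x [^]\<^bsub>PW\<^esub> (fact C :: nat) \<in> diffs d W n" if x: "x \<in> diffs d W 1" for x
  proof -
    obtain t t' where t: "t \<in> stage d" "t' \<in> stage d" "nearby 1 t t'" "diff_rel d W x t t'"
      using x unfolding diffs_def by blast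
    have xc: "x \<in> carrier PW" by (rule diffs_closed[OF x])
    have "\<exists>f. \<forall>i::nat. f i \<in> stage d \<and> diff_rel d W x (f i) (f (Suc i))"
      using t(1) diff_rel_transport[OF t(1,2) _ t(3,4)] by (intro dependent_nat_choice) blast+
    then obtain f where f: "\<And>i::nat. f i \<in> stage d" "\<And>i. diff_rel d W x (f i) (f (Suc i))" by blast
    have pow: "diff_rel d W (x [^]\<^bsub>PW\<^esub> j) (f i) (f (i + j))" for i j :: nat
    proof (induction j)
      case 0
      then show ?case using diff_rel_one[OF stageD(2)[OF f(1)]] by (simp del: one_product_group)
    next
      case (Suc j)
      show ?case
        using diff_rel_mult[OF stageD(2)[OF f(1)] stageD(2)[OF f(1)] stageD(2)[OF f(1)] Suc f(2)]
        by (simp del: mult_product_group)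
    qed
    obtain i j where ij: "i < j" "j \<le> C" "nearby n (f i) (f j)" using C[of f] stageD(1)[OF f(1)] by blast
    have "x [^]\<^bsub>PW\<^esub> (j - i) \<in> diffs d W n"
      using pow[of "j - i" i] ij(1) by (intro diffsI[OF P.nat_pow_closed[OF xc] f(1) f(1) ij(3)]) simp
    moreover have "(j - i) dvd fact C" using ij by (intro dvd_fact) auto
    then obtain k where "fact C = (j - i) * k" by auto
    ultimately show ?thesis
      using P.subgroup_nat_pow_closed[OF diffs_subgroup, of "x [^]\<^bsub>PW\<^esub> (j - i)" n k] P.nat_pow_pow[OF xc] by simp
  qed
  then show ?thesis by (intro exI[of _ "fact C"]) simp
qed

lemma diffs_contains:
  assumes x: "x \<in> carrier PW" "\<And>i. i \<in> W \<Longrightarrow> x i \<in> L (Suc (fst i + d))"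
  shows "x \<in> diffs d W n"
proof (rule diffs_cong[OF subgroup.one_closed[OF diffs_subgroup] x(1)])
  fix i assume i: "i \<in> W"
  then show "eqm G (L (Suc (fst i + d))) (\<one>\<^bsub>PW\<^esub> i) (x i)"
    using x(2)[OF i] PW_closed[OF x(1) i] eqm_one_iff[OF lower_central_subgroup] by simp
qed

lemma wvals_diff:
  assumes t: "t \<in> stage d" "t' \<in> stage d"
  shows "wvals W t' \<otimes>\<^bsub>PW\<^esub> inv\<^bsub>PW\<^esub> wvals W t \<in> diffs d W 1"
proof -
  interpret P: group PW by (rule PW_group)
  have v: "wvals W t \<in> carrier PW" "wvals W t' \<in> carrier PW" using t stageD(2) wvals_closed by auto
  have "diff_rel d W (wvals W t' \<otimes>\<^bsub>PW\<^esub> inv\<^bsub>PW\<^esub> wvals W t) t t'"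
    unfolding diff_rel_def
  proof
    fix i assume i: "i \<in> W"
    have "inv (snd i t) \<in> carrier G" using W_closed[OF i stageD(2)[OF t(1)]] by simp
    then have "eqm G (L (Suc (fst i + d))) (inv (snd i t) \<otimes> snd i t') (snd i t' \<otimes> inv (snd i t))"
      by (rule eqm_commute[OF W_stage[OF i t(2)]])
    then show "eqm G (L (Suc (fst i + d))) (inv (snd i t) \<otimes> snd i t') ((wvals W t' \<otimes>\<^bsub>PW\<^esub> inv\<^bsub>PW\<^esub> wvals W t) i)"
      using PW_mult[OF i] PW_inv[OF v(1) i] wvals_apply[OF i] by simp
  qed
  then show ?thesis
    using t start_nearby[OF stageD(1)[OF t(1)] stageD(1)[OF t(2)]] v
    by (intro diffsI[OF _ t]) (auto simp del: carrier_product_group mult_product_group intro!: P.m_closed P.inv_closed)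
qed

text \<open>The values of tuples at stage \<open>d\<close> form a coset of \<open>diffs d W 1\<close> that approaches the
  trivial element, hence it is the trivial coset. Then separability lets us correct an
  approximating tuple by a transport that is small in the profinite topology.\<close>

lemma stage_correction:
  assumes n: "n > 0"
    and appr: "\<And>m. m > 0 \<Longrightarrow> \<exists>t\<in>stage d. t \<in> A m \<and>
      (\<forall>i\<in>W. \<exists>l\<in>L (Suc (fst i + d)). eqm G (powers G (carrier G) m) l (snd i t))"
    and A: "\<And>m m'. m dvd m' \<Longrightarrow> A m' \<subseteq> A m"
  shows "\<exists>t\<in>A n. \<exists>t'\<in>stage d. nearby n t t' \<and> (\<forall>i\<in>W. snd i t' \<in> L (Suc (fst i + d)))"
proof -
  interpret P: group PW by (rule PW_group)
  let ?R = "\<lambda>m. powers PW (carrier PW) m"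
  have Rc: "p \<in> carrier PW" if "p \<in> ?R m" for p m
    using subgroup.mem_carrier[OF P.powers_subgroup[OF order_refl] that] .
  \<comment> \<open>Multiplying by \<open>p\<close> replaces the values at \<open>t\<close> by the
    entries \<open>l i\<close>, which are trivial up to the next degree and hence belong to
    \<open>diffs d W n'\<close> for every \<open>n'\<close>.\<close>
  have small: "\<exists>p\<in>?R m. wvals W t \<otimes>\<^bsub>PW\<^esub> p \<in> diffs d W n'"
    if m: "m dvd m'" and t: "t \<in> stage d"
      and l: "\<forall>i\<in>W. \<exists>l\<in>L (Suc (fst i + d)). eqm G (powers G (carrier G) m') l (snd i t)" for m m' n' t
  proof -
    obtain l where l: "\<And>i. i \<in> W \<Longrightarrow> l i \<in> L (Suc (fst i + d))"
      "\<And>i. i \<in> W \<Longrightarrow> eqm G (powers G (carrier G) m') (l i) (snd i t)" using l by metis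
    define p where "p = (\<lambda>i\<in>W. inv (snd i t) \<otimes> l i)"
    have lc: "l i \<in> carrier G" "snd i t \<in> carrier G" if "i \<in> W" for i using l(2)[OF that] by (auto simp: eqm_def)
    have pc: "p \<in> carrier PW" using lc by (auto simp: p_def)
    have "p i \<in> powers G (carrier G) m" if i: "i \<in> W" for i
      using eqm_sym[OF powers_subgroup[OF order_refl] l(2)[OF i]] powers_dvd[OF order_refl m] i
      by (auto simp: p_def eqm_def)
    then have "p \<in> ?R m" by (rule power_group_powers[OF W(1) pc])
    moreover have "wvals W t \<otimes>\<^bsub>PW\<^esub> p \<in> diffs d W n'"
    proof (rule diffs_contains)
      show "wvals W t \<otimes>\<^bsub>PW\<^esub> p \<in> carrier PW" using wvals_closed[OF stageD(2)[OF t]] pc by (rule P.m_closed)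
      fix i assume i: "i \<in> W"
      then have "(wvals W t \<otimes>\<^bsub>PW\<^esub> p) i = l i" using lc[OF i] wvals_apply[OF i] by (simp add: p_def)
      then show "(wvals W t \<otimes>\<^bsub>PW\<^esub> p) i \<in> L (Suc (fst i + d))" using l(1)[OF i] by simp
    qed
    ultimately show ?thesis by blast
  qed
  obtain t1 where t1: "t1 \<in> stage d" using nonempty by blast
  note D1 = diffs_subgroup[of 1]
  have v1c: "wvals W t1 \<in> carrier PW" by (rule wvals_closed[OF stageD(2)[OF t1]])
  have v1: "wvals W t1 \<in> diffs d W 1"
  proof (rule P.polycyclic_closed[OF PW_polycyclic D1 subgroup.subset[OF D1] v1c])
    show "wvals W t1 \<in> normalizing PW (diffs d W 1)" using diffs_normalizing v1c by blast
    fix m :: nat assume m: "m > 0"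
    obtain t where t: "t \<in> stage d"
      "\<forall>i\<in>W. \<exists>l\<in>L (Suc (fst i + d)). eqm G (powers G (carrier G) m) l (snd i t)" using appr[OF m] by blast
    obtain p where p: "p \<in> ?R m" "wvals W t \<otimes>\<^bsub>PW\<^esub> p \<in> diffs d W 1" using small[OF dvd_refl t] by blast
    have "(wvals W t1 \<otimes>\<^bsub>PW\<^esub> inv\<^bsub>PW\<^esub> wvals W t) \<otimes>\<^bsub>PW\<^esub> (wvals W t \<otimes>\<^bsub>PW\<^esub> p) \<in> diffs d W 1"
      by (rule subgroup.m_closed[OF D1 wvals_diff[OF t(1) t1] p(2)])
    moreover have "(wvals W t1 \<otimes>\<^bsub>PW\<^esub> inv\<^bsub>PW\<^esub> wvals W t) \<otimes>\<^bsub>PW\<^esub> (wvals W t \<otimes>\<^bsub>PW\<^esub> p) = wvals W t1 \<otimes>\<^bsub>PW\<^esub> p"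
      using v1c wvals_closed[OF stageD(2)[OF t(1)]] Rc[OF p(1)]
      by (simp add: P.m_assoc del: carrier_product_group mult_product_group)
    ultimately show "\<exists>p\<in>?R m. wvals W t1 \<otimes>\<^bsub>PW\<^esub> p \<in> diffs d W 1" using p(1) by auto
  qed
  have vD: "wvals W t \<in> diffs d W 1" if t: "t \<in> stage d" for t
  proof -
    have "(wvals W t \<otimes>\<^bsub>PW\<^esub> inv\<^bsub>PW\<^esub> wvals W t1) \<otimes>\<^bsub>PW\<^esub> wvals W t1 \<in> diffs d W 1"
      by (rule subgroup.m_closed[OF D1 wvals_diff[OF t1 t] v1])
    then show ?thesis using v1c wvals_closed[OF stageD(2)[OF t]]
      by (simp add: P.m_assoc del: carrier_product_group mult_product_group one_product_group)
  qed
  obtain m0 :: nat where m0: "m0 > 0" "\<forall>x\<in>diffs d W 1. x [^]\<^bsub>PW\<^esub> m0 \<in> diffs d W n"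
    using diffs_exponent[OF n] by blast
  then have "\<exists>m>0. diffs d W 1 \<inter> ?R m \<subseteq> diffs d W n"
    by (intro P.polycyclic_separation[OF PW_polycyclic D1 subgroup.subset[OF D1] diffs_subgroup]) auto
  then obtain m where m: "m > 0" "diffs d W 1 \<inter> ?R m \<subseteq> diffs d W n" by blast
  \<comment> \<open>The factor \<open>n\<close> keeps the tuple in \<open>A n\<close>; at level
    \<open>m\<close> a small element of \<open>diffs d W 1\<close> comes from a nearby move.\<close>
  have "n * m > 0" using n m by simp
  then obtain t where t: "t \<in> stage d" "t \<in> A (n * m)"
    "\<forall>i\<in>W. \<exists>l\<in>L (Suc (fst i + d)). eqm G (powers G (carrier G) (n * m)) l (snd i t)"
    using appr by blast
  have vc: "wvals W t \<in> carrier PW" by (rule wvals_closed[OF stageD(2)[OF t(1)]])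
  obtain p where p: "p \<in> ?R m" "wvals W t \<otimes>\<^bsub>PW\<^esub> p \<in> diffs d W n"
    using small[OF dvd_triv_right t(1,3)] by blast
  have "p \<in> diffs d W 1"
    using P.subgroup_cancel_left[OF D1 vD[OF t(1)] Rc[OF p(1)]] p(2) diffs_mono by blast
  then have "p \<in> diffs d W n" using p(1) m(2) by blast
  then have "wvals W t \<in> diffs d W n" by (rule P.subgroup_cancel_right[OF diffs_subgroup _ vc p(2)])
  then obtain u u' where u: "u \<in> stage d" "u' \<in> stage d" "nearby n u u'" "diff_rel d W (wvals W t) u u'"
    unfolding diffs_def by blast
  \<comment> \<open>The values at \<open>t\<close> are the difference of the nearby pair
    \<open>u\<close>, \<open>u'\<close>. Transporting the reversed pair to \<open>t\<close> removes
    them up to the next degree.\<close>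
  obtain t' where t': "t' \<in> stage d" "nearby n t t'" "diff_rel d W (inv\<^bsub>PW\<^esub> wvals W t) t t'"
    using diff_rel_transport[OF u(2,1) t(1) nearby_sym[OF u(3)]
        diff_rel_inv[OF stageD(2)[OF u(1)] stageD(2)[OF u(2)] vc u(4)]] by blast
  have "snd i t' \<in> L (Suc (fst i + d))" if i: "i \<in> W" for i
  proof -
    have c: "snd i t \<in> carrier G" "snd i t' \<in> carrier G"
      using W_closed[OF i] stageD(2)[OF t(1)] stageD(2)[OF t'(1)] by auto
    have "eqm G (L (Suc (fst i + d))) (inv (snd i t) \<otimes> snd i t') ((inv\<^bsub>PW\<^esub> wvals W t) i)"
      using t'(3) i unfolding diff_rel_def by blast
    then have "eqm G (L (Suc (fst i + d))) (inv (snd i t) \<otimes> snd i t') (inv (snd i t))"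
      by (simp only: PW_inv[OF vc i] wvals_apply[OF i])
    then have "eqm G (L (Suc (fst i + d))) (snd i t \<otimes> (inv (snd i t) \<otimes> snd i t')) (snd i t \<otimes> inv (snd i t))"
      by (rule eqm_mult[OF lower_central_normal eqm_refl[OF c(1) lower_central_subgroup]])
    then have "eqm G (L (Suc (fst i + d))) \<one> (snd i t')"
      using c eqm_sym[OF lower_central_subgroup] by simp
    then show ?thesis using eqm_one_iff[OF lower_central_subgroup c(2)] by blast
  qed
  then show ?thesis using t(2) t' A[of n "n * m"] by (intro bexI[of _ t] bexI[of _ t']) auto
qed

end

end

section \<open>Ascending the stages, and the automorphism at the last stage\<close>

context tuple_stages
begin

lemma stage_0: "stage 0 = start"
  unfolding stage_def using word_lower_central startD by auto

text \<open>\<open>A m\<close> stands for the tuples that approximate a given automorphism to level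
  \<open>m\<close>. The assumptions keep what the correction uses: the sets shrink, small moves stay
  inside, and a word that is deep at the generators takes values close to that depth.\<close>

lemma stage_dense:
  assumes mono: "\<And>m m'. m dvd m' \<Longrightarrow> A m' \<subseteq> A m"
    and near: "\<And>m t t'. t \<in> A m \<Longrightarrow> t' \<in> TS \<Longrightarrow>
      (\<And>s. s \<in> S \<Longrightarrow> eqm G (powers G (carrier G) m) (t s) (t' s)) \<Longrightarrow> t' \<in> A m"
    and wordsA: "\<And>m t w k. m > 0 \<Longrightarrow> t \<in> A m \<Longrightarrow> t \<in> TS \<Longrightarrow> w \<in> carrier F \<Longrightarrow> w base \<in> L k \<Longrightarrow>
      \<exists>l\<in>L k. eqm G (powers G (carrier G) m) l (w t)"
    and dense: "\<And>m. m > 0 \<Longrightarrow> \<exists>t\<in>start. t \<in> A m"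
    and n: "n > (0::nat)"
  shows "\<exists>t\<in>stage d. t \<in> A n"
  using n
proof (induction d arbitrary: n)
  case 0
  then show ?case using dense stage_0 by simp
next
  case (Suc d)
  interpret F: group F by (rule words_group)
  \<comment> \<open>These are the words whose values must become one degree deeper for the next
    stage; for each \<open>k\<close> finitely many of them generate the rest.\<close>
  define K where "K k = {w \<in> LF k. w base \<in> L (Suc (k + d))}" for k
  have K: "subgroup (K k) F" for k
  proof (rule F.subgroupI)
    interpret e: group_hom F G "\<lambda>w. w base" by (rule eval_hom[OF base_tuple])
    show "K k \<subseteq> carrier F" using LF_closed by (auto simp: K_def)
    have "\<one>\<^bsub>F\<^esub> \<in> K k"
      using subgroup.one_closed[OF LF_subgroup] subgroup.one_closed[OF lower_central_subgroup] e.hom_one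
      by (simp add: K_def)
    then show "K k \<noteq> {}" by blast
    show "inv\<^bsub>F\<^esub> a \<in> K k" if "a \<in> K k" for a
      using that subgroup.m_inv_closed[OF LF_subgroup] subgroup.m_inv_closed[OF lower_central_subgroup]
        e.hom_inv[OF LF_closed[of _ k]] by (simp add: K_def)
    show "a \<otimes>\<^bsub>F\<^esub> b \<in> K k" if "a \<in> K k" "b \<in> K k" for a b
      using that subgroup.m_closed[OF LF_subgroup] subgroup.m_closed[OF lower_central_subgroup]
        e.hom_mult[OF LF_closed[of _ k] LF_closed[of _ k]] by (simp add: K_def)
  qed
  have "\<exists>T. finite T \<and> T \<subseteq> K k \<and> generate F T = K k" for k
    by (rule F.polycyclic_subgroup_fin_gen[OF polycyclic_F K subgroup.subset[OF K]])
  then obtain T where T: "\<And>k. finite (T k)" "\<And>k. T k \<subseteq> K k" "\<And>k. generate F (T k) = K k" by metis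
  \<comment> \<open>The degrees below \<open>c\<close> suffice, because \<open>LF c\<close> is
    trivial.\<close>
  define W where "W = (\<Union>k<c. Pair k ` T k)"
  have W: "finite W" "\<And>i. i \<in> W \<Longrightarrow> snd i \<in> LF (fst i)" "\<And>i. i \<in> W \<Longrightarrow> snd i base \<in> L (Suc (fst i + d))"
    using T(1) subsetD[OF T(2)] by (auto simp: W_def K_def)
  have nonempty: "stage d \<noteq> {}" using Suc.IH[of 1] by auto
  have "\<exists>t\<in>stage d. t \<in> A m \<and>
      (\<forall>i\<in>W. \<exists>l\<in>L (Suc (fst i + d)). eqm G (powers G (carrier G) m) l (snd i t))" if m: "m > 0" for m
  proof -
    obtain t where t: "t \<in> stage d" "t \<in> A m" using Suc.IH[OF m] by blast
    have "\<exists>l\<in>L (Suc (fst i + d)). eqm G (powers G (carrier G) m) l (snd i t)" if i: "i \<in> W" for i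
      using wordsA[OF m t(2) stageD(2)[OF t(1)] LF_closed[OF W(2)[OF i]] W(3)[OF i]] .
    then show ?thesis using t by blast
  qed
  then have "\<exists>t\<in>A n. \<exists>t'\<in>stage d. nearby n t t' \<and> (\<forall>i\<in>W. snd i t' \<in> L (Suc (fst i + d)))"
    using mono Suc.prems by (intro stage_correction[OF W nonempty]) auto
  then obtain t t' where t: "t \<in> A n" "t' \<in> stage d" "nearby n t t'" "\<And>i. i \<in> W \<Longrightarrow> snd i t' \<in> L (Suc (fst i + d))"
    by blast
  note t'T = stageD(2)[OF t(2)]
  have "w t' \<in> L (k + Suc d)" if w: "w \<in> LF k" "w base \<in> L (k + Suc d)" for k w
  proof (cases "k < c")
    case True
    interpret e: group_hom F G "\<lambda>w. w t'" by (rule eval_hom[OF t'T])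
    let ?B = "{w \<in> carrier F. w t' \<in> L (Suc (k + d))}"
    have B: "subgroup ?B F"
    proof (rule F.subgroupI)
      have "\<one>\<^bsub>F\<^esub> \<in> ?B" using subgroup.one_closed[OF lower_central_subgroup] e.hom_one by simp
      then show "?B \<noteq> {}" by blast
      show "inv\<^bsub>F\<^esub> a \<in> ?B" if "a \<in> ?B" for a
        using that subgroup.m_inv_closed[OF lower_central_subgroup] e.hom_inv by simp
      show "a \<otimes>\<^bsub>F\<^esub> b \<in> ?B" if "a \<in> ?B" "b \<in> ?B" for a b
        using that subgroup.m_closed[OF lower_central_subgroup] e.hom_mult by simp
    qed auto
    have "v t' \<in> L (Suc (k + d))" if v: "v \<in> T k" for v
      using t(4)[of "(k, v)"] v True by (auto simp: W_def)
    then have "T k \<subseteq> ?B" using subgroup.subset[OF K] T(2) by blast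
    then have "K k \<subseteq> ?B" using F.generate_subgroup_incl[OF _ B, of "T k"] T(3) by simp
    then show ?thesis using w by (auto simp: K_def)
  next
    case False
    then have "w = \<one>\<^bsub>F\<^esub>" using w F.lower_central_antimono[of c k] LF_c by auto
    then show ?thesis using word_one[OF t'T] subgroup.one_closed[OF lower_central_subgroup] by simp
  qed
  then have "t' \<in> stage (Suc d)" using stageD(1)[OF t(2)] by (simp add: stage_def)
  moreover have "t' \<in> A n"
  proof (rule near[OF t(1) t'T])
    show "eqm G (powers G (carrier G) n) (t s) (t' s)" if "s \<in> S" for s
      using t(3) that eqm_mono[OF _ V_powers] unfolding nearby_def by blast
  qed
  ultimately show ?case by blast
qed

text \<open>In degree \<open>0\<close> the stage condition and its converse say that the same words
  vanish at \<open>base\<close> and at \<open>t\<close>, which makes the induced map well defined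
  and injective. It is onto because \<open>t\<close> generates \<open>G\<close>.\<close>

lemma stage_automorphism:
  assumes t: "t \<in> stage c"
  shows "\<exists>\<phi>\<in>auto G. \<forall>s\<in>S. \<phi> s = t s"
proof -
  interpret F: group F by (rule words_group)
  interpret b: group_hom F G "\<lambda>w. w base" by (rule eval_hom[OF base_tuple])
  interpret e: group_hom F G "\<lambda>w. w t" by (rule eval_hom[OF stageD(2)[OF t]])
  have surj: "(\<lambda>w. w base) ` carrier F = carrier G" by (rule eval_surj[OF base_tuple base_generate])
  have one: "w base = \<one> \<longleftrightarrow> w t = \<one>" if "w \<in> carrier F" for w
    using stage_mem[OF t, of w 0] stage_converse[OF t, of w 0] that c by auto
  define \<phi> where "\<phi> = (\<lambda>g\<in>carrier G. (inv_into (carrier F) (\<lambda>w. w base) g) t)"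
  have \<phi>: "\<phi> (w base) = w t" if w: "w \<in> carrier F" for w
  proof -
    define v where "v = inv_into (carrier F) (\<lambda>w. w base) (w base)"
    have "w base \<in> (\<lambda>w. w base) ` carrier F" using w by blast
    then have v: "v \<in> carrier F" "v base = w base"
      unfolding v_def by (auto intro: inv_into_into f_inv_into_f[where f = "\<lambda>w. w base"])
    have vw: "inv\<^bsub>F\<^esub> v \<otimes>\<^bsub>F\<^esub> w \<in> carrier F" using v w by simp
    have "(inv\<^bsub>F\<^esub> v \<otimes>\<^bsub>F\<^esub> w) base = \<one>" using v w b.hom_mult b.hom_inv b.hom_closed by simp
    then have "(inv\<^bsub>F\<^esub> v \<otimes>\<^bsub>F\<^esub> w) t = \<one>" using one[OF vw] by blast
    then have "inv (v t) \<otimes> w t = \<one>" using v w e.hom_mult e.hom_inv by simp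
    then have "v t = w t"
      using e.hom_closed[OF v(1)] e.hom_closed[OF w] inv_cancel(1)[of "v t" "w t"] by simp
    then show ?thesis using b.hom_closed[OF w] by (simp add: \<phi>_def v_def)
  qed
  have "\<phi> \<in> hom G G"
  proof (rule homI)
    fix x assume "x \<in> carrier G"
    then obtain v where v: "v \<in> carrier F" "x = v base" using surj by blast
    then show "\<phi> x \<in> carrier G" using \<phi> e.hom_closed by simp
    fix y assume "y \<in> carrier G"
    then obtain w where w: "w \<in> carrier F" "y = w base" using surj by blast
    have "x \<otimes> y = (v \<otimes>\<^bsub>F\<^esub> w) base" using v w b.hom_mult by simp
    then show "\<phi> (x \<otimes> y) = \<phi> x \<otimes> \<phi> y" using \<phi> v w e.hom_mult F.m_closed by metis
  qed
  then interpret \<phi>: group_hom G G \<phi> by (simp add: group_hom_def group_hom_axioms_def is_group)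
  have "inj_on \<phi> (carrier G)"
    unfolding \<phi>.inj_on_one_iff
  proof (intro allI impI)
    fix x assume x: "x \<in> carrier G" "\<phi> x = \<one>"
    then obtain v where v: "v \<in> carrier F" "x = v base" using surj by blast
    then show "x = \<one>" using \<phi>[OF v(1)] x one by simp
  qed
  moreover have "\<phi> ` carrier G = carrier G"
  proof
    show "carrier G \<subseteq> \<phi> ` carrier G"
    proof
      fix y assume "y \<in> carrier G"
      then obtain w where "w \<in> carrier F" "y = w t"
        using eval_surj[OF stageD(2)[OF t] start_generate[OF stageD(1)[OF t]]] by blast
      then show "y \<in> \<phi> ` carrier G" using \<phi> b.hom_closed by (metis imageI)
    qed
  qed auto
  ultimately have "\<phi> \<in> auto G"
    using \<open>\<phi> \<in> hom G G\<close> by (simp add: auto_def Bij_def bij_betw_def \<phi>_def)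
  moreover have "\<phi> s = t s" if s: "s \<in> S" for s
    using \<phi>[OF coord_word[OF s]] coord_apply[OF base_tuple, of s] coord_apply[OF stageD(2)[OF t], of s] s
    by (simp add: base_def)
  ultimately show ?thesis by blast
qed

end

section \<open>The congruence kernel\<close>

lemma profinite_mult:
  "N \<in> fin_normal G \<Longrightarrow> (x \<otimes>\<^bsub>profinite_completion G\<^esub> y) N = x N <#>\<^bsub>G\<^esub> y N"
  by (simp add: profinite_completion_def)

lemma profinite_one: "\<one>\<^bsub>profinite_completion G\<^esub> = (\<lambda>N\<in>fin_normal G. N)"
  by (simp add: profinite_completion_def)

lemma profinite_compat:
  "x \<in> carrier (profinite_completion G) \<Longrightarrow> N \<in> fin_normal G \<Longrightarrow> M \<in> fin_normal G \<Longrightarrow> N \<subseteq> M \<Longrightarrow> x N \<subseteq> x M"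
  by (simp add: profinite_completion_def)

lemma profinite_rcosets:
  "x \<in> carrier (profinite_completion G) \<Longrightarrow> N \<in> fin_normal G \<Longrightarrow> x N \<in> rcosets\<^bsub>G\<^esub> N"
  by (auto simp: profinite_completion_def PiE_iff)

lemma profinite_extensional:
  "x \<in> carrier (profinite_completion G) \<Longrightarrow> x \<in> extensional (fin_normal G)"
  by (auto simp: profinite_completion_def PiE_iff)

definition profinite_emb :: "('a, 'b) monoid_scheme \<Rightarrow> 'a \<Rightarrow> 'a set \<Rightarrow> 'a set" where
  "profinite_emb G g = (\<lambda>N\<in>fin_normal G. N #>\<^bsub>G\<^esub> g)"

context group
begin

lemma fin_normalD: "N \<in> fin_normal G \<Longrightarrow> N \<lhd> G" "N \<in> fin_normal G \<Longrightarrow> subgroup N G"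
  by (auto simp: fin_normal_def normal_imp_subgroup)

lemma profinite_emb_closed:
  assumes "g \<in> carrier G" shows "profinite_emb G g \<in> carrier (profinite_completion G)"
  using assms rcosetsI subgroup.subset[OF fin_normalD(2)]
  by (auto simp: profinite_emb_def profinite_completion_def r_coset_def)

lemma profinite_emb_apply: "N \<in> fin_normal G \<Longrightarrow> profinite_emb G g N = N #> g"
  by (simp add: profinite_emb_def)

lemma profinite_emb_mult:
  assumes "g \<in> carrier G" "h \<in> carrier G"
  shows "profinite_emb G (g \<otimes> h) = profinite_emb G g \<otimes>\<^bsub>profinite_completion G\<^esub> profinite_emb G h"
  using assms normal.rcos_sum[OF fin_normalD(1)]
  by (auto simp: profinite_emb_def profinite_completion_def intro!: restrict_ext)

lemma rcosets_rep:
  assumes N: "subgroup N G" and C: "C \<in> rcosets N" and g: "g \<in> C"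
  shows "g \<in> carrier G" "C = N #> g"
proof -
  obtain a where a: "a \<in> carrier G" "C = N #> a" using C by (auto simp: RCOSETS_def)
  show "g \<in> carrier G" using g a r_coset_subset_G[OF subgroup.subset[OF N] a(1)] by blast
  show "C = N #> g" using a g repr_independence[OF _ a(1) N] by blast
qed

lemma profinite_rep:
  assumes "x \<in> carrier (profinite_completion G)" "N \<in> fin_normal G" "g \<in> x N"
  shows "g \<in> carrier G" "x N = N #> g"
  using rcosets_rep[OF fin_normalD(2)[OF assms(2)] profinite_rcosets[OF assms(1,2)] assms(3)] by auto

lemma profinite_nonempty:
  assumes "x \<in> carrier (profinite_completion G)" "N \<in> fin_normal G"
  shows "\<exists>g. g \<in> x N"
  using subgroup.rcosets_non_empty[OF fin_normalD(2)[OF assms(2)] profinite_rcosets[OF assms]] by blast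

lemma fin_normal_Int:
  assumes "N \<in> fin_normal G" "M \<in> fin_normal G" shows "N \<inter> M \<in> fin_normal G"
proof -
  note N = fin_normalD(1)[OF assms(1)] and M = fin_normalD(1)[OF assms(2)]
  have NM: "N \<inter> M \<lhd> G" using N M by (rule normal_subgroup_intersect)
  define f where "f x = (N #> x, M #> x)" for x
  have "f ` carrier G \<subseteq> (rcosets N) \<times> (rcosets M)"
    using rcosetsI subgroup.subset[OF fin_normalD(2)] assms by (auto simp: f_def)
  then have "finite (f ` carrier G)"
    using assms finite_subset[of "f ` carrier G" "(rcosets N) \<times> (rcosets M)"] by (simp add: fin_normal_def)
  then have fin: "finite (inv_into (carrier G) f ` f ` carrier G)" by simp
  have "\<exists>a\<in>inv_into (carrier G) f ` f ` carrier G. inv a \<otimes> x \<in> N \<inter> M" if x: "x \<in> carrier G" for x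
  proof -
    define a where "a = inv_into (carrier G) f (f x)"
    have a: "a \<in> carrier G" "f a = f x" using x by (auto simp: a_def inv_into_into f_inv_into_f)
    then have "N #> a = N #> x" "M #> a = M #> x" by (auto simp: f_def)
    then have "inv a \<otimes> x \<in> N \<inter> M"
      using eqm_rcos(2)[OF N a(1) x] eqm_rcos(2)[OF M a(1) x] by (simp add: eqm_def)
    then show ?thesis using x by (auto simp: a_def)
  qed
  moreover have "inv_into (carrier G) f ` f ` carrier G \<subseteq> carrier G" by (auto intro: inv_into_into)
  ultimately show ?thesis using finite_reps_rcosets[OF NM fin] by blast
qed

end

context fg_nilpotent
begin

abbreviation GP where "GP n \<equiv> powers G (carrier G) n"

lemma GP_fin_normal: "n > 0 \<Longrightarrow> GP n \<in> fin_normal G"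
  by (rule powers_fin_normal[OF polycyclic_G])

lemma fin_normalI:
  assumes N: "N \<lhd> G" and n: "n > 0" "GP n \<subseteq> N" shows "N \<in> fin_normal G"
proof -
  obtain T where "finite T" "T \<subseteq> carrier G" "\<And>x. x \<in> carrier G \<Longrightarrow> \<exists>a\<in>T. inv a \<otimes> x \<in> GP n"
    using fin_normal_finite_reps[OF GP_fin_normal[OF n(1)]] by blast
  then show ?thesis using n(2) by (intro finite_reps_rcosets[OF N]) blast+
qed

text \<open>As \<open>GP n\<close> is characteristic, it lies in the preimage of \<open>N\<close>
  under every automorphism. One representative of \<open>x\<close> at level \<open>GP n\<close> thus
  computes the action of all automorphisms modulo \<open>N\<close>.\<close>

lemma aut_ext_apply:
  assumes \<phi>: "\<phi> \<in> auto G" and x: "x \<in> carrier (profinite_completion G)" and N: "N \<in> fin_normal G"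
    and n: "n > 0" "GP n \<subseteq> N" and g: "g \<in> x (GP n)"
  shows "aut_ext G \<phi> x N = N #> \<phi> g"
proof -
  interpret p: group_hom G G \<phi> by (rule autoE(1)[OF \<phi>])
  note Nn = fin_normalD(1)[OF N] and Nsg = fin_normalD(2)[OF N]
  let ?M = "\<phi> -` N \<inter> carrier G"
  have "?M \<lhd> G"
    unfolding normal_inv_iff
  proof (intro conjI ballI)
    show "subgroup ?M G"
    proof (rule subgroupI)
      have "\<one> \<in> ?M" using subgroup.one_closed[OF Nsg] by simp
      then show "?M \<noteq> {}" by blast
      show "inv a \<in> ?M" if "a \<in> ?M" for a using that subgroup.m_inv_closed[OF Nsg] by simp
      show "a \<otimes> b \<in> ?M" if "a \<in> ?M" "b \<in> ?M" for a b using that subgroup.m_closed[OF Nsg] by simp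
    qed auto
    show "u \<otimes> h \<otimes> inv u \<in> ?M" if "u \<in> carrier G" "h \<in> ?M" for u h
      using that normal.inv_op_closed2[OF Nn] by simp
  qed
  moreover have sub: "GP n \<subseteq> ?M"
    using auto_powers[OF \<phi>, of n] n(2) subgroup.subset[OF powers_subgroup[OF order_refl]] by blast
  ultimately have M: "?M \<in> fin_normal G" using fin_normalI n(1) by blast
  have "g \<in> x ?M" using g profinite_compat[OF x GP_fin_normal[OF n(1)] M sub] by blast
  note xM = profinite_rep[OF x M this]
  have "\<phi> ` (?M #> g) = N #> \<phi> g"
  proof
    show "\<phi> ` (?M #> g) \<subseteq> N #> \<phi> g" using xM(1) by (auto simp: r_coset_def)
    show "N #> \<phi> g \<subseteq> \<phi> ` (?M #> g)"
    proof
      fix y assume "y \<in> N #> \<phi> g"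
      then obtain m where m: "m \<in> N" "y = m \<otimes> \<phi> g" by (auto simp: r_coset_def)
      have "m \<in> \<phi> ` carrier G"
        using autoE(3)[OF \<phi>] subgroup.mem_carrier[OF Nsg m(1)] by (simp add: bij_betw_def)
      then obtain a where a: "a \<in> carrier G" "m = \<phi> a" by blast
      then have "a \<otimes> g \<in> ?M #> g" using m(1) by (auto simp: r_coset_def)
      moreover have "y = \<phi> (a \<otimes> g)" using a m(2) xM(1) by simp
      ultimately show "y \<in> \<phi> ` (?M #> g)" by blast
    qed
  qed
  then show ?thesis using x N xM(2) by (simp add: aut_ext_def)
qed

section \<open>Principal congruence subgroups of a group of automorphisms\<close>

context
  fixes H assumes H: "subgroup H (AutoGroup G)" "H \<subseteq> IA_star G"
begin

abbreviation BH where "BH \<equiv> aut_subgroup G H"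

definition CH :: "nat \<Rightarrow> ('a \<Rightarrow> 'a) set" where "CH n = H \<inter> cong_aut G (GP n)"

lemma BH_group: "group BH"
  unfolding aut_subgroup_def by (rule group.subgroup_imp_group[OF AutoGroup H(1)])

lemma BH_carrier: "carrier BH = H"
  by (simp add: aut_subgroup_def)

lemma BH_mult: "\<phi> \<otimes>\<^bsub>BH\<^esub> \<psi> = \<phi> \<otimes>\<^bsub>AutoGroup G\<^esub> \<psi>"
  by (simp add: aut_subgroup_def)

lemma BH_one: "\<one>\<^bsub>BH\<^esub> = \<one>\<^bsub>AutoGroup G\<^esub>"
  by (simp add: aut_subgroup_def)

lemma BH_inv: "\<phi> \<in> H \<Longrightarrow> inv\<^bsub>BH\<^esub> \<phi> = inv\<^bsub>AutoGroup G\<^esub> \<phi>"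
  unfolding aut_subgroup_def by (rule group.m_inv_consistent[OF AutoGroup H(1)])

lemma H_auto: "H \<subseteq> auto G"
  using subgroup.subset[OF H(1)] by (simp add: carrier_AutoGroup)

lemma CH_subgroup: "subgroup (CH n) BH"
proof -
  have "subgroup (CH n) (AutoGroup G)"
    unfolding CH_def
    by (intro group.subgroups_Inter_pair[OF AutoGroup] H cong_aut_subgroup powers_subgroup order_refl)
  then show ?thesis unfolding aut_subgroup_def
    by (rule group.subgroup_incl[OF AutoGroup _ H(1)]) (auto simp: CH_def)
qed

lemma CH_fin_normal:
  assumes n: "n > 0" shows "CH n \<in> fin_normal BH"
proof -
  interpret B: group BH by (rule BH_group)
  have nrm: "CH n \<lhd> BH"
    unfolding B.normal_inv_iff
  proof (intro conjI ballI)
    show "subgroup (CH n) BH" by (rule CH_subgroup)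
    fix u h assume u: "u \<in> carrier BH" and h: "h \<in> CH n"
    have uH: "u \<in> H" and hH: "h \<in> H" using u h by (auto simp: BH_carrier CH_def)
    have ua: "u \<in> auto G" and ha: "h \<in> auto G" using uH hH H_auto by auto
    let ?i = "inv\<^bsub>AutoGroup G\<^esub> u" and ?c = "u \<otimes>\<^bsub>BH\<^esub> h \<otimes>\<^bsub>BH\<^esub> inv\<^bsub>BH\<^esub> u"
    have ia: "?i \<in> auto G" by (rule AutoGroup_inv_closed[OF ua])
    have cH: "?c \<in> H" using B.m_closed B.inv_closed u hH by (simp add: BH_carrier)
    have uh: "u \<otimes>\<^bsub>AutoGroup G\<^esub> h \<in> auto G"
      using B.m_closed[of u h] uH hH H_auto by (auto simp: BH_carrier BH_mult)
    have "eqm G (GP n) g (?c g)" if g: "g \<in> carrier G" for g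
    proof -
      have ig: "?i g \<in> carrier G" by (rule auto_closed[OF ia g])
      have "?c g = u (h (?i g))"
        using ua ha ia uh uH g ig by (simp add: BH_mult BH_inv AutoGroup_mult_apply)
      moreover have "eqm G (GP n) (?i g) (h (?i g))" using h ig by (simp add: CH_def cong_aut_def)
      then have "eqm G (GP n) (u (?i g)) (u (h (?i g)))"
        by (rule group_hom.eqm_hom[OF autoE(1)[OF ua] _ auto_powers[OF ua]])
      ultimately show ?thesis using AutoGroup_inv_apply(1)[OF ua g] by simp
    qed
    then show "?c \<in> CH n" using cH H_auto by (auto simp: CH_def cong_aut_def)
  qed
  obtain T where T: "finite T" "T \<subseteq> H"
    "\<And>\<phi>. \<phi> \<in> H \<Longrightarrow> \<exists>\<psi>\<in>T. inv\<^bsub>AutoGroup G\<^esub> \<psi> \<otimes>\<^bsub>AutoGroup G\<^esub> \<phi> \<in> cong_aut G (GP n)"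
    using cong_aut_finite_reps[OF GP_fin_normal[OF n] auto_powers S H_auto] by auto
  show ?thesis
  proof (rule B.finite_reps_rcosets[OF nrm T(1)])
    show "T \<subseteq> carrier BH" using T by (simp add: BH_carrier)
    fix \<phi> assume "\<phi> \<in> carrier BH"
    then have \<phi>: "\<phi> \<in> H" by (simp add: BH_carrier)
    obtain \<psi> where \<psi>: "\<psi> \<in> T" "inv\<^bsub>AutoGroup G\<^esub> \<psi> \<otimes>\<^bsub>AutoGroup G\<^esub> \<phi> \<in> cong_aut G (GP n)" using T(3)[OF \<phi>] by blast
    have \<psi>H: "\<psi> \<in> H" using \<psi> T by blast
    have "inv\<^bsub>BH\<^esub> \<psi> \<otimes>\<^bsub>BH\<^esub> \<phi> \<in> H" using \<phi> \<psi>H B.m_closed B.inv_closed by (simp add: BH_carrier)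
    then have "inv\<^bsub>BH\<^esub> \<psi> \<otimes>\<^bsub>BH\<^esub> \<phi> \<in> CH n" using \<psi>(2) \<psi>H by (simp add: CH_def BH_mult BH_inv)
    then show "\<exists>a\<in>T. inv\<^bsub>BH\<^esub> a \<otimes>\<^bsub>BH\<^esub> \<phi> \<in> CH n" using \<psi>(1) by blast
  qed
qed

text \<open>A normal subgroup of finite index contains all \<open>m\<close>-th powers for some
  \<open>m\<close>, which is the form in which the congruence subgroup property asks for it. The
  congruence topology on \<open>H\<close> is therefore its full profinite topology.\<close>

lemma CH_cofinal:
  assumes M: "M \<in> fin_normal BH" shows "\<exists>n>0. CH n \<subseteq> M"
proof -
  interpret B: group BH by (rule BH_group)
  interpret A: group "AutoGroup G" by (rule AutoGroup)
  obtain m where m: "m > 0" "powers BH (carrier BH) m \<subseteq> M" using B.fin_normal_powers[OF M] by blast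
  have Msg: "subgroup M (AutoGroup G)"
    using A.incl_subgroup[OF H(1)] B.fin_normalD(2)[OF M] by (simp add: aut_subgroup_def)
  have "\<phi> [^]\<^bsub>AutoGroup G\<^esub> m \<in> M" if \<phi>: "\<phi> \<in> H" for \<phi>
  proof -
    have "\<phi> [^]\<^bsub>BH\<^esub> m \<in> M" using B.powers_mem[of \<phi> "carrier BH" m] m \<phi> by (auto simp: BH_carrier)
    then show ?thesis unfolding aut_subgroup_def by (simp add: A.nat_pow_consistent[symmetric])
  qed
  then show ?thesis
    unfolding CH_def using congruence_subgroup_property[OF S c H Msg m(1)] by blast
qed

text \<open>On the coset \<open>h (CH n)\<close> the class of the image of \<open>g\<close> modulo
  \<open>N\<close> is constant. Any other witness \<open>M\<close> in the definite description gives
  the same class, since \<open>h\<close> has a representative at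
  \<open>M \<inter> CH n\<close>.\<close>

lemma completion_action_apply:
  assumes h: "h \<in> carrier (profinite_completion BH)" and x: "x \<in> carrier (profinite_completion G)"
    and N: "N \<in> fin_normal G" and n: "n > 0" "GP n \<subseteq> N" and g: "g \<in> x (GP n)" and \<phi>: "\<phi> \<in> h (CH n)"
  shows "completion_action G H h x N = N #> \<phi> g"
proof -
  interpret B: group BH by (rule BH_group)
  note C = CH_fin_normal[OF n(1)]
  have gc: "g \<in> carrier G" by (rule profinite_rep[OF x GP_fin_normal[OF n(1)] g])
  have val: "aut_ext G \<psi> x N = N #> \<phi> g" if \<psi>: "\<psi> \<in> h (CH n)" for \<psi>
  proof -
    have \<phi>H: "\<phi> \<in> H" and \<psi>H: "\<psi> \<in> H" using B.profinite_rep(1)[OF h C] \<phi> \<psi> by (auto simp: BH_carrier)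
    then have a: "\<phi> \<in> auto G" "\<psi> \<in> auto G" using H_auto by auto
    have "\<psi> \<in> CH n #>\<^bsub>BH\<^esub> \<phi>" using B.profinite_rep(2)[OF h C \<phi>] \<psi> by simp
    then obtain \<mu> where \<mu>: "\<mu> \<in> CH n" "\<psi> = \<mu> \<otimes>\<^bsub>AutoGroup G\<^esub> \<phi>" by (auto simp: r_coset_def BH_mult)
    have \<mu>a: "\<mu> \<in> auto G" using \<mu> by (simp add: CH_def cong_aut_def)
    have "eqm G (GP n) (\<phi> g) (\<mu> (\<phi> g))" using \<mu>(1) auto_closed[OF a(1) gc] by (simp add: CH_def cong_aut_def)
    then have "eqm G N (\<phi> g) (\<psi> g)" using eqm_mono[OF _ n(2)] \<mu>(2) \<mu>a a gc by (simp add: AutoGroup_mult_apply)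
    then have "N #> \<phi> g = N #> \<psi> g"
      using eqm_rcos(2)[OF fin_normalD(1)[OF N] auto_closed[OF a(1) gc] auto_closed[OF a(2) gc]] by blast
    then show ?thesis using aut_ext_apply[OF a(2) x N n g] by simp
  qed
  have "(THE e. \<exists>M\<in>fin_normal BH. \<forall>\<psi>\<in>h M. aut_ext G \<psi> x N = e) = N #> \<phi> g"
  proof (rule the_equality)
    show "\<exists>M\<in>fin_normal BH. \<forall>\<psi>\<in>h M. aut_ext G \<psi> x N = N #> \<phi> g" using val C by blast
    fix e assume "\<exists>M\<in>fin_normal BH. \<forall>\<psi>\<in>h M. aut_ext G \<psi> x N = e"
    then obtain M where M: "M \<in> fin_normal BH" "\<And>\<psi>. \<psi> \<in> h M \<Longrightarrow> aut_ext G \<psi> x N = e" by blast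
    have MC: "M \<inter> CH n \<in> fin_normal BH" by (rule B.fin_normal_Int[OF M(1) C])
    obtain \<psi> where "\<psi> \<in> h (M \<inter> CH n)" using B.profinite_nonempty[OF h MC] by blast
    then have "\<psi> \<in> h M" "\<psi> \<in> h (CH n)"
      using profinite_compat[OF h MC M(1)] profinite_compat[OF h MC C] by blast+
    then show "e = N #> \<phi> g" using M(2)[of \<psi>] val[of \<psi>] by simp
  qed
  then show ?thesis using x N by (simp add: completion_action_def)
qed

text \<open>Testing the action on the embedded elements of \<open>G\<close> shows that a
  representative of \<open>h\<close> at level \<open>CH n\<close> belongs to \<open>CH n\<close>; by
  cofinality all components of \<open>h\<close> are then trivial.\<close>

lemma congruence_kernel_trivial: "congruence_kernel G H = {\<one>\<^bsub>profinite_completion BH\<^esub>}"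
proof
  interpret B: group BH by (rule BH_group)
  show "congruence_kernel G H \<subseteq> {\<one>\<^bsub>profinite_completion BH\<^esub>}"
  proof
    fix h assume "h \<in> congruence_kernel G H"
    then have h: "h \<in> carrier (profinite_completion BH)"
      and triv: "completion_action G H h = (\<lambda>x\<in>carrier (profinite_completion G). x)"
      by (auto simp: congruence_kernel_def)
    have "h M = M" if M: "M \<in> fin_normal BH" for M
    proof -
      obtain n where n: "n > 0" "CH n \<subseteq> M" using CH_cofinal[OF M] by blast
      note C = CH_fin_normal[OF n(1)] and N = GP_fin_normal[OF n(1)]
      obtain \<phi> where \<phi>: "\<phi> \<in> h (CH n)" using B.profinite_nonempty[OF h C] by blast
      have \<phi>H: "\<phi> \<in> H" using B.profinite_rep(1)[OF h C \<phi>] by (simp add: BH_carrier)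
      then have a: "\<phi> \<in> auto G" using H_auto by blast
      have "eqm G (GP n) g (\<phi> g)" if g: "g \<in> carrier G" for g
      proof -
        let ?x = "profinite_emb G g"
        have x: "?x \<in> carrier (profinite_completion G)" by (rule profinite_emb_closed[OF g])
        have gx: "g \<in> ?x (GP n)" using rcos_self[OF g fin_normalD(2)[OF N]] by (simp add: profinite_emb_apply[OF N])
        have "GP n #> \<phi> g = completion_action G H h ?x (GP n)"
          using completion_action_apply[OF h x N n(1) order_refl gx \<phi>] by simp
        also have "\<dots> = GP n #> g" using triv x by (simp add: profinite_emb_apply[OF N])
        finally show ?thesis using eqm_rcos(2)[OF fin_normalD(1)[OF N] g auto_closed[OF a g]] by simp
      qed
      then have "\<phi> \<in> M" using n(2) \<phi>H a by (auto simp: CH_def cong_aut_def)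
      moreover have "\<phi> \<in> h M" using \<phi> profinite_compat[OF h C M n(2)] by blast
      then have "h M = M #>\<^bsub>BH\<^esub> \<phi>" by (rule B.profinite_rep(2)[OF h M])
      ultimately show ?thesis
        using B.coset_join2[OF _ B.fin_normalD(2)[OF M]] \<phi>H by (simp add: BH_carrier)
    qed
    then have "h = \<one>\<^bsub>profinite_completion BH\<^esub>"
      unfolding profinite_one using profinite_extensional[OF h]
      by (intro extensionalityI[of _ "fin_normal BH"]) auto
    then show "h \<in> {\<one>\<^bsub>profinite_completion BH\<^esub>}" by simp
  qed
  show "{\<one>\<^bsub>profinite_completion BH\<^esub>} \<subseteq> congruence_kernel G H"
  proof -
    let ?e = "\<one>\<^bsub>profinite_completion BH\<^esub>"
    have e: "?e \<in> carrier (profinite_completion BH)"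
      using subgroup.subgroup_in_rcosets[OF B.fin_normalD(2) BH_group]
      by (auto simp: profinite_completion_def)
    have "completion_action G H ?e x N = x N"
      if x: "x \<in> carrier (profinite_completion G)" and N: "N \<in> fin_normal G" for x N
    proof -
      obtain n where n: "n > 0" "GP n \<subseteq> N" using fin_normal_powers[OF N] by blast
      note C = CH_fin_normal[OF n(1)] and Nn = GP_fin_normal[OF n(1)]
      obtain g where g: "g \<in> x (GP n)" using profinite_nonempty[OF x Nn] by blast
      have gc: "g \<in> carrier G" by (rule profinite_rep[OF x Nn g])
      have "\<one>\<^bsub>AutoGroup G\<^esub> \<in> CH n" using subgroup.one_closed[OF CH_subgroup] by (simp add: BH_one)
      then have "\<one>\<^bsub>AutoGroup G\<^esub> \<in> ?e (CH n)" using C by (simp add: profinite_one)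
      then have "completion_action G H ?e x N = N #> g"
        using completion_action_apply[OF e x N n g] AutoGroup_one_apply[OF gc] by simp
      moreover have "g \<in> x N" using g profinite_compat[OF x Nn N n(2)] by blast
      ultimately show ?thesis using profinite_rep(2)[OF x N] by simp
    qed
    moreover have "completion_action G H ?e x \<in> extensional (fin_normal G)"
      if "x \<in> carrier (profinite_completion G)" for x
      using that by (simp add: completion_action_def)
    ultimately have "completion_action G H ?e x = x" if "x \<in> carrier (profinite_completion G)" for x
      using that profinite_extensional[OF that] by (intro extensionalityI[of _ "fin_normal G"]) auto
    then have "completion_action G H ?e = (\<lambda>x\<in>carrier (profinite_completion G). x)"
      by (intro extensionalityI[of _ "carrier (profinite_completion G)"]) (auto simp: completion_action_def)
    then show ?thesis using e by (simp add: congruence_kernel_def)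
  qed
qed

end

end

section \<open>Density\<close>

lemma group_homs_eq_generate:
  assumes "group_hom G H h" "group_hom G H h'" "S \<subseteq> carrier G"
    and "\<And>s. s \<in> S \<Longrightarrow> h s = h' s" and "g \<in> generate G S"
  shows "h g = h' g"
proof -
  interpret h: group_hom G H h by fact
  interpret h': group_hom G H h' by fact
  show ?thesis using assms(5)
  proof (induction rule: generate.induct)
    case (eng a b)
    have "a \<in> carrier G" "b \<in> carrier G" using eng h.G.generate_in_carrier[OF assms(3)] by auto
    then show ?case using eng by simp
  qed (use assms(3,4) in auto)
qed

lemma (in group) normal_Inter_finite:
  assumes "finite A" "A \<subseteq> fin_normal G" shows "\<exists>M\<in>fin_normal G. \<forall>N\<in>A. M \<subseteq> N"
  using assms
proof (induction A)
  case empty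
  have "carrier G \<in> fin_normal G"
    by (rule finite_reps_rcosets[OF normal_self, of "{\<one>}"]) auto
  then show ?case by blast
next
  case (insert N A)
  then obtain M where "M \<in> fin_normal G" "\<forall>N\<in>A. M \<subseteq> N" by auto
  then show ?case using fin_normal_Int[of M N] insert.prems by (intro bexI[of _ "M \<inter> N"]) auto
qed

lemma (in group) profinite_eq_mono:
  assumes x: "x \<in> carrier (profinite_completion G)" "y \<in> carrier (profinite_completion G)"
    and N: "N \<in> fin_normal G" "M \<in> fin_normal G" "N \<subseteq> M" and eq: "x N = y N"
  shows "x M = y M"
proof -
  obtain g where g: "g \<in> x N" using profinite_nonempty[OF x(1) N(1)] by blast
  then have "g \<in> x M" "g \<in> y M" using profinite_compat[OF x(1) N] profinite_compat[OF x(2) N] eq by blast+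
  then show ?thesis using profinite_rep(2)[OF x(1) N(2)] profinite_rep(2)[OF x(2) N(2)] by blast
qed

text \<open>A basic open set around \<open>x\<close> restricts finitely many components, and
  \<open>M\<close> lies in all the corresponding subgroups. \<open>M\<close> may depend on
  \<open>x\<close>.\<close>

lemma (in group) profinite_continuous:
  assumes cont: "continuous_map (profinite_topology G) (profinite_topology G) \<alpha>"
    and x: "x \<in> carrier (profinite_completion G)" and N: "N \<in> fin_normal G"
  shows "\<exists>M\<in>fin_normal G. \<forall>y\<in>carrier (profinite_completion G). y M = x M \<longrightarrow> \<alpha> y N = \<alpha> x N"
proof -
  let ?T = "\<lambda>N. discrete_topology (rcosets N)"
  let ?P = "product_topology ?T (fin_normal G)" and ?C = "carrier (profinite_completion G)"
  have sub: "?C \<subseteq> topspace ?P" by (auto simp: profinite_completion_def)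
  have top: "topspace (profinite_topology G) = ?C"
    using sub by (simp add: profinite_topology_def Int_absorb1)
  have \<alpha>C: "\<alpha> y \<in> ?C" if "y \<in> ?C" for y
    using continuous_map_funspace[OF cont] that top by auto
  have "continuous_map (profinite_topology G) (?T N) (\<lambda>z. z N)"
    unfolding profinite_topology_def
    by (rule continuous_map_from_subtopology[OF continuous_map_product_coordinates[OF N, of ?T]])
  then have cN: "continuous_map (profinite_topology G) (?T N) ((\<lambda>z. z N) \<circ> \<alpha>)"
    by (rule continuous_map_compose[OF cont])
  have oN: "openin (?T N) {\<alpha> x N}" using profinite_rcosets[OF \<alpha>C[OF x] N] by simp
  have "openin (profinite_topology G) {y \<in> ?C. ((\<lambda>z. z N) \<circ> \<alpha>) y \<in> {\<alpha> x N}}"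
    using openin_continuous_map_preimage[OF cN oN] unfolding top .
  then obtain U where U: "openin ?P U" "{y \<in> ?C. ((\<lambda>z. z N) \<circ> \<alpha>) y \<in> {\<alpha> x N}} = U \<inter> ?C"
    unfolding profinite_topology_def openin_subtopology by blast
  have xU: "x \<in> U" using U(2) x by auto
  obtain V where V: "x \<in> (\<Pi>\<^sub>E i\<in>fin_normal G. V i)" "finite {i. V i \<noteq> topspace (?T i)}"
    "(\<Pi>\<^sub>E i\<in>fin_normal G. V i) \<subseteq> U"
    using product_topology_open_contains_basis[OF U(1) xU] by (elim exE conjE) (rule that)
  obtain M where M: "M \<in> fin_normal G" "\<And>i. i \<in> fin_normal G \<Longrightarrow> V i \<noteq> topspace (?T i) \<Longrightarrow> M \<subseteq> i"
    using normal_Inter_finite[of "{i. V i \<noteq> topspace (?T i)} \<inter> fin_normal G"] V(2) by auto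
  have "\<alpha> y N = \<alpha> x N" if y: "y \<in> ?C" "y M = x M" for y
  proof -
    have "y i \<in> V i" if i: "i \<in> fin_normal G" for i
    proof (cases "V i = topspace (?T i)")
      case True
      then show ?thesis using profinite_rcosets[OF y(1) i] by simp
    next
      case False
      then have "y i = x i" using profinite_eq_mono[OF y(1) x M(1) i M(2)[OF i] y(2)] by blast
      then show ?thesis using V(1) i by auto
    qed
    then have "y \<in> (\<Pi>\<^sub>E i\<in>fin_normal G. V i)" using profinite_extensional[OF y(1)] by (simp add: PiE_iff)
    then have "y \<in> U \<inter> ?C" using V(3) y(1) by blast
    then show ?thesis using U(2) by auto
  qed
  then show ?thesis using M(1) by blast
qed

section \<open>A continuous automorphism seen in the finite quotients\<close>

context fg_nilpotent
begin

abbreviation R where "R \<equiv> tor_preimage G"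

context
  fixes \<alpha> assumes \<alpha>: "\<alpha> \<in> IA_star_hat G"
begin

text \<open>\<alpha> restricted to the image of \<open>G\<close> and reduced modulo
  \<open>N\<close>: a homomorphism from \<open>G\<close> to the finite group
  \<open>G Mod N\<close>.\<close>

definition psi :: "'a set \<Rightarrow> 'a \<Rightarrow> 'a set" where
  "psi N g = \<alpha> (profinite_emb G g) N"

lemma \<alpha>_auto: "\<alpha> \<in> auto (profinite_completion G)"
  using \<alpha> by (simp add: IA_star_hat_def cont_aut_def)

lemma \<alpha>_cont: "continuous_map (profinite_topology G) (profinite_topology G) \<alpha>"
  using \<alpha> by (simp add: IA_star_hat_def cont_aut_def)

lemma \<alpha>_closed: "x \<in> carrier (profinite_completion G) \<Longrightarrow> \<alpha> x \<in> carrier (profinite_completion G)"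
  using \<alpha>_auto by (auto simp: auto_def hom_def)

lemma psi_rcosets: "N \<in> fin_normal G \<Longrightarrow> g \<in> carrier G \<Longrightarrow> psi N g \<in> rcosets N"
  unfolding psi_def by (rule profinite_rcosets[OF \<alpha>_closed[OF profinite_emb_closed]])

lemma psi_mono:
  "N \<in> fin_normal G \<Longrightarrow> M \<in> fin_normal G \<Longrightarrow> N \<subseteq> M \<Longrightarrow> g \<in> carrier G \<Longrightarrow> psi N g \<subseteq> psi M g"
  unfolding psi_def by (rule profinite_compat[OF \<alpha>_closed[OF profinite_emb_closed]])

lemma psi_rep: "N \<in> fin_normal G \<Longrightarrow> g \<in> carrier G \<Longrightarrow> a \<in> psi N g \<Longrightarrow> psi N g = N #> a"
  using rcosets_rep(2)[OF fin_normalD(2) psi_rcosets] by blast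

lemma psi_hom:
  assumes N: "N \<in> fin_normal G" shows "group_hom G (G Mod N) (psi N)"
proof -
  have "psi N (g \<otimes> h) = psi N g <#> psi N h" if "g \<in> carrier G" "h \<in> carrier G" for g h
    using \<alpha>_auto profinite_emb_closed that profinite_mult[OF N]
    by (simp add: psi_def profinite_emb_mult auto_def hom_def)
  then show ?thesis
    using psi_rcosets[OF N] normal.factorgroup_is_group[OF fin_normalD(1)[OF N]] is_group
    by (auto simp: group_hom_def group_hom_axioms_def hom_def FactGroup_def)
qed

lemma quotient_hom: "N \<lhd> G \<Longrightarrow> group_hom G (G Mod N) (\<lambda>g. N #> g)"
  by (simp add: group_hom_def group_hom_axioms_def is_group normal.factorgroup_is_group normal.r_coset_hom_Mod)

text \<open>A preimage under \<alpha> exists in the completion; by continuity an element of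
  \<open>G\<close> close to it has the same component at \<open>N\<close>.\<close>

lemma psi_surj:
  assumes N: "N \<in> fin_normal G" and C: "C \<in> rcosets N"
  shows "\<exists>g\<in>carrier G. psi N g = C"
proof -
  obtain a where a: "a \<in> carrier G" "C = N #> a" using C by (auto simp: RCOSETS_def)
  have "profinite_emb G a \<in> \<alpha> ` carrier (profinite_completion G)"
    using \<alpha>_auto profinite_emb_closed[OF a(1)] by (auto simp: auto_def Bij_def bij_betw_def)
  then obtain x where x: "x \<in> carrier (profinite_completion G)" "profinite_emb G a = \<alpha> x" by blast
  obtain M where M: "M \<in> fin_normal G"
    "\<And>y. y \<in> carrier (profinite_completion G) \<Longrightarrow> y M = x M \<Longrightarrow> \<alpha> y N = \<alpha> x N"
    using profinite_continuous[OF \<alpha>_cont x(1) N] by blast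
  obtain g where g: "g \<in> x M" using profinite_nonempty[OF x(1) M(1)] by blast
  note gx = profinite_rep[OF x(1) M(1) g]
  have "psi N g = \<alpha> x N"
    unfolding psi_def using gx M(1) by (intro M(2) profinite_emb_closed) (simp_all add: profinite_emb_apply)
  also have "\<dots> = C" using x(2) a(2) profinite_emb_apply[OF N, of a] by simp
  finally show ?thesis using gx(1) by blast
qed

lemma star_fin_normal:
  assumes N: "N \<in> fin_normal G" "R \<subseteq> N"
  shows "(\<lambda>g. R #> g) ` N \<in> fin_normal (Gstar G)" "\<Union>((\<lambda>g. R #> g) ` N) = N"
proof -
  note Nn = fin_normalD(1)[OF N(1)] and Nsg = fin_normalD(2)[OF N(1)]
  interpret Q: group "Gstar G"
    unfolding Gstar_def by (rule normal.factorgroup_is_group[OF tor_preimage_normal])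
  interpret p: group_hom G "Gstar G" "\<lambda>g. R #> g"
    unfolding Gstar_def by (rule quotient_hom[OF tor_preimage_normal])
  have surj: "(\<lambda>g. R #> g) ` carrier G = carrier (Gstar G)"
    unfolding Gstar_def carrier_FactGroup ..
  have nrm: "(\<lambda>g. R #> g) ` N \<lhd> Gstar G"
    by (rule normal.surj_hom_normal_subgroup[OF Nn p.group_hom_axioms surj])
  obtain T where T: "finite T" "T \<subseteq> carrier G" "\<And>x. x \<in> carrier G \<Longrightarrow> \<exists>a\<in>T. inv a \<otimes> x \<in> N"
    using fin_normal_finite_reps[OF N(1)] by blast
  show "(\<lambda>g. R #> g) ` N \<in> fin_normal (Gstar G)"
  proof (rule Q.finite_reps_rcosets[OF nrm, of "(\<lambda>g. R #> g) ` T"])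
    show "finite ((\<lambda>g. R #> g) ` T)" using T by simp
    show "(\<lambda>g. R #> g) ` T \<subseteq> carrier (Gstar G)" using T(2) p.hom_closed by blast
    fix C assume "C \<in> carrier (Gstar G)"
    then obtain x where x: "x \<in> carrier G" "C = R #> x" using surj by blast
    obtain a where a: "a \<in> T" "inv a \<otimes> x \<in> N" using T(3)[OF x(1)] by blast
    have ac: "a \<in> carrier G" using a T by blast
    have "inv\<^bsub>Gstar G\<^esub> (R #> a) \<otimes>\<^bsub>Gstar G\<^esub> C = R #> (inv a \<otimes> x)"
      using ac x p.hom_mult[of "inv a" x] p.hom_inv[OF ac] by simp
    then show "\<exists>b\<in>(\<lambda>g. R #> g) ` T. inv\<^bsub>Gstar G\<^esub> b \<otimes>\<^bsub>Gstar G\<^esub> C \<in> (\<lambda>g. R #> g) ` N"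
      using a by blast
  qed
  show "\<Union>((\<lambda>g. R #> g) ` N) = N"
  proof
    show "\<Union>((\<lambda>g. R #> g) ` N) \<subseteq> N"
      using N(2) subgroup.m_closed[OF Nsg] by (auto simp: r_coset_def)
    show "N \<subseteq> \<Union>((\<lambda>g. R #> g) ` N)"
      using rcos_self[OF _ tor_preimage_subgroup] subgroup.mem_carrier[OF Nsg] by blast
  qed
qed

text \<open>The levels \<open>N\<close> containing \<open>R\<close> come from the finite quotients
  of \<open>Gstar G\<close>, on whose completion \<alpha> acts trivially.\<close>

lemma psi_trivial_mod_R:
  assumes N: "N \<in> fin_normal G" "R \<subseteq> N" and g: "g \<in> carrier G"
  shows "psi N g = N #> g"
proof -
  let ?Q = "(\<lambda>g. R #> g) ` N" and ?x = "profinite_emb G g"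
  note Q = star_fin_normal[OF N]
  note x = profinite_emb_closed[OF g]
  have "star_proj G (\<alpha> ?x) = star_proj G ?x" using \<alpha> x by (simp add: IA_star_hat_def)
  then have "star_proj G (\<alpha> ?x) ?Q = star_proj G ?x ?Q" by simp
  then have eq: "{c \<in> carrier (Gstar G). c \<subseteq> psi N g} = {c \<in> carrier (Gstar G). c \<subseteq> N #> g}"
    using Q x \<alpha>_closed[OF x] profinite_emb_apply[OF N(1), of g] by (simp add: star_proj_def psi_def)
  have "R #> g \<in> carrier (Gstar G)" unfolding Gstar_def carrier_FactGroup using g by blast
  moreover have "R #> g \<subseteq> N #> g" using N(2) by (auto simp: r_coset_def)
  ultimately have "R #> g \<subseteq> psi N g" using eq by blast
  then have "g \<in> psi N g" using rcos_self[OF g tor_preimage_subgroup] by blast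
  then show ?thesis by (rule psi_rep[OF N(1) g])
qed

text \<open>Triviality holds at the level \<open>R <#> N\<close>, which gives
  \<open>inv a \<otimes> g = r \<otimes> m\<close>. Then \<open>g \<otimes> inv r\<close> is
  congruent to \<open>g\<close> modulo \<open>R\<close> and to \<open>a\<close> modulo
  \<open>N\<close>.\<close>

lemma psi_meets_R_coset:
  assumes N: "N \<in> fin_normal G" and g: "g \<in> carrier G"
  shows "\<exists>a\<in>psi N g. eqm G R g a"
proof -
  note Nn = fin_normalD(1)[OF N] and Nsg = fin_normalD(2)[OF N]
  have RN: "R <#> N \<lhd> G" by (rule normal_subgroup_set_mult_closed[OF tor_preimage_normal Nn])
  have NR: "N \<subseteq> R <#> N" "R \<subseteq> R <#> N"
  proof -
    show "N \<subseteq> R <#> N"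
    proof
      fix a assume a: "a \<in> N"
      then have "a = \<one> \<otimes> a" using subgroup.mem_carrier[OF Nsg] by simp
      then show "a \<in> R <#> N" using a subgroup.one_closed[OF tor_preimage_subgroup] unfolding set_mult_def by blast
    qed
    show "R \<subseteq> R <#> N"
    proof
      fix a assume a: "a \<in> R"
      then have "a = a \<otimes> \<one>" using subgroup.mem_carrier[OF tor_preimage_subgroup] by simp
      then show "a \<in> R <#> N" using a subgroup.one_closed[OF Nsg] unfolding set_mult_def by blast
    qed
  qed
  obtain n where "n > 0" "GP n \<subseteq> N" using fin_normal_powers[OF N] by blast
  then have RNf: "R <#> N \<in> fin_normal G" using fin_normalI[OF RN] NR(1) by blast
  obtain a where a: "a \<in> psi N g"
    using subgroup.rcosets_non_empty[OF Nsg psi_rcosets[OF N g]] by blast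
  have ac: "a \<in> carrier G" using rcosets_rep(1)[OF Nsg psi_rcosets[OF N g] a] .
  have "a \<in> (R <#> N) #> g"
    using a psi_mono[OF N RNf NR(1) g] psi_trivial_mod_R[OF RNf NR(2) g] by blast
  then have "eqm G (R <#> N) a g"
    using eqm_rcos(1)[OF RN g ac] eqm_sym[OF normal_imp_subgroup[OF RN]] by blast
  then obtain r m where rm: "r \<in> R" "m \<in> N" "inv a \<otimes> g = r \<otimes> m" by (auto simp: eqm_def set_mult_def)
  have c: "r \<in> carrier G" "m \<in> carrier G"
    using rm subgroup.mem_carrier[OF Nsg] subgroup.mem_carrier[OF tor_preimage_subgroup] by auto
  have gar: "g = a \<otimes> (r \<otimes> m)" using rm(3) ac g inv_cancel(1)[of a g] by simp
  let ?b = "g \<otimes> inv r"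
  have "eqm G N a ?b"
  proof -
    have "r \<otimes> m \<otimes> inv r \<in> N" by (rule normal.inv_op_closed2[OF Nn c(1) rm(2)])
    then show ?thesis using ac c by (simp add: eqm_def gar m_assoc)
  qed
  then have "?b \<in> N #> a" using eqm_rcos(1)[OF Nn ac] g c by simp
  then have "?b \<in> psi N g" using psi_rep[OF N g a] by simp
  moreover have "eqm G R g ?b"
    using g c subgroup.m_inv_closed[OF tor_preimage_subgroup rm(1)] by (simp add: eqm_def)
  ultimately show ?thesis by blast
qed

text \<open>Positivity of \<open>m\<close> is included because \<open>GP 0\<close> is the trivial
  subgroup, which may have infinite index, and \<open>psi\<close> is meaningful only at levels in
  \<open>fin_normal G\<close>.\<close>

definition AT :: "nat \<Rightarrow> ('a \<Rightarrow> 'a) set" where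
  "AT m = {t \<in> TS. m > 0 \<and> (\<forall>s\<in>S. t s \<in> psi (GP m) s)}"

lemma S_closed: "s \<in> S \<Longrightarrow> s \<in> carrier G"
  using S by blast

lemma AT_mono: "m dvd m' \<Longrightarrow> AT m' \<subseteq> AT m"
proof
  fix t assume m: "m dvd m'" and t: "t \<in> AT m'"
  then have "m' > 0" "m > 0" by (auto simp: AT_def dest: dvd_pos_nat)
  then have "psi (GP m') s \<subseteq> psi (GP m) s" if "s \<in> S" for s
    using psi_mono[OF GP_fin_normal GP_fin_normal powers_dvd[OF order_refl m] S_closed[OF that]] by blast
  then show "t \<in> AT m" using t \<open>m > 0\<close> unfolding AT_def by blast
qed

lemma AT_near:
  assumes t: "t \<in> AT m" "t' \<in> TS" and near: "\<And>s. s \<in> S \<Longrightarrow> eqm G (GP m) (t s) (t' s)"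
  shows "t' \<in> AT m"
proof -
  have m: "m > 0" using t by (simp add: AT_def)
  note N = GP_fin_normal[OF m]
  have "t' s \<in> psi (GP m) s" if s: "s \<in> S" for s
  proof -
    have "t s \<in> psi (GP m) s" using t s by (simp add: AT_def)
    then have "psi (GP m) s = GP m #> t s" by (rule psi_rep[OF N S_closed[OF s]])
    then show ?thesis
      using near[OF s] eqm_rcos(1)[OF fin_normalD(1)[OF N]] eqm_carrier[OF near[OF s]] by blast
  qed
  then show ?thesis using t(2) m by (simp add: AT_def)
qed

text \<open>Evaluation at \<open>base\<close> followed by \<open>psi\<close>, and evaluation at
  \<open>t\<close> modulo \<open>GP m\<close>, are homomorphisms on words that agree on the
  coordinates. Homomorphisms respect the lower central series, so the value at \<open>t\<close> is
  congruent to an element of \<open>L k\<close>.\<close>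

lemma AT_words:
  assumes m: "m > 0" and t: "t \<in> AT m" and w: "w \<in> carrier F" "w base \<in> L k"
  shows "\<exists>l\<in>L k. eqm G (GP m) l (w t)"
proof -
  note N = GP_fin_normal[OF m]
  note Nn = fin_normalD(1)[OF N]
  have tT: "t \<in> TS" using t by (simp add: AT_def)
  interpret p: group_hom G "G Mod GP m" "psi (GP m)" by (rule psi_hom[OF N])
  interpret q: group_hom G "G Mod GP m" "\<lambda>g. GP m #> g" by (rule quotient_hom[OF Nn])
  interpret b: group_hom F G "\<lambda>w. w base" by (rule eval_hom[OF base_tuple])
  interpret e: group_hom F G "\<lambda>w. w t" by (rule eval_hom[OF tT])
  have h1: "group_hom F (G Mod GP m) (\<lambda>w. psi (GP m) (w base))"
    using b.hom_mult p.hom_mult b.hom_closed p.hom_closed words_group p.is_group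
    by (auto simp: group_hom_def group_hom_axioms_def hom_def p.H.is_group)
  have h2: "group_hom F (G Mod GP m) (\<lambda>w. GP m #> w t)"
    using e.hom_mult q.hom_mult e.hom_closed q.hom_closed words_group
    by (auto simp: group_hom_def group_hom_axioms_def hom_def p.H.is_group)
  have "psi (GP m) (v base) = GP m #> v t" if v: "v \<in> coord G S ` S" for v
  proof -
    obtain s where s: "s \<in> S" "v = coord G S s" using v by blast
    have "t s \<in> psi (GP m) s" using t s by (simp add: AT_def)
    then have "psi (GP m) s = GP m #> t s" by (rule psi_rep[OF N S_closed[OF s(1)]])
    then show ?thesis using s coord_apply[OF base_tuple, of s] coord_apply[OF tT, of s] by (simp add: base_def)
  qed
  then have eq: "psi (GP m) (w base) = GP m #> w t"
    using group_homs_eq_generate[OF h1 h2, of "coord G S ` S" w] w(1) words_generate coord_word by auto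
  have "psi (GP m) (w base) \<in> lower_central (G Mod GP m) k" by (rule p.lower_central_img_subset[OF w(2)])
  also have "\<dots> = (\<lambda>g. GP m #> g) ` L k" using q.lower_central_img by (simp add: carrier_FactGroup)
  finally obtain l where l: "l \<in> L k" "GP m #> w t = GP m #> l" using eq by auto
  then have "eqm G (GP m) l (w t)"
    using eqm_rcos(2)[OF Nn lower_central_closed[OF l(1)] e.hom_closed[OF w(1)]] by simp
  then show ?thesis using l(1) by blast
qed

lemma AT_tuple:
  assumes m: "m > 0" shows "\<exists>t\<in>AT m. \<forall>s\<in>S. eqm G R s (t s)"
proof -
  have "\<forall>s\<in>S. \<exists>a. a \<in> psi (GP m) s \<and> eqm G R s a"
    using psi_meets_R_coset[OF GP_fin_normal[OF m] S_closed] by blast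
  then obtain f where f: "\<And>s. s \<in> S \<Longrightarrow> f s \<in> psi (GP m) s" "\<And>s. s \<in> S \<Longrightarrow> eqm G R s (f s)" by metis
  have "(\<lambda>s\<in>S. f s) \<in> AT m"
    using m f tupleI[of f] eqm_carrier(2)[OF f(2)] by (simp add: AT_def)
  then show ?thesis using f(2) by (intro bexI[of _ "\<lambda>s\<in>S. f s"]) auto
qed

text \<open>Two approximations of \<open>\<alpha>\<close> that are close enough agree modulo commutators, because the
  torsion of the abelianization is finite; this provides the tuple \<open>t0\<close> of the stages.\<close>

lemma approximation_exists:
  assumes N: "N \<in> fin_normal G"
  shows "\<exists>\<phi>\<in>IA_star G. \<forall>x\<in>carrier (profinite_completion G). aut_ext G \<phi> x N = \<alpha> x N"
proof -
  obtain n1 where n1: "n1 > 0" "R \<inter> GP n1 \<subseteq> L 1" using tor_preimage_separation[OF polycyclic_G] by blast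
  note Rsg = tor_preimage_subgroup and Lsg = lower_central_subgroup[of 1]
  obtain t0 where tz: "t0 \<in> AT n1" "\<And>s. s \<in> S \<Longrightarrow> eqm G R s (t0 s)" using AT_tuple[OF n1(1)] by blast
  have t0T: "t0 \<in> TS" using tz(1) by (simp add: AT_def)
  have close: "eqm G (L 1) (t0 s) (t s)"
    if t: "t \<in> AT n1" "\<And>s. s \<in> S \<Longrightarrow> eqm G R s (t s)" and s: "s \<in> S" for t s
  proof -
    note M = GP_fin_normal[OF n1(1)]
    have "t0 s \<in> psi (GP n1) s" "t s \<in> psi (GP n1) s" using t(1) tz(1) s by (auto simp: AT_def)
    then have "t s \<in> GP n1 #> t0 s" using psi_rep[OF M S_closed[OF s]] by blast
    then have "eqm G (GP n1) (t0 s) (t s)"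
      using eqm_rcos(1)[OF fin_normalD(1)[OF M]] eqm_carrier(2)[OF t(2)[OF s]] eqm_carrier(2)[OF tz(2)[OF s]] by blast
    moreover have "eqm G R (t0 s) (t s)"
      using eqm_trans[OF Rsg eqm_sym[OF Rsg tz(2)[OF s]] t(2)[OF s]] .
    ultimately show ?thesis using n1(2) by (auto simp: eqm_def)
  qed
  have approx: "\<exists>t\<in>AT m. \<forall>s\<in>S. eqm G (L 1) (t0 s) (t s)" if m: "m > 0" for m
  proof -
    obtain t where t: "t \<in> AT (m * n1)" "\<And>s. s \<in> S \<Longrightarrow> eqm G R s (t s)" using AT_tuple[of "m * n1"] m n1 by auto
    then have "t \<in> AT m" "t \<in> AT n1" using AT_mono[of m "m * n1"] AT_mono[of n1 "m * n1"] by auto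
    then show ?thesis using close t(2) by blast
  qed
  \<comment> \<open>\<open>?B\<close> contains all commutators, hence is normal. It contains
    \<open>GP r\<close>, as each \<open>s\<close> differs from \<open>t0 s\<close> by torsion, hence
    has finite index. Then \<open>psi ?B\<close> is both surjective and trivial on the generators,
    which leaves only \<open>?B = carrier G\<close>.\<close>
  have gen: "generate G (t0 ` S) = carrier G"
  proof (rule nilpotent_generate[OF _ _ _ c])
    show "finite (t0 ` S)" using S by simp
    show sub: "t0 ` S \<subseteq> carrier G" using tuple_closed[OF t0T] by blast
    let ?B = "generate G (t0 ` S \<union> L 1)"
    have B: "subgroup ?B G" using sub lower_central_closed by (intro generate_is_subgroup) blast
    have LB: "L 1 \<subseteq> ?B" and t0B: "\<And>s. s \<in> S \<Longrightarrow> t0 s \<in> ?B" by (auto intro: generate.incl)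
    have memB: "b \<in> ?B" if "eqm G (L 1) a b" "a \<in> ?B" for a b
      using eqm_mem[OF B eqm_mono[OF that(1) LB] that(2)] .
    have Bn: "?B \<lhd> G"
      unfolding normal_inv_iff
    proof (intro conjI ballI B)
      fix u h assume u: "u \<in> carrier G" and h: "h \<in> ?B"
      have "eqm G (L 1) (u \<otimes> h \<otimes> inv u) h"
        using eqm_central[of h 0 u] u subgroup.mem_carrier[OF B h] by simp
      then show "u \<otimes> h \<otimes> inv u \<in> ?B" using memB[OF eqm_sym[OF Lsg] h] by blast
    qed
    obtain r where r: "r > 0" "\<And>x. x \<in> R \<Longrightarrow> x [^] (r::nat) \<in> L 1"
      using tor_preimage_exponent[OF polycyclic_G] by blast
    let ?D = "{g \<in> carrier G. g [^] r \<in> ?B}"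
    have D: "subgroup ?D G"
    proof (rule subgroupI)
      have "\<one> \<in> ?D" using subgroup.one_closed[OF B] by simp
      then show "?D \<noteq> {}" by blast
      show "inv a \<in> ?D" if "a \<in> ?D" for a using that subgroup.m_inv_closed[OF B] by (simp add: nat_pow_inv)
      show "a \<otimes> b \<in> ?D" if ab: "a \<in> ?D" "b \<in> ?D" for a b
      proof -
        have "a [^] r \<otimes> b [^] r \<in> ?B" using ab subgroup.m_closed[OF B] by simp
        moreover have "eqm G (L 1) (a [^] r \<otimes> b [^] r) ((a \<otimes> b) [^] r)"
          using eqm_sym[OF Lsg eqm_pow_mult[of a b r]] ab by simp
        ultimately show ?thesis using memB ab by simp
      qed
    qed auto
    have "s \<in> ?D" if s: "s \<in> S" for s
    proof -
      have "eqm G R (t0 s) s" using eqm_sym[OF Rsg tz(2)[OF s]] .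
      then have x: "inv (t0 s) \<otimes> s \<in> R" by (simp add: eqm_def)
      have "t0 s [^] r \<in> ?B" using subgroup_nat_pow_closed[OF B t0B[OF s]] .
      then have "t0 s \<in> ?D" using tuple_closed[OF t0T s] by simp
      moreover have "inv (t0 s) \<otimes> s \<in> ?D" using r(2)[OF x] LB subgroup.mem_carrier[OF Rsg x] by auto
      ultimately have "t0 s \<otimes> (inv (t0 s) \<otimes> s) \<in> ?D" by (rule subgroup.m_closed[OF D])
      then show ?thesis using tuple_closed[OF t0T s] S_closed[OF s] by simp
    qed
    then have "carrier G \<subseteq> ?D" using generate_subgroup_incl[OF _ D, of S] S(3) by blast
    then have rB: "GP r \<subseteq> ?B" by (intro powers_subset[OF B]) auto
    then have Bf: "?B \<in> fin_normal G" by (rule fin_normalI[OF Bn r(1)])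
    interpret p: group_hom G "G Mod ?B" "psi ?B" by (rule psi_hom[OF Bf])
    \<comment> \<open>\<open>t0\<close> approximates \<alpha> only to level \<open>n1\<close>. A
      tuple at level \<open>r\<close> in the same class modulo commutators still has its entries in
      \<open>?B\<close>.\<close>
    obtain t where t: "t \<in> AT r" "\<And>s. s \<in> S \<Longrightarrow> eqm G (L 1) (t0 s) (t s)" using approx[OF r(1)] by blast
    have "psi ?B s = \<one>\<^bsub>G Mod ?B\<^esub>" if s: "s \<in> S" for s
    proof -
      have "t s \<in> psi ?B s"
        using t(1) s psi_mono[OF GP_fin_normal[OF r(1)] Bf rB S_closed[OF s]] by (auto simp: AT_def)
      then have "psi ?B s = ?B #> t s" by (rule psi_rep[OF Bf S_closed[OF s]])
      also have "\<dots> = ?B"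
        using memB[OF t(2)[OF s] t0B[OF s]] eqm_carrier(2)[OF t(2)[OF s]] by (intro coset_join2[OF _ B])
      finally show ?thesis by simp
    qed
    moreover have "group_hom G (G Mod ?B) (\<lambda>_. \<one>\<^bsub>G Mod ?B\<^esub>)"
      unfolding group_hom_def group_hom_axioms_def
      using is_group p.H.is_group trivial_hom[OF p.H.is_group] by blast
    ultimately have triv: "psi ?B g = ?B" if "g \<in> carrier G" for g
      using group_homs_eq_generate[OF p.group_hom_axioms _ S(2), of "\<lambda>_. \<one>\<^bsub>G Mod ?B\<^esub>" g] S(3) that by simp
    have "g \<in> ?B" if g: "g \<in> carrier G" for g
    proof -
      have "?B #> g \<in> rcosets ?B" using rcosetsI[OF subgroup.subset[OF B] g] .
      then have "?B #> g = ?B" using psi_surj[OF Bf] triv by blast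
      then show ?thesis using rcos_self[OF g B] by blast
    qed
    then show "?B = carrier G" using subgroup.subset[OF B] by blast
  qed
  interpret tuple_stages G S c t0 by unfold_locales (use t0T gen in auto)
  obtain n where n: "n > 0" "GP n \<subseteq> N" using fin_normal_powers[OF N] by blast
  have "\<exists>t\<in>stage c. t \<in> AT n"
  proof (rule stage_dense[where A = AT])
    show "\<exists>t\<in>start. t \<in> AT m" if "m > 0" for m
      using approx[OF that] unfolding start_def AT_def by blast
    show "AT m' \<subseteq> AT m" if "m dvd m'" for m m' by (rule AT_mono[OF that])
    show "t' \<in> AT m" if "t \<in> AT m" "t' \<in> TS" "\<And>s. s \<in> S \<Longrightarrow> eqm G (GP m) (t s) (t' s)" for m t t'
      by (rule AT_near[OF that])
    show "\<exists>l\<in>L k. eqm G (GP m) l (w t)" if "m > 0" "t \<in> AT m" "w \<in> carrier F" "w base \<in> L k" for m t w k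
      by (rule AT_words[OF that])
  qed (rule n(1))
  then obtain t where t: "t \<in> stage c" "t \<in> AT n" by blast
  obtain \<phi> where \<phi>: "\<phi> \<in> auto G" "\<And>s. s \<in> S \<Longrightarrow> \<phi> s = t s" using stage_automorphism[OF t(1)] by blast
  have id: "group_hom G G (\<lambda>x. x)" by (simp add: group_hom_def group_hom_axioms_def is_group hom_def)
  have "eqm G R g (\<phi> g)" if g: "g \<in> carrier G" for g
  proof -
    have "eqm G R s (\<phi> s)" if s: "s \<in> S" for s
    proof -
      have "eqm G (L 1) (t0 s) (t s)" using stageD(1)[OF t(1)] s by (simp add: start_def)
      then have "eqm G R (t0 s) (t s)" by (rule eqm_mono[OF _ derived_subset_tor_preimage])
      then show ?thesis using eqm_trans[OF Rsg tz(2)[OF s]] \<phi>(2)[OF s] by simp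
    qed
    then show ?thesis
      using eqm_homs_generate[OF id autoE(1)[OF \<phi>(1)] tor_preimage_normal S(2), of g] S(3) g by simp
  qed
  then have "R #> \<phi> g = R #> g" if "g \<in> carrier G" for g
    using eqm_rcos(2)[OF tor_preimage_normal that auto_closed[OF \<phi>(1) that]] that by simp
  then have "\<phi> \<in> IA_star G" using \<phi>(1) by (simp add: IA_star_def)
  moreover have "aut_ext G \<phi> x N = \<alpha> x N" if x: "x \<in> carrier (profinite_completion G)" for x
  proof -
    \<comment> \<open>\<open>M\<close> depends on \<open>x\<close>, but \<phi> does not: it is fixed
      by the classes of its values on the generators modulo \<open>N\<close>.\<close>
    obtain M where M: "M \<in> fin_normal G"
      "\<And>y. y \<in> carrier (profinite_completion G) \<Longrightarrow> y M = x M \<Longrightarrow> \<alpha> y N = \<alpha> x N"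
      using profinite_continuous[OF \<alpha>_cont x N] by blast
    note Nn = GP_fin_normal[OF n(1)]
    have K: "M \<inter> GP n \<in> fin_normal G" by (rule fin_normal_Int[OF M(1) Nn])
    obtain g where g: "g \<in> x (M \<inter> GP n)" using profinite_nonempty[OF x K] by blast
    have gM: "g \<in> x M" and gn: "g \<in> x (GP n)"
      using g profinite_compat[OF x K M(1)] profinite_compat[OF x K Nn] by blast+
    note gx = profinite_rep[OF x M(1) gM]
    have "psi N g = \<alpha> x N"
      unfolding psi_def using gx M(1) by (intro M(2) profinite_emb_closed) (simp_all add: profinite_emb_apply)
    moreover have "psi N g = N #> \<phi> g"
    proof -
      interpret p: group_hom G G \<phi> by (rule autoE(1)[OF \<phi>(1)])
      interpret q: group_hom G "G Mod N" "\<lambda>g. N #> g" by (rule quotient_hom[OF fin_normalD(1)[OF N]])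
      have h: "group_hom G (G Mod N) (\<lambda>g. N #> \<phi> g)"
        using p.hom_mult p.hom_closed q.hom_mult q.hom_closed q.H.is_group is_group
        by (auto simp: group_hom_def group_hom_axioms_def hom_def)
      have "psi N s = N #> \<phi> s" if s: "s \<in> S" for s
      proof -
        have "t s \<in> psi N s"
          using t(2) s psi_mono[OF Nn N n(2) S_closed[OF s]] by (auto simp: AT_def)
        then show ?thesis using psi_rep[OF N S_closed[OF s]] \<phi>(2)[OF s] by simp
      qed
      then show ?thesis using group_homs_eq_generate[OF psi_hom[OF N] h S(2), of g] S(3) gx(1) by simp
    qed
    ultimately show ?thesis using aut_ext_apply[OF \<phi>(1) x N n gn] by simp
  qed
  ultimately show ?thesis by blast
qed

end

end

text \<open>Density is meant for the congruence topology on automorphisms: a basic neighbourhood of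
  \<alpha> consists of those that agree with it modulo \<open>N\<close> at all points
  \<open>x\<close> simultaneously. One \<open>N\<close> at a time suffices, since finite
  intersections of levels are levels.\<close>

theorem theorem1p4:
  fixes \<Gamma> :: "('a, 'b) monoid_scheme"
  assumes "group \<Gamma>" and "finitely_generated \<Gamma>" and "nilpotent \<Gamma>"
  shows "(\<forall>G. subgroup G (AutoGroup \<Gamma>) \<and> G \<subseteq> IA_star \<Gamma> \<longrightarrow>
            congruence_kernel \<Gamma> G = {\<one>\<^bsub>profinite_completion (aut_subgroup \<Gamma> G)\<^esub>})
       \<and> (\<forall>\<alpha>\<in>IA_star_hat \<Gamma>. \<forall>N\<in>fin_normal \<Gamma>. \<exists>\<phi>\<in>IA_star \<Gamma>.
            \<forall>x\<in>carrier (profinite_completion \<Gamma>). aut_ext \<Gamma> \<phi> x N = \<alpha> x N)"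
proof -
  obtain S where S: "finite S" "S \<subseteq> carrier \<Gamma>" "generate \<Gamma> S = carrier \<Gamma>"
    using assms(2) by (auto simp: finitely_generated_def)
  obtain c where c: "lower_central \<Gamma> c = {\<one>\<^bsub>\<Gamma>\<^esub>}" using assms(3) by (auto simp: nilpotent_def)
  interpret fg_nilpotent \<Gamma> S c
    using assms(1) S c by (simp add: fg_nilpotent_def fg_nilpotent_axioms_def)
  show ?thesis using congruence_kernel_trivial approximation_exists by blast
qed

end
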